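(* Let $1\le p<2$. There are constants $c_0,c_1,c_2,c_3>0$ such that for all $n,N\in\mathbb{N}$ with $c_0\sqrt{N}\le n\le c_1 N$, $$ c_2\, n^{-2/p}N^{2/p-1}\le e_n^q(S_N,\mathcal{B}_p^N)\le c_3\, n^{-2/p}N^{2/p-1}\max\big(\log(n/\sqrt{N}),1\big)^{2/p-1}. $$
   Context: Throughout, $\log=\log_2$, $\mathbb{N}=\{1,2,\dots\}$, $\mathbb{N}_0=\mathbb{N}\cup\{0\}$, and $\mathbb{Z}[0,N)=\{0,\dots,N-1\}$. Quantum model. Let $D,K$ be nonempty sets, $F$ a nonempty set of functions $D\to K$, $G$ a normed space over $\mathbb{R}$ or $\mathbb{C}$, and $S:F\to G$. Let $H_m=(\mathbb{C}^2)^{\otimes m}$ with canonical basis $|i\rangle$, $i\in\mathbb{Z}[0,2^m)$ (via binary expansion). A quantum query is a tuple $Q=(m,m',m'',Z,\tau,\beta)$ with $m,m',m''\in\mathbb{N}$, $m'+m''\le m$, $\emptyset\ne Z\subseteq\mathbb{Z}[0,2^{m'})$, $\tau:Z\to D$, $\beta:K\to\mathbb{Z}[0,2^{m''})$. For $f\in F$ the unitary $Q_f$ on $H_m=H_{m'}\otimes H_{m''}\otimes H_{m-m'-m''}$ is given on basis states by $Q_f|i\rangle|x\rangle|y\rangle=|i\rangle|x\oplus\beta(f(\tau(i)))\rangle|y\rangle$ if $i\in Z$ and $Q_f|i\rangle|x\rangle|y\rangle=|i\rangle|x\rangle|y\rangle$ otherwise, where $\oplus$ is addition mod $2^{m''}$.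 A quantum algorithm with no measurement is $(Q,(U_j)_{j=0}^n)$ with $n\in\mathbb{N}_0$ and unitaries $U_j$ on $H_{m}$, $m=m(Q)$; it defines $A_f=U_nQ_fU_{n-1}\cdots U_1Q_fU_0$ and uses $n$ queries; $A_f(x,y)$ denotes its matrix entries in the canonical basis. A quantum algorithm from $F$ to $G$ with $k\in\mathbb{N}$ measurements is $A=((A_\ell)_{\ell=0}^{k-1},(b_\ell)_{\ell=0}^{k-1},\varphi)$, where each $A_\ell$ is an algorithm with no measurement on $m_\ell$ qubits, $b_0\in\mathbb{Z}[0,2^{m_0})$, $b_\ell:\prod_{i<\ell}\mathbb{Z}[0,2^{m_i})\to\mathbb{Z}[0,2^{m_\ell})$ for $1\le\ell\le k-1$, and $\varphi:\prod_{\ell<k}\mathbb{Z}[0,2^{m_\ell})\to G$. Its output on $f$ is the probability measure $A(f)$ on $G$ which is the distribution of $\varphi(x_0,\dots,x_{k-1})$, where $(x_0,\dots,x_{k-1})$ has probability $\prod_{\ell=0}^{k-1}|A_{\ell,f}(x_\ell,b_\ell(x_0,\dots,x_{\ell-1}))|^2$ (with $b_0$ a constant). Its number of queries is $n_q(A)=\sum_\ell n_q(A_\ell)$. For a random variable $\zeta$ with distribution $A(f)$, let $e(S,A,f)=\inf\{\varepsilon:\ \mathbf{P}\{\|S(f)-\zeta\|>\varepsilon\}\le 1/4\}$, $e(S,A,F)=\sup_{f\in F}e(S,A,f)$, and the $n$-th minimal query error is $e_n^q(S,F)=\inf\{e(S,A,F): A \text{ a quantum algorithm from } F \text{ to } G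 \text{ with } n_q(A)\le n\}$. Summation setting. For $N\in\mathbb{N}$, $D=\mathbb{Z}[0,N)$, $K=G=\mathbb{R}$. For $1\le p<\infty$, $L_p^N$ is the space of functions $f:\mathbb{Z}[0,N)\to\mathbb{R}$ with norm $\|f\|_{L_p^N}=\big(\frac1N\sum_{i=0}^{N-1}|f(i)|^p\big)^{1/p}$; $\mathcal{B}_p^N=\{f\in L_p^N:\|f\|_{L_p^N}\le 1\}$; and $S_N f=\frac1N\sum_{i=0}^{N-1}f(i)$. *)

theory Defs
  imports Complex_Main
begin

text \<open>Square complex matrices on H_m are represented as functions nat => nat => complex,
  only the entries with indices < 2^m being relevant. Entry (a,b) = row a, column b,
  i.e. <a| M |b>.\<close>

definition mat_mult :: "nat \<Rightarrow> (nat \<Rightarrow> nat \<Rightarrow> complex) \<Rightarrow> (nat \<Rightarrow> nat \<Rightarrow> complex)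
    \<Rightarrow> (nat \<Rightarrow> nat \<Rightarrow> complex)" where
  "mat_mult d A B = (\<lambda>i j. \<Sum>k<d. A i k * B k j)"

definition is_unitary :: "nat \<Rightarrow> (nat \<Rightarrow> nat \<Rightarrow> complex) \<Rightarrow> bool" where
  "is_unitary d U \<longleftrightarrow>
     (\<forall>i<d. \<forall>j<d. (\<Sum>k<d. cnj (U k i) * U k j) = (if i = j then 1 else 0))"

record ('d, 'k) query =
  qm :: nat
  qm1 :: nat
  qm2 :: nat
  qZ :: "nat set"
  qtau :: "nat \<Rightarrow> 'd"
  qbeta :: "'k \<Rightarrow> nat"

definition is_query :: "'d set \<Rightarrow> ('d, 'k) query \<Rightarrow> bool" where
  "is_query D Q \<longleftrightarrow>
     qm Q \<ge> 1 \<and> qm1 Q \<ge> 1 \<and> qm2 Q \<ge> 1 \<and> qm1 Q + qm2 Q \<le> qm Q \<and>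
     qZ Q \<noteq> {} \<and> qZ Q \<subseteq> {..<2 ^ qm1 Q} \<and>
     (\<forall>i\<in>qZ Q. qtau Q i \<in> D) \<and> (\<forall>y. qbeta Q y < 2 ^ qm2 Q)"

text \<open>Basis index decomposition |i>|x>|y> with i the most significant block
  (binary expansion of the index of H_m = H_m' (x) H_m'' (x) H_(m-m'-m'')).\<close>
definition query_perm :: "('d, 'k) query \<Rightarrow> ('d \<Rightarrow> 'k) \<Rightarrow> nat \<Rightarrow> nat" where
  "query_perm Q f a =
    (let r = qm Q - qm1 Q - qm2 Q;
         i = a div 2 ^ (qm Q - qm1 Q);
         x = (a div 2 ^ r) mod 2 ^ qm2 Q;
         y = a mod 2 ^ r
     in if i \<in> qZ Q
        then i * 2 ^ (qm Q - qm1 Q) + ((x + qbeta Q (f (qtau Q i))) mod 2 ^ qm2 Q) * 2 ^ r + y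
        else a)"

definition query_mat :: "('d, 'k) query \<Rightarrow> ('d \<Rightarrow> 'k) \<Rightarrow> nat \<Rightarrow> nat \<Rightarrow> complex" where
  "query_mat Q f = (\<lambda>a b. if a = query_perm Q f b then 1 else 0)"

record ('d, 'k) nm_alg =
  nmQ :: "('d, 'k) query"
  nmU :: "(nat \<Rightarrow> nat \<Rightarrow> complex) list"

definition is_nm_alg :: "'d set \<Rightarrow> ('d, 'k) nm_alg \<Rightarrow> bool" where
  "is_nm_alg D A \<longleftrightarrow> is_query D (nmQ A) \<and> nmU A \<noteq> [] \<and>
     (\<forall>U\<in>set (nmU A). is_unitary (2 ^ qm (nmQ A)) U)"

definition nm_qubits :: "('d, 'k) nm_alg \<Rightarrow> nat" where
  "nm_qubits A = qm (nmQ A)"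

definition nm_queries :: "('d, 'k) nm_alg \<Rightarrow> nat" where
  "nm_queries A = length (nmU A) - 1"

definition nm_mat :: "('d, 'k) nm_alg \<Rightarrow> ('d \<Rightarrow> 'k) \<Rightarrow> nat \<Rightarrow> nat \<Rightarrow> complex" where
  "nm_mat A f =
    (let d = 2 ^ qm (nmQ A); Qf = query_mat (nmQ A) f
     in foldl (\<lambda>M U. mat_mult d U (mat_mult d Qf M)) (hd (nmU A)) (tl (nmU A)))"

text \<open>Quantum algorithm with k measurements: ((A_l)_(l<k), (b_l)_(l<k), phi).
  The family b_l (l<k) is encoded by one function on lists: b_l(x_0,...,x_(l-1)) =
  qb A [x_0,...,x_(l-1)] (so b_0 = qb A []).  phi is applied to the list [x_0,...,x_(k-1)].\<close>
record ('d, 'k, 'g) qalg =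
  qA :: "('d, 'k) nm_alg list"
  qb :: "nat list \<Rightarrow> nat"
  qphi :: "nat list \<Rightarrow> 'g"

definition qalg_outcomes :: "('d, 'k, 'g) qalg \<Rightarrow> nat list set" where
  "qalg_outcomes A = {xs. length xs = length (qA A) \<and>
      (\<forall>l<length (qA A). xs ! l < 2 ^ nm_qubits (qA A ! l))}"

definition is_qalg :: "'d set \<Rightarrow> ('d, 'k, 'g) qalg \<Rightarrow> bool" where
  "is_qalg D A \<longleftrightarrow> qA A \<noteq> [] \<and> (\<forall>l<length (qA A). is_nm_alg D (qA A ! l)) \<and>
     (\<forall>l<length (qA A). \<forall>xs. length xs = l \<and> (\<forall>i<l. xs ! i < 2 ^ nm_qubits (qA A ! i))
          \<longrightarrow> qb A xs < 2 ^ nm_qubits (qA A ! l))"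

definition qalg_queries :: "('d, 'k, 'g) qalg \<Rightarrow> nat" where
  "qalg_queries A = (\<Sum>l<length (qA A). nm_queries (qA A ! l))"

definition qalg_weight :: "('d, 'k, 'g) qalg \<Rightarrow> ('d \<Rightarrow> 'k) \<Rightarrow> nat list \<Rightarrow> real" where
  "qalg_weight A f xs =
     (\<Prod>l<length (qA A). (cmod (nm_mat (qA A ! l) f (xs ! l) (qb A (take l xs)))) ^ 2)"

definition qalg_prob :: "('d, 'k, 'g) qalg \<Rightarrow> ('d \<Rightarrow> 'k) \<Rightarrow> ('g \<Rightarrow> bool) \<Rightarrow> real" where
  "qalg_prob A f E = (\<Sum>xs\<in>qalg_outcomes A. if E (qphi A xs) then qalg_weight A f xs else 0)"

definition qerr :: "(('d \<Rightarrow> 'k) \<Rightarrow> 'g::real_normed_vector) \<Rightarrow> ('d, 'k, 'g) qalg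
    \<Rightarrow> ('d \<Rightarrow> 'k) \<Rightarrow> real" where
  "qerr S A f = Inf {\<epsilon>. qalg_prob A f (\<lambda>z. norm (S f - z) > \<epsilon>) \<le> 1/4}"

definition qerr_set :: "(('d \<Rightarrow> 'k) \<Rightarrow> 'g::real_normed_vector) \<Rightarrow> ('d, 'k, 'g) qalg
    \<Rightarrow> ('d \<Rightarrow> 'k) set \<Rightarrow> real" where
  "qerr_set S A F = Sup ((\<lambda>f. qerr S A f) ` F)"

definition min_query_err :: "nat \<Rightarrow> 'd set \<Rightarrow> (('d \<Rightarrow> 'k) \<Rightarrow> 'g::real_normed_vector)
    \<Rightarrow> ('d \<Rightarrow> 'k) set \<Rightarrow> real" where
  "min_query_err n D S F =
     Inf {qerr_set S A F | A. is_qalg D A \<and> qalg_queries A \<le> n}"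

text \<open>Functions Z[0,N) -> R represented as nat => real vanishing outside {0..<N}.\<close>
definition Lp_norm :: "real \<Rightarrow> nat \<Rightarrow> (nat \<Rightarrow> real) \<Rightarrow> real" where
  "Lp_norm p N f = ((1 / real N) * (\<Sum>i<N. \<bar>f i\<bar> powr p)) powr (1 / p)"

definition Lp_ball :: "real \<Rightarrow> nat \<Rightarrow> (nat \<Rightarrow> real) set" where
  "Lp_ball p N = {f. (\<forall>i\<ge>N. f i = 0) \<and> Lp_norm p N f \<le> 1}"

definition sumN :: "nat \<Rightarrow> (nat \<Rightarrow> real) \<Rightarrow> real" where
  "sumN N f = (1 / real N) * (\<Sum>i<N. f i)"

end

theory Submission
  imports Defs "HOL-Number_Theory.Cong"
begin

text \<open>
  Lower bound: by the adversary method, the multiples of indicator functions of sets of sizes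
  \<open>k\<close> and \<open>k + 1\<close> cannot be told apart with fewer than a constant times
  \<open>sqrt ((N - k) (k + 1))\<close> queries. Measurements need no separate treatment: the products of the
  matrix entries along the sequences of outcomes are the amplitudes of the state obtained by
  deferring all measurements. Taking \<open>k\<close> of order \<open>n\<^sup>2 / N\<close> gives the claim.

  Upper bound: with \<open>k\<close> of order \<open>n\<^sup>2 / (N L\<^sup>2)\<close>, where \<open>L = max (log 2 (n / sqrt N)) 1\<close>, a function in the unit ball
  has at most \<open>k\<close> values of modulus at least \<open>t = (N / k) powr (1 / p)\<close>. One run of
  Grover's search with about \<open>sqrt (N / k)\<close> iterations hits each of their positions with
  probability at least a constant times \<open>1 / k\<close>, so about \<open>k log k\<close> independent runs find all of
  them (coupon collector), and their contribution is summed exactly. The remaining function is split into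
  dyadic levels \<open>t / 2 ^ Suc l \<le> \<bar>f i\<bar> < t / 2 ^ l\<close>, whose means are found by amplitude
  estimation. As \<open>p < 2\<close>, the errors decay geometrically in \<open>l\<close>, which leaves room for geometrically decreasing
  query numbers and failure probabilities.
\<close>

section \<open>Algorithms acting on vectors\<close>

text \<open>The logarithm and the exponent \<open>2 / p - 1\<close> come from the balance between
  the two stages of the upper bound. Finding all large values costs about
  \<open>k log k * sqrt (N / k) = sqrt (N k) log k\<close> queries; this stays below
  \<open>n\<close> only if \<open>k\<close> is smaller than \<open>n\<^sup>2 / N\<close> by a factor
  of order \<open>L\<^sup>2\<close>, which raises the threshold \<open>t\<close> by
  \<open>L powr (2 / p)\<close>. On the other hand, the top level of the remaining function then
  lives on a fraction of order \<open>k / N\<close> of the points. Amplitude estimation has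
  precision of order \<open>1 / n\<close> in the square root of a fraction, so the error in the mean
  is of order \<open>t * sqrt (k / N) / n\<close>, which is of order \<open>t / (N L)\<close>: one
  factor \<open>L\<close> is gained back. At level \<open>l\<close> the same product shrinks by
  \<open>2 powr (- (1 - p / 2) l)\<close>. All constants may depend on \<open>p\<close> alone, so
  this decay is divided once and for all among accuracy, failure probability and query numbers. Real
  values do not fit into finitely many qubits; they are rounded to any accuracy wanted, at no cost,
  since only queries count.\<close>

definition mat_app :: "nat \<Rightarrow> (nat \<Rightarrow> nat \<Rightarrow> complex) \<Rightarrow> (nat \<Rightarrow> complex) \<Rightarrow> nat \<Rightarrow> complex" where
  "mat_app d M v = (\<lambda>a. \<Sum>k<d. M a k * v k)"

definition cinner :: "nat \<Rightarrow> (nat \<Rightarrow> complex) \<Rightarrow> (nat \<Rightarrow> complex) \<Rightarrow> complex" where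
  "cinner d v w = (\<Sum>a<d. cnj (v a) * w a)"

definition normsq :: "nat \<Rightarrow> (nat \<Rightarrow> complex) \<Rightarrow> real" where
  "normsq d v = (\<Sum>a<d. (cmod (v a))\<^sup>2)"

text \<open>Monomial matrices: a map of basis states combined with a factor for each column. Both
  the query, with all factors 1, and the phase oracle of the Grover iteration have this
  form.\<close>

definition mono_mat :: "(nat \<Rightarrow> nat) \<Rightarrow> (nat \<Rightarrow> complex) \<Rightarrow> nat \<Rightarrow> nat \<Rightarrow> complex" where
  "mono_mat \<pi> \<phi> = (\<lambda>a b. if a = \<pi> b then \<phi> b else 0)"

text \<open>The unitary that acts before any query is absorbed in the vector \<open>v\<close>, so
  every entry of the list costs exactly one query.\<close>

definition nm_run :: "nat \<Rightarrow> (nat \<Rightarrow> nat \<Rightarrow> complex) \<Rightarrow> (nat \<Rightarrow> complex) \<Rightarrow> (nat \<Rightarrow> nat \<Rightarrow> complex) list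
    \<Rightarrow> nat \<Rightarrow> complex" where
  "nm_run d Q v Us = foldl (\<lambda>v U. mat_app d U (mat_app d Q v)) v Us"

lemma cinner_self: "cinner d v v = of_real (normsq d v)"
  unfolding cinner_def normsq_def of_real_sum
  by (intro sum.cong refl) (metis complex_norm_square mult.commute)

lemma unitary_cinner:
  assumes "is_unitary d U"
  shows "cinner d (mat_app d U v) (mat_app d U w) = cinner d v w"
proof -
  have "cinner d (mat_app d U v) (mat_app d U w)
      = (\<Sum>a<d. \<Sum>k<d. \<Sum>l<d. cnj (v k) * w l * (cnj (U a k) * U a l))"
    unfolding cinner_def mat_app_def cnj_sum sum_product
    by (intro sum.cong refl) (simp add: algebra_simps)
  also have "\<dots> = (\<Sum>k<d. \<Sum>l<d. \<Sum>a<d. cnj (v k) * w l * (cnj (U a k) * U a l))"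
    by (subst sum.swap, rule sum.cong[OF refl], subst sum.swap, rule refl)
  also have "\<dots> = (\<Sum>k<d. \<Sum>l<d. cnj (v k) * w l * (\<Sum>a<d. cnj (U a k) * U a l))"
    by (simp add: sum_distrib_left)
  also have "\<dots> = (\<Sum>k<d. \<Sum>l<d. cnj (v k) * w l * (if k = l then 1 else 0))"
    using assms by (intro sum.cong refl) (simp add: is_unitary_def)
  also have "\<dots> = cinner d v w"
    by (simp add: cinner_def if_distrib sum.delta' cong: if_cong)
  finally show ?thesis .
qed

lemma unitary_normsq:
  assumes "is_unitary d U"
  shows "normsq d (mat_app d U v) = normsq d v"
  using unitary_cinner[OF assms, of v v] by (simp add: cinner_self)

lemma unitary_column_normsq:
  assumes "is_unitary d U" "b < d"
  shows "normsq d (\<lambda>i. U i b) = 1"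
proof -
  have "cinner d (\<lambda>i. U i b) (\<lambda>i. U i b) = 1"
    using assms by (simp add: is_unitary_def cinner_def)
  thus ?thesis by (simp add: cinner_self)
qed

text \<open>Evaluation at \<open>\<pi> b\<close> instead of a general row avoids naming the inverse
  of \<open>\<pi>\<close>.\<close>

lemma mono_mat_app:
  assumes "inj_on \<pi> {..<d}" "b < d"
  shows "mat_app d (mono_mat \<pi> \<phi>) v (\<pi> b) = \<phi> b * v b"
proof -
  have "mat_app d (mono_mat \<pi> \<phi>) v (\<pi> b) = (\<Sum>k<d. if k = b then \<phi> b * v b else 0)"
    unfolding mat_app_def mono_mat_def
    by (intro sum.cong refl) (use assms in \<open>auto simp: inj_on_def\<close>)
  thus ?thesis using assms(2) by simp
qed

lemma mono_mat_unitary: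
  assumes "inj_on \<pi> {..<d}" "\<pi> ` {..<d} \<subseteq> {..<d}" "\<And>b. b < d \<Longrightarrow> cmod (\<phi> b) = 1"
  shows "is_unitary d (mono_mat \<pi> \<phi>)"
  unfolding is_unitary_def
proof (intro allI impI)
  fix i j assume ij: "i < d" "j < d"
  have "(\<Sum>k<d. cnj (mono_mat \<pi> \<phi> k i) * mono_mat \<pi> \<phi> k j)
      = (\<Sum>k<d. if k = \<pi> i then (if i = j then 1 else 0) else 0)"
  proof (intro sum.cong refl)
    fix k assume "k \<in> {..<d}"
    have "cnj (\<phi> i) * \<phi> i = 1" using assms(3)[OF ij(1)]
      by (metis complex_norm_square mult.commute of_real_1 power_one)
    thus "cnj (mono_mat \<pi> \<phi> k i) * mono_mat \<pi> \<phi> k j = (if k = \<pi> i then (if i = j then 1 else 0) else 0)"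
      using assms(1) ij by (auto simp: mono_mat_def inj_on_def)
  qed
  also have "\<dots> = (if i = j then 1 else 0)"
    using assms(2) ij by auto
  finally show "(\<Sum>k<d. cnj (mono_mat \<pi> \<phi> k i) * mono_mat \<pi> \<phi> k j) = (if i = j then 1 else 0)" .
qed

section \<open>Three-block basis indices and the query as a permutation\<close>

lemma split_index:
  fixes a r s :: nat
  shows "a = a div 2 ^ (s + r) * 2 ^ (s + r) + (a div 2 ^ r) mod 2 ^ s * 2 ^ r + a mod 2 ^ r"
proof -
  have "a div 2 ^ (s + r) = a div 2 ^ r div 2 ^ s"
    by (metis add.commute div_mult2_eq power_add)
  moreover have "a div 2 ^ r = a div 2 ^ r div 2 ^ s * 2 ^ s + (a div 2 ^ r) mod 2 ^ s"
    by (rule div_mult_mod_eq[symmetric])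
  moreover have "a = a div 2 ^ r * 2 ^ r + a mod 2 ^ r" by (rule div_mult_mod_eq[symmetric])
  ultimately show ?thesis
    by (metis (no_types, lifting) add_mult_distrib mult.assoc power_add)
qed

lemma join_index:
  fixes i x y r s :: nat
  assumes "x < 2 ^ s" "y < 2 ^ r"
  defines "a \<equiv> i * 2 ^ (s + r) + x * 2 ^ r + y"
  shows "a div 2 ^ (s + r) = i" "(a div 2 ^ r) mod 2 ^ s = x" "a mod 2 ^ r = y"
proof -
  have a: "a = (i * 2 ^ s + x) * 2 ^ r + y" by (simp add: a_def power_add algebra_simps)
  have 1: "a div 2 ^ r = i * 2 ^ s + x" using assms(2) by (simp add: a)
  show "a mod 2 ^ r = y" using assms(2) by (simp add: a)
  show "(a div 2 ^ r) mod 2 ^ s = x" using assms(1) by (simp add: 1)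
  have "a div 2 ^ (s + r) = a div 2 ^ r div 2 ^ s"
    by (metis add.commute div_mult2_eq power_add)
  thus "a div 2 ^ (s + r) = i" using assms(1) by (simp add: 1)
qed

lemma mod_add_inj:
  fixes x y c M :: nat
  assumes "(x + c) mod M = (y + c) mod M" "x < M" "y < M"
  shows "x = y"
proof -
  have "[x + c = y + c] (mod M)" using assms(1) by (simp only: unique_euclidean_semiring_class.cong_def)
  hence "[x = y] (mod M)" by (simp only: cong_add_rcancel_nat)
  thus ?thesis using assms(2,3) by (simp add: unique_euclidean_semiring_class.cong_def)
qed

lemma query_perm_eq:
  assumes "is_query D Q" "a div 2 ^ (qm Q - qm1 Q) \<in> qZ Q"
  defines "r \<equiv> qm Q - qm1 Q - qm2 Q"
  shows "query_perm Q f a = a div 2 ^ (qm2 Q + r) * 2 ^ (qm2 Q + r)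
    + (((a div 2 ^ r) mod 2 ^ qm2 Q + qbeta Q (f (qtau Q (a div 2 ^ (qm2 Q + r))))) mod 2 ^ qm2 Q) * 2 ^ r
    + a mod 2 ^ r"
proof -
  have "qm Q - qm1 Q = qm2 Q + r" using assms(1) by (auto simp: is_query_def r_def)
  thus ?thesis using assms(2) by (simp add: query_perm_def Let_def r_def)
qed

lemma query_perm_div:
  assumes "is_query D Q"
  shows "query_perm Q f a div 2 ^ (qm Q - qm1 Q) = a div 2 ^ (qm Q - qm1 Q)"
proof (cases "a div 2 ^ (qm Q - qm1 Q) \<in> qZ Q")
  case True
  have m: "qm Q - qm1 Q = qm2 Q + (qm Q - qm1 Q - qm2 Q)" using assms(1) by (auto simp: is_query_def)
  show ?thesis
    unfolding query_perm_eq[OF assms True, of f] by (subst (1 2) m, rule join_index(1)) auto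
qed (simp add: query_perm_def Let_def)

lemma query_perm_less:
  assumes "is_query D Q" "a < 2 ^ qm Q"
  shows "query_perm Q f a < 2 ^ qm Q"
proof -
  have e: "(2::nat) ^ qm Q = 2 ^ (qm Q - qm1 Q) * 2 ^ qm1 Q"
    using assms(1) by (simp add: is_query_def flip: power_add)
  have "a div 2 ^ (qm Q - qm1 Q) < 2 ^ qm1 Q"
    using assms(2) unfolding e by (simp add: less_mult_imp_div_less mult.commute)
  hence "query_perm Q f a div 2 ^ (qm Q - qm1 Q) < 2 ^ qm1 Q"
    by (simp add: query_perm_div[OF assms(1)])
  thus ?thesis unfolding e by (simp add: div_less_iff_less_mult mult.commute)
qed

text \<open>The query keeps the block that holds the argument. Equal images therefore come from
  equal arguments, the same constant was added to both value blocks, and addition of a constant is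
  injective modulo \<open>2 ^ qm2 Q\<close>.\<close>

lemma query_perm_inj:
  assumes "is_query D Q"
  shows "inj (query_perm Q f)"
proof (rule injI)
  fix a b assume eq: "query_perm Q f a = query_perm Q f b"
  let ?r = "qm Q - qm1 Q - qm2 Q"
  have m: "qm Q - qm1 Q = qm2 Q + ?r" using assms(1) by (auto simp: is_query_def)
  have i: "a div 2 ^ (qm Q - qm1 Q) = b div 2 ^ (qm Q - qm1 Q)"
    using arg_cong[OF eq, of "\<lambda>a. a div 2 ^ (qm Q - qm1 Q)"] by (simp only: query_perm_div[OF assms])
  show "a = b"
  proof (cases "a div 2 ^ (qm Q - qm1 Q) \<in> qZ Q")
    case True
    note pa = query_perm_eq[OF assms True, of f]
    note pb = query_perm_eq[OF assms True[unfolded i], of f]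
    let ?c = "qbeta Q (f (qtau Q (a div 2 ^ (qm2 Q + ?r))))"
    have "((a div 2 ^ ?r) mod 2 ^ qm2 Q + ?c) mod 2 ^ qm2 Q = query_perm Q f a div 2 ^ ?r mod 2 ^ qm2 Q"
      unfolding pa by (subst join_index(2)) auto
    also have "\<dots> = ((b div 2 ^ ?r) mod 2 ^ qm2 Q + ?c) mod 2 ^ qm2 Q"
      unfolding eq pb by (subst join_index(2)) (use i m in auto)
    finally have x: "(a div 2 ^ ?r) mod 2 ^ qm2 Q = (b div 2 ^ ?r) mod 2 ^ qm2 Q"
      by (rule mod_add_inj) auto
    have "a mod 2 ^ ?r = query_perm Q f a mod 2 ^ ?r"
      unfolding pa by (subst join_index(3)) auto
    also have "\<dots> = b mod 2 ^ ?r"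
      unfolding eq pb by (subst join_index(3)) auto
    finally have y: "a mod 2 ^ ?r = b mod 2 ^ ?r" .
    have "a = a div 2 ^ (qm2 Q + ?r) * 2 ^ (qm2 Q + ?r) + (a div 2 ^ ?r) mod 2 ^ qm2 Q * 2 ^ ?r + a mod 2 ^ ?r"
      by (rule split_index)
    also have "\<dots> = b div 2 ^ (qm2 Q + ?r) * 2 ^ (qm2 Q + ?r) + (b div 2 ^ ?r) mod 2 ^ qm2 Q * 2 ^ ?r + b mod 2 ^ ?r"
      using i m x y by simp
    also have "\<dots> = b" by (rule split_index[symmetric])
    finally show ?thesis .
  qed (use eq i in \<open>simp add: query_perm_def Let_def\<close>)
qed

lemma query_mat_mono: "query_mat Q f = mono_mat (query_perm Q f) (\<lambda>_. 1)"
  by (simp add: query_mat_def mono_mat_def)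

lemma query_mat_unitary:
  assumes "is_query D Q"
  shows "is_unitary (2 ^ qm Q) (query_mat Q f)"
  unfolding query_mat_mono
  by (rule mono_mat_unitary)
     (use query_perm_inj[OF assms, of f] query_perm_less[OF assms] in \<open>auto intro: inj_on_subset\<close>)

lemma nm_run_Nil [simp]: "nm_run d Q v [] = v"
  and nm_run_Cons [simp]: "nm_run d Q v (U # Us) = nm_run d Q (mat_app d U (mat_app d Q v)) Us"
  and nm_run_append: "nm_run d Q v (Us @ Vs) = nm_run d Q (nm_run d Q v Us) Vs"
  by (simp_all add: nm_run_def)

text \<open>Every stage starts in a basis state, so only columns of the algorithm's matrix matter;
  they evolve as vectors, to which inner product arguments apply.\<close>

lemma nm_mat_column:
  "(\<lambda>i. nm_mat A f i b)
   = nm_run (2 ^ qm (nmQ A)) (query_mat (nmQ A) f) (\<lambda>i. hd (nmU A) i b) (tl (nmU A))"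
proof -
  have "(\<lambda>i. foldl (\<lambda>M U. mat_mult d U (mat_mult d Q M)) M Us i b) = nm_run d Q (\<lambda>i. M i b) Us"
    for d Q M Us
  proof (induction Us arbitrary: M)
    case (Cons U Us)
    show ?case by (simp add: Cons.IH) (simp add: mat_mult_def mat_app_def)
  qed simp
  thus ?thesis by (simp add: nm_mat_def Let_def)
qed

lemma nm_run_normsq:
  assumes "is_unitary d Q" "\<forall>U\<in>set Us. is_unitary d U"
  shows "normsq d (nm_run d Q v Us) = normsq d v"
  using assms(2) by (induction Us arbitrary: v) (simp_all add: unitary_normsq assms(1))

lemma nm_mat_normsq:
  assumes "is_nm_alg D A" "b < 2 ^ nm_qubits A"
  shows "normsq (2 ^ nm_qubits A) (\<lambda>i. nm_mat A f i b) = 1"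
proof -
  have U: "\<forall>U\<in>set (nmU A). is_unitary (2 ^ qm (nmQ A)) U" "nmU A \<noteq> []" "is_query D (nmQ A)"
    using assms(1) by (auto simp: is_nm_alg_def)
  have "normsq (2 ^ nm_qubits A) (\<lambda>i. nm_mat A f i b) = normsq (2 ^ nm_qubits A) (\<lambda>i. hd (nmU A) i b)"
    unfolding nm_mat_column nm_qubits_def
    by (rule nm_run_normsq) (use U query_mat_unitary in \<open>auto dest: list.set_sel(2)\<close>)
  also have "\<dots> = 1"
    by (rule unitary_column_normsq) (use U assms(2) in \<open>auto simp: nm_qubits_def\<close>)
  finally show ?thesis .
qed

section \<open>Sequences of measurement outcomes and their amplitudes\<close>

definition outs :: "('d, 'k, 'g) qalg \<Rightarrow> nat \<Rightarrow> nat list set" where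
  "outs A l = {xs. length xs = l \<and> (\<forall>i<l. xs ! i < 2 ^ nm_qubits (qA A ! i))}"

text \<open>A version of the product behind \<open>qalg_weight\<close> without the squared modulus
  and cut off after \<open>l\<close> measurements, so that induction can run over the measurements
  already made and phases are kept.\<close>

definition amp :: "('d, 'k, 'g) qalg \<Rightarrow> nat \<Rightarrow> ('d \<Rightarrow> 'k) \<Rightarrow> nat list \<Rightarrow> complex" where
  "amp A l f xs = (\<Prod>i<l. nm_mat (qA A ! i) f (xs ! i) (qb A (take i xs)))"

lemma outs_Suc: "outs A (Suc l) = (\<lambda>(h, x). h @ [x]) ` (outs A l \<times> {..<2 ^ nm_qubits (qA A ! l)})"
proof (intro equalityI subsetI)
  fix xs assume xs: "xs \<in> outs A (Suc l)"
  hence l: "length xs = Suc l" by (simp add: outs_def)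
  hence e: "xs = take l xs @ [xs ! l]" by (metis lessI order_refl take_Suc_conv_app_nth take_all)
  have "take l xs \<in> outs A l" "xs ! l < 2 ^ nm_qubits (qA A ! l)"
    using xs by (auto simp: outs_def)
  thus "xs \<in> (\<lambda>(h, x). h @ [x]) ` (outs A l \<times> {..<2 ^ nm_qubits (qA A ! l)})"
    using e by (intro image_eqI[of _ _ "(take l xs, xs ! l)"]) auto
qed (auto simp: outs_def nth_append less_Suc_eq)

lemma outs_0 [simp]: "outs A 0 = {[]}"
  by (auto simp: outs_def)

lemma finite_outs: "finite (outs A l)"
  by (induction l) (auto simp: outs_Suc)

lemma sum_outs_Suc:
  "(\<Sum>xs\<in>outs A (Suc l). F xs) = (\<Sum>h\<in>outs A l. \<Sum>x<2 ^ nm_qubits (qA A ! l). F (h @ [x]))"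
  unfolding outs_Suc sum.cartesian_product
  by (subst sum.reindex) (auto simp: inj_on_def case_prod_unfold)

lemma qalg_outcomes_outs: "qalg_outcomes A = outs A (length (qA A))"
  by (simp add: qalg_outcomes_def outs_def)

lemma qalg_weight_amp: "qalg_weight A f xs = (cmod (amp A (length (qA A)) f xs))\<^sup>2"
  unfolding qalg_weight_def amp_def prod_norm[symmetric] by (simp only: prod_power_distrib)

lemma amp_snoc:
  assumes "length h = l"
  shows "amp A (Suc l) f (h @ [x]) = amp A l f h * nm_mat (qA A ! l) f x (qb A h)"
  unfolding amp_def using assms by (simp add: nth_append)

lemma amp_normsq:
  assumes "is_qalg D A" "l \<le> length (qA A)"
  shows "(\<Sum>xs\<in>outs A l. (cmod (amp A l f xs))\<^sup>2) = 1"
  using assms(2)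
proof (induction l)
  case (Suc l)
  have "(\<Sum>xs\<in>outs A (Suc l). (cmod (amp A (Suc l) f xs))\<^sup>2)
    = (\<Sum>h\<in>outs A l. (cmod (amp A l f h))\<^sup>2 *
         normsq (2 ^ nm_qubits (qA A ! l)) (\<lambda>i. nm_mat (qA A ! l) f i (qb A h)))"
    unfolding sum_outs_Suc normsq_def sum_distrib_left
    by (intro sum.cong refl) (simp add: amp_snoc outs_def norm_mult power_mult_distrib)
  also have "\<dots> = (\<Sum>h\<in>outs A l. (cmod (amp A l f h))\<^sup>2 * 1)"
  proof (intro sum.cong refl)
    fix h assume h: "h \<in> outs A l"
    have "is_nm_alg D (qA A ! l)" using assms(1) Suc.prems by (auto simp: is_qalg_def)
    moreover have "qb A h < 2 ^ nm_qubits (qA A ! l)"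
      using assms(1) Suc.prems h unfolding is_qalg_def outs_def by force
    ultimately have "normsq (2 ^ nm_qubits (qA A ! l)) (\<lambda>i. nm_mat (qA A ! l) f i (qb A h)) = 1"
      by (rule nm_mat_normsq)
    thus "(cmod (amp A l f h))\<^sup>2 * normsq (2 ^ nm_qubits (qA A ! l)) (\<lambda>i. nm_mat (qA A ! l) f i (qb A h))
      = (cmod (amp A l f h))\<^sup>2 * 1" by simp
  qed
  finally show ?case using Suc by simp
qed (simp add: amp_def)

lemma qalg_weight_total:
  assumes "is_qalg D A"
  shows "(\<Sum>xs\<in>qalg_outcomes A. qalg_weight A f xs) = 1"
  using amp_normsq[OF assms order_refl] by (simp add: qalg_outcomes_outs qalg_weight_amp)

lemma qalg_weight_nonneg: "qalg_weight A f xs \<ge> 0"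
  by (simp add: qalg_weight_amp)

lemma finite_qalg_outcomes: "finite (qalg_outcomes A)"
  by (simp add: qalg_outcomes_outs finite_outs)

section \<open>Output probabilities and the error functionals\<close>

lemma qalg_prob_mono:
  assumes "\<And>xs. xs \<in> qalg_outcomes A \<Longrightarrow> E (qphi A xs) \<Longrightarrow> E' (qphi A xs)"
  shows "qalg_prob A f E \<le> qalg_prob A f E'"
  unfolding qalg_prob_def
  by (intro sum_mono) (use assms in \<open>auto simp: qalg_weight_nonneg\<close>)

lemma qalg_prob_cong:
  assumes "\<And>xs. xs \<in> qalg_outcomes A \<Longrightarrow> E (qphi A xs) = E' (qphi A xs)"
  shows "qalg_prob A f E = qalg_prob A f E'"
  unfolding qalg_prob_def by (intro sum.cong refl) (use assms in auto)

lemma qalg_prob_True: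
  assumes "is_qalg D A" "\<And>z. E z"
  shows "qalg_prob A f E = 1"
  using qalg_weight_total[OF assms(1)] assms(2) by (simp add: qalg_prob_def)

text \<open>For a negative \<epsilon> the event is certain and has probability 1. Hence 0 bounds
  from below the set whose infimum is \<open>qerr\<close>.\<close>

lemma qerr_set_nonneg:
  assumes "is_qalg D A" "qalg_prob A f (\<lambda>z. norm (S f - z) > \<epsilon>) \<le> 1/4"
  shows "\<epsilon> \<ge> 0"
proof (rule ccontr)
  assume "\<not> \<epsilon> \<ge> 0"
  hence "norm (S f - z) > \<epsilon>" for z by (meson linorder_not_le norm_ge_zero order_trans)
  hence "qalg_prob A f (\<lambda>z. norm (S f - z) > \<epsilon>) = 1" by (rule qalg_prob_True[OF assms(1)])
  thus False using assms(2) by simp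
qed

lemma qerr_le:
  assumes "is_qalg D A" "qalg_prob A f (\<lambda>z. norm (S f - z) > \<epsilon>) \<le> 1/4"
  shows "qerr S A f \<le> \<epsilon>"
  unfolding qerr_def
  by (rule cInf_lower) (use assms qerr_set_nonneg[OF assms(1)] in \<open>auto intro!: bdd_belowI[of _ 0]\<close>)

text \<open>The set whose infimum is \<open>qerr\<close> is nonempty: an algorithm has finitely many
  outputs, so some threshold exceeds all possible deviations.\<close>

lemma qerr_bound_ex:
  fixes S :: "('d \<Rightarrow> 'k) \<Rightarrow> 'g::real_normed_vector"
  assumes "is_qalg D A"
  shows "qalg_prob A f (\<lambda>z. norm (S f - z) > norm (S f) + (\<Sum>xs\<in>qalg_outcomes A. norm (qphi A xs))) \<le> 1/4"
proof -
  have "norm (S f - qphi A xs) \<le> norm (S f) + (\<Sum>xs\<in>qalg_outcomes A. norm (qphi A xs))"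
    if "xs \<in> qalg_outcomes A" for xs
    using norm_triangle_ineq4[of "S f" "qphi A xs"]
      member_le_sum[OF that, of "\<lambda>xs. norm (qphi A xs)"] finite_qalg_outcomes[of A] by auto
  hence "qalg_prob A f (\<lambda>z. norm (S f - z) > norm (S f) + (\<Sum>xs\<in>qalg_outcomes A. norm (qphi A xs)))
    = qalg_prob A f (\<lambda>_. False)"
    by (intro qalg_prob_cong) (auto simp: not_less)
  thus ?thesis by (simp add: qalg_prob_def)
qed

lemma qerr_nonneg:
  assumes "is_qalg D A"
  shows "qerr S A f \<ge> 0"
  unfolding qerr_def
  by (rule cInf_greatest) (use qerr_bound_ex[OF assms] qerr_set_nonneg[OF assms] in auto)

text \<open>The bound depends on the algorithm but not on \<open>f\<close>, as the supremum over
  \<open>F\<close> requires.\<close>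

lemma qerr_bdd_above:
  assumes "is_qalg D A" "\<And>f. f \<in> F \<Longrightarrow> norm (S f) \<le> C"
  shows "bdd_above ((\<lambda>f. qerr S A f) ` F)"
proof (rule bdd_aboveI2)
  fix f assume "f \<in> F"
  show "qerr S A f \<le> C + (\<Sum>xs\<in>qalg_outcomes A. norm (qphi A xs))"
    using qerr_le[where S = S, OF assms(1) qerr_bound_ex[OF assms(1), of f S]] assms(2)[OF \<open>f \<in> F\<close>] by linarith
qed

lemma min_query_err_le:
  assumes "is_qalg D A" "qalg_queries A \<le> n" "F \<noteq> {}" "\<And>f. f \<in> F \<Longrightarrow> norm (S f) \<le> C"
    and "\<And>f. f \<in> F \<Longrightarrow> qalg_prob A f (\<lambda>z. norm (S f - z) > E) \<le> 1/4"
  shows "min_query_err n D S F \<le> E"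
proof -
  have "min_query_err n D S F \<le> qerr_set S A F"
    unfolding min_query_err_def
  proof (rule cInf_lower)
    show "bdd_below {qerr_set S A F | A. is_qalg D A \<and> qalg_queries A \<le> n}"
    proof (rule bdd_belowI[of _ 0])
      fix x assume "x \<in> {qerr_set S A F | A. is_qalg D A \<and> qalg_queries A \<le> n}"
      then obtain B where B: "is_qalg D B" "x = qerr_set S B F" by blast
      obtain f where f: "f \<in> F" using assms(3) by blast
      have "qerr S B f \<le> x" unfolding B(2) qerr_set_def
        by (rule cSup_upper) (use f qerr_bdd_above[OF B(1) assms(4)] in auto)
      thus "0 \<le> x" using qerr_nonneg[OF B(1), of S f] by linarith
    qed
  qed (use assms in auto)
  also have "\<dots> \<le> E"
    unfolding qerr_set_def
    by (rule cSup_least) (use assms qerr_le[OF assms(1)] in auto)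
  finally show ?thesis .
qed

text \<open>For every \<epsilon> below \<open>E\<close> the event that the deviation is at least
  \<open>E\<close> lies inside the event that it exceeds \<epsilon>, so no such \<epsilon> is
  admissible for the function \<open>f\<close> that is supplied. The algorithm \<open>A0\<close>
  makes the set under the infimum nonempty.\<close>

lemma min_query_err_ge:
  fixes S :: "('d \<Rightarrow> 'k) \<Rightarrow> 'g::real_normed_vector" and A0 :: "('d, 'k, 'g) qalg"
  assumes "is_qalg D A0" "qalg_queries A0 \<le> n" "\<And>f. f \<in> F \<Longrightarrow> norm (S f) \<le> C"
    and "\<And>A. is_qalg D A \<Longrightarrow> qalg_queries A \<le> n \<Longrightarrow>
      \<exists>f\<in>F. qalg_prob A f (\<lambda>z. norm (S f - z) \<ge> E) > 1/4"
  shows "min_query_err n D S F \<ge> E"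
  unfolding min_query_err_def
proof (rule cInf_greatest)
  fix x assume "x \<in> {qerr_set S A F | A. is_qalg D A \<and> qalg_queries A \<le> n}"
  then obtain A where A: "is_qalg D A" "qalg_queries A \<le> n" "x = qerr_set S A F" by blast
  obtain f where f: "f \<in> F" "qalg_prob A f (\<lambda>z. norm (S f - z) \<ge> E) > 1/4"
    using assms(4)[OF A(1,2)] by blast
  have "E \<le> qerr S A f" unfolding qerr_def
  proof (rule cInf_greatest)
    show "{\<epsilon>. qalg_prob A f (\<lambda>z. norm (S f - z) > \<epsilon>) \<le> 1/4} \<noteq> {}"
      using qerr_bound_ex[OF A(1)] by blast
    fix \<epsilon> assume e: "\<epsilon> \<in> {\<epsilon>. qalg_prob A f (\<lambda>z. norm (S f - z) > \<epsilon>) \<le> 1/4}"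
    show "E \<le> \<epsilon>"
    proof (rule ccontr)
      assume "\<not> E \<le> \<epsilon>"
      hence "qalg_prob A f (\<lambda>z. norm (S f - z) \<ge> E) \<le> qalg_prob A f (\<lambda>z. norm (S f - z) > \<epsilon>)"
        by (intro qalg_prob_mono) auto
      thus False using e f(2) by auto
    qed
  qed
  also have "\<dots> \<le> x" unfolding A(3) qerr_set_def
    by (rule cSup_upper) (use f qerr_bdd_above[OF A(1) assms(3)] in auto)
  finally show "E \<le> x" .
next
  show "{qerr_set S A F | A. is_qalg D A \<and> qalg_queries A \<le> n} \<noteq> {}"
    using assms(1,2) by auto
qed

section \<open>The adversary lower bound\<close>

text \<open>The basis states on which the query reads the function at \<open>e\<close>. The squared
  norm of a state on this set is its query magnitude at \<open>e\<close>.\<close>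

definition qmass :: "('d, 'k) query \<Rightarrow> 'd \<Rightarrow> nat set" where
  "qmass Q e = {b. b < 2 ^ qm Q \<and> b div 2 ^ (qm Q - qm1 Q) \<in> qZ Q \<and> qtau Q (b div 2 ^ (qm Q - qm1 Q)) = e}"

text \<open>Arithmetic-geometric mean inequality with a free weight \<alpha>. The weight later
  balances the two sides of the adversary relation, whose degrees differ.\<close>

lemma norm_sum_prod_le:
  fixes v w :: "'a \<Rightarrow> complex"
  assumes "\<alpha> > 0"
  shows "cmod (\<Sum>a\<in>H. cnj (v a) * w a) \<le> \<alpha> / 2 * (\<Sum>a\<in>H. (cmod (v a))\<^sup>2) + 1 / (2 * \<alpha>) * (\<Sum>a\<in>H. (cmod (w a))\<^sup>2)"
proof -
  have am: "x * y \<le> \<alpha> / 2 * x\<^sup>2 + 1 / (2 * \<alpha>) * y\<^sup>2" for x y :: real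
  proof -
    have "0 \<le> (\<alpha> * x - y)\<^sup>2 / (2 * \<alpha>)" using assms by simp
    also have "\<dots> = \<alpha> / 2 * x\<^sup>2 + 1 / (2 * \<alpha>) * y\<^sup>2 - x * y"
      using assms by (simp add: field_simps power2_eq_square)
    finally show ?thesis by simp
  qed
  have "cmod (\<Sum>a\<in>H. cnj (v a) * w a) \<le> (\<Sum>a\<in>H. cmod (cnj (v a) * w a))" by (rule norm_sum)
  also have "\<dots> \<le> (\<Sum>a\<in>H. \<alpha> / 2 * (cmod (v a))\<^sup>2 + 1 / (2 * \<alpha>) * (cmod (w a))\<^sup>2)"
    by (intro sum_mono) (use am in \<open>simp only: norm_mult complex_mod_cnj\<close>)
  finally show ?thesis by (simp add: sum.distrib sum_distrib_left)
qed

text \<open>Off \<open>qmass Q e\<close> the two queries are the same permutation, so that part of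
  the inner product is unchanged. Both permutations map \<open>qmass Q e\<close> onto itself, so the
  part on this set is controlled, before and after the query, by the same two query
  magnitudes.\<close>

lemma query_step:
  assumes Q: "is_query D Q" and fg: "\<And>x. x \<in> D \<Longrightarrow> x \<noteq> e \<Longrightarrow> f x = g x" and \<alpha>: "\<alpha> > 0"
  defines "d \<equiv> 2 ^ qm Q"
  shows "cmod (cinner d (mat_app d (query_mat Q f) v) (mat_app d (query_mat Q g) w) - cinner d v w)
    \<le> \<alpha> * (\<Sum>b\<in>qmass Q e. (cmod (v b))\<^sup>2) + 1 / \<alpha> * (\<Sum>b\<in>qmass Q e. (cmod (w b))\<^sup>2)"
proof -
  let ?H = "qmass Q e" and ?H' = "{..<d} - qmass Q e"
  have sub: "?H \<subseteq> {..<d}" by (auto simp: qmass_def d_def)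
  have fin: "finite ?H" using sub finite_subset by blast
  let ?f = "query_perm Q f" and ?g = "query_perm Q g"
  let ?v = "mat_app d (query_mat Q f) v" and ?w = "mat_app d (query_mat Q g) w"
  have inj: "inj_on (query_perm Q h) A" for h A
    using query_perm_inj[OF Q] inj_on_subset by blast
  have app: "mat_app d (query_mat Q h) u (query_perm Q h b) = u b" if "b < d" for h u b
    unfolding query_mat_mono by (subst mono_mat_app[OF inj that]) simp
  have mem: "query_perm Q h b \<in> ?H \<longleftrightarrow> b \<in> ?H" if "b < d" for h b
    using that query_perm_less[OF Q, of b h] by (simp add: qmass_def d_def query_perm_div[OF Q])
  have less: "query_perm Q h b < d" if "b < d" for h b
    using that query_perm_less[OF Q, of b h] by (simp add: d_def)
  have imH: "query_perm Q h ` ?H = ?H" for h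
    by (rule endo_inj_surj[OF fin _ inj]) (use mem sub in auto)
  have imH': "query_perm Q h ` ?H' = ?H'" for h
    by (rule endo_inj_surj[OF _ _ inj]) (use mem less in auto)
  have eq: "?f b = ?g b" if "b \<in> ?H'" for b
    using that fg Q by (auto simp: query_perm_def Let_def qmass_def d_def is_query_def)
  have sumH: "(\<Sum>a\<in>?H. (cmod (mat_app d (query_mat Q h) u a))\<^sup>2) = (\<Sum>b\<in>?H. (cmod (u b))\<^sup>2)" for h u
  proof -
    have "(\<Sum>a\<in>?H. (cmod (mat_app d (query_mat Q h) u a))\<^sup>2)
      = (\<Sum>a\<in>query_perm Q h ` ?H. (cmod (mat_app d (query_mat Q h) u a))\<^sup>2)" by (simp only: imH)
    also have "\<dots> = (\<Sum>b\<in>?H. (cmod (mat_app d (query_mat Q h) u (query_perm Q h b)))\<^sup>2)"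
      by (simp add: sum.reindex[OF inj])
    also have "\<dots> = (\<Sum>b\<in>?H. (cmod (u b))\<^sup>2)"
      using sub by (intro sum.cong refl) (simp add: app subset_iff)
    finally show ?thesis .
  qed
  have "(\<Sum>a\<in>?H'. cnj (?v a) * ?w a) = (\<Sum>a\<in>?f ` ?H'. cnj (?v a) * ?w a)" by (simp only: imH')
  also have "\<dots> = (\<Sum>b\<in>?H'. cnj (?v (?f b)) * ?w (?f b))" by (simp add: sum.reindex[OF inj])
  also have "\<dots> = (\<Sum>b\<in>?H'. cnj (v b) * w b)"
  proof (intro sum.cong refl)
    fix b assume b: "b \<in> ?H'"
    hence "?w (?f b) = ?w (?g b)" by (simp add: eq)
    thus "cnj (?v (?f b)) * ?w (?f b) = cnj (v b) * w b" using b by (simp add: app)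
  qed
  finally have H': "(\<Sum>a\<in>?H'. cnj (?v a) * ?w a) = (\<Sum>b\<in>?H'. cnj (v b) * w b)" .
  have split: "cinner d x y = (\<Sum>a\<in>?H. cnj (x a) * y a) + (\<Sum>a\<in>?H'. cnj (x a) * y a)" for x y
    unfolding cinner_def by (subst sum.subset_diff[OF sub]) auto
  have "cmod (cinner d ?v ?w - cinner d v w)
      = cmod ((\<Sum>a\<in>?H. cnj (?v a) * ?w a) - (\<Sum>a\<in>?H. cnj (v a) * w a))"
    by (simp add: split H')
  also have "\<dots> \<le> cmod (\<Sum>a\<in>?H. cnj (?v a) * ?w a) + cmod (\<Sum>a\<in>?H. cnj (v a) * w a)"
    by (rule norm_triangle_ineq4)
  also have "\<dots> \<le> (\<alpha> / 2 * (\<Sum>a\<in>?H. (cmod (v a))\<^sup>2) + 1 / (2 * \<alpha>) * (\<Sum>a\<in>?H. (cmod (w a))\<^sup>2))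
      + (\<alpha> / 2 * (\<Sum>a\<in>?H. (cmod (v a))\<^sup>2) + 1 / (2 * \<alpha>) * (\<Sum>a\<in>?H. (cmod (w a))\<^sup>2))"
    by (rule add_mono) (use norm_sum_prod_le[OF \<alpha>, of ?v ?w ?H] norm_sum_prod_le[OF \<alpha>, of v w ?H] in \<open>simp_all add: sumH\<close>)
  finally show ?thesis by simp
qed

lemma norm_diff_split: "norm (a - c) \<le> norm (a - b) + norm (b - c)" for a b c :: "'a::real_normed_vector"
  using norm_triangle_ineq[of "a - b" "b - c"] by simp

text \<open>The relation of the adversary method as a bipartite graph: \<open>R\<close> is the set
  of edges, \<open>lft\<close> and \<open>rgt\<close> give the ends, and \<open>pt\<close> gives the
  only argument in \<open>D\<close> at which the two functions may differ. Injectivity of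
  \<open>pt\<close> on the edges at a vertex says that different neighbours differ from it at
  different arguments.\<close>

locale adversary =
  fixes D :: "'d set" and F :: "'x \<Rightarrow> 'd \<Rightarrow> 'k" and X Y :: "'x set"
    and R :: "'r set" and lft rgt :: "'r \<Rightarrow> 'x" and pt :: "'r \<Rightarrow> 'd" and \<alpha> :: real
  assumes finX: "finite X" and finY: "finite Y" and finR: "finite R"
    and lft: "\<And>\<rho>. \<rho> \<in> R \<Longrightarrow> lft \<rho> \<in> X" and rgt: "\<And>\<rho>. \<rho> \<in> R \<Longrightarrow> rgt \<rho> \<in> Y"
    and inj_lft: "\<And>x. inj_on pt {\<rho>\<in>R. lft \<rho> = x}" and inj_rgt: "\<And>y. inj_on pt {\<rho>\<in>R. rgt \<rho> = y}"
    and agree: "\<And>\<rho> z. \<rho> \<in> R \<Longrightarrow> z \<in> D \<Longrightarrow> z \<noteq> pt \<rho> \<Longrightarrow> F (lft \<rho>) z = F (rgt \<rho>) z"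
    and \<alpha>: "\<alpha> > 0"
begin

text \<open>For a fixed vertex the edges have distinct points, so their sets \<open>qmass\<close>
  are disjoint and the query magnitudes add up to at most the squared norm of the state.\<close>

lemma sum_qmass_le:
  assumes "finite X'" "\<And>\<rho>. \<rho> \<in> R \<Longrightarrow> s \<rho> \<in> X'" "\<And>x. inj_on pt {\<rho>\<in>R. s \<rho> = x}"
  shows "(\<Sum>\<rho>\<in>R. \<Sum>b\<in>qmass Q (pt \<rho>). (cmod (v (s \<rho>) b))\<^sup>2) \<le> (\<Sum>x\<in>X'. normsq (2 ^ qm Q) (v x))"
proof -
  have "(\<Sum>\<rho>\<in>R. \<Sum>b\<in>qmass Q (pt \<rho>). (cmod (v (s \<rho>) b))\<^sup>2)
    = (\<Sum>x\<in>X'. \<Sum>\<rho>\<in>{\<rho>\<in>R. s \<rho> = x}. \<Sum>b\<in>qmass Q (pt \<rho>). (cmod (v (s \<rho>) b))\<^sup>2)"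
    by (rule sum.group[symmetric, OF finR assms(1)]) (use assms(2) in auto)
  also have "\<dots> = (\<Sum>x\<in>X'. \<Sum>\<rho>\<in>{\<rho>\<in>R. s \<rho> = x}. \<Sum>b\<in>qmass Q (pt \<rho>). (cmod (v x b))\<^sup>2)"
    by (intro sum.cong refl) simp
  also have "\<dots> = (\<Sum>x\<in>X'. \<Sum>b\<in>(\<Union>\<rho>\<in>{\<rho>\<in>R. s \<rho> = x}. qmass Q (pt \<rho>)). (cmod (v x b))\<^sup>2)"
  proof (intro sum.cong refl sum.UNION_disjoint[symmetric] ballI impI)
    fix x i j assume "i \<in> {\<rho>\<in>R. s \<rho> = x}" "j \<in> {\<rho>\<in>R. s \<rho> = x}" "i \<noteq> j"
    hence "pt i \<noteq> pt j" using assms(3)[of x] by (auto simp: inj_on_def)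
    thus "qmass Q (pt i) \<inter> qmass Q (pt j) = {}" by (auto simp: qmass_def)
  qed (auto simp: qmass_def finR)
  also have "\<dots> \<le> (\<Sum>x\<in>X'. normsq (2 ^ qm Q) (v x))"
    unfolding normsq_def by (intro sum_mono sum_mono2) (auto simp: qmass_def)
  finally show ?thesis .
qed

text \<open>Unitaries applied to both states leave inner products alone, so only the queries
  contribute, each by at most the same amount since norms are preserved. The start vectors are not
  normalised because they will carry the amplitudes of earlier outcomes.\<close>

lemma run_step:
  assumes Q: "is_query D Q" and U: "\<forall>U\<in>set Us. is_unitary (2 ^ qm Q) U"
  defines "d \<equiv> 2 ^ qm Q"
  shows "(\<Sum>\<rho>\<in>R. cmod (cinner d (nm_run d (query_mat Q (F (lft \<rho>))) (v (lft \<rho>)) Us)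
                                (nm_run d (query_mat Q (F (rgt \<rho>))) (v (rgt \<rho>)) Us)
                     - cinner d (v (lft \<rho>)) (v (rgt \<rho>))))
    \<le> real (length Us) * (\<alpha> * (\<Sum>x\<in>X. normsq d (v x)) + 1 / \<alpha> * (\<Sum>y\<in>Y. normsq d (v y)))"
  using U
proof (induction Us arbitrary: v)
  case Nil
  show ?case by simp
next
  case (Cons U Us)
  let ?B = "\<alpha> * (\<Sum>x\<in>X. normsq d (v x)) + 1 / \<alpha> * (\<Sum>y\<in>Y. normsq d (v y))"
  define w where "w = (\<lambda>x. mat_app d U (mat_app d (query_mat Q (F x)) (v x)))"
  have uU: "is_unitary d U" using Cons.prems by (simp add: d_def)
  have uQ: "is_unitary d (query_mat Q f)" for f unfolding d_def by (rule query_mat_unitary[OF Q])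
  have nw: "normsq d (w x) = normsq d (v x)" for x by (simp add: w_def unitary_normsq uU uQ)
  let ?r = "\<lambda>x. nm_run d (query_mat Q (F x)) (w x) Us"
  have "(\<Sum>\<rho>\<in>R. cmod (cinner d (w (lft \<rho>)) (w (rgt \<rho>)) - cinner d (v (lft \<rho>)) (v (rgt \<rho>))))
    \<le> (\<Sum>\<rho>\<in>R. \<alpha> * (\<Sum>b\<in>qmass Q (pt \<rho>). (cmod (v (lft \<rho>) b))\<^sup>2) + 1 / \<alpha> * (\<Sum>b\<in>qmass Q (pt \<rho>). (cmod (v (rgt \<rho>) b))\<^sup>2))"
    unfolding w_def unitary_cinner[OF uU] unfolding d_def
    by (intro sum_mono query_step[OF Q _ \<alpha>] agree)
  also have "\<dots> = \<alpha> * (\<Sum>\<rho>\<in>R. \<Sum>b\<in>qmass Q (pt \<rho>). (cmod (v (lft \<rho>) b))\<^sup>2)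
      + 1 / \<alpha> * (\<Sum>\<rho>\<in>R. \<Sum>b\<in>qmass Q (pt \<rho>). (cmod (v (rgt \<rho>) b))\<^sup>2)"
    by (simp only: sum.distrib sum_distrib_left)
  also have "\<dots> \<le> ?B" unfolding d_def
    using \<alpha> by (intro add_mono mult_left_mono sum_qmass_le) (auto simp: finX finY lft rgt inj_lft inj_rgt)
  finally have 1: "(\<Sum>\<rho>\<in>R. cmod (cinner d (w (lft \<rho>)) (w (rgt \<rho>)) - cinner d (v (lft \<rho>)) (v (rgt \<rho>)))) \<le> ?B" .
  have 2: "(\<Sum>\<rho>\<in>R. cmod (cinner d (?r (lft \<rho>)) (?r (rgt \<rho>)) - cinner d (w (lft \<rho>)) (w (rgt \<rho>)))) \<le> real (length Us) * ?B"
    using Cons.IH[of w] Cons.prems by (simp add: nw)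
  have "(\<Sum>\<rho>\<in>R. cmod (cinner d (?r (lft \<rho>)) (?r (rgt \<rho>)) - cinner d (v (lft \<rho>)) (v (rgt \<rho>))))
    \<le> (\<Sum>\<rho>\<in>R. cmod (cinner d (?r (lft \<rho>)) (?r (rgt \<rho>)) - cinner d (w (lft \<rho>)) (w (rgt \<rho>)))
        + cmod (cinner d (w (lft \<rho>)) (w (rgt \<rho>)) - cinner d (v (lft \<rho>)) (v (rgt \<rho>))))"
    by (intro sum_mono) (rule norm_diff_split)
  also have "\<dots> \<le> real (length Us) * ?B + ?B" unfolding sum.distrib using 1 2 by (rule add_mono[rotated])
  also have "\<dots> = real (length (U # Us)) * ?B" by (simp add: distrib_right)
  finally show ?case by (simp only: w_def nm_run_Cons)
qed

text \<open>The factor \<open>c x\<close> is the amplitude of the earlier outcomes for the input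
  \<open>x\<close>. The start index \<open>b\<close> is common to all inputs, since it depends on
  the outcomes alone; so the initial inner product is just the product of these factors.\<close>

lemma nm_step:
  fixes c :: "'x \<Rightarrow> complex"
  assumes A: "is_nm_alg D A" and b: "b < 2 ^ nm_qubits A"
  defines "u \<equiv> \<lambda>x i. c x * nm_mat A (F x) i b"
  shows "(\<Sum>\<rho>\<in>R. cmod (cinner (2 ^ nm_qubits A) (u (lft \<rho>)) (u (rgt \<rho>)) - cnj (c (lft \<rho>)) * c (rgt \<rho>)))
    \<le> real (nm_queries A) * (\<alpha> * (\<Sum>x\<in>X. (cmod (c x))\<^sup>2) + 1 / \<alpha> * (\<Sum>y\<in>Y. (cmod (c y))\<^sup>2))"
proof -
  let ?d = "2 ^ nm_qubits A" and ?Q = "nmQ A"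
  have U: "\<forall>U\<in>set (nmU A). is_unitary (2 ^ qm ?Q) U" "nmU A \<noteq> []" "is_query D ?Q"
    using A by (auto simp: is_nm_alg_def)
  define v where "v = (\<lambda>x i. c x * hd (nmU A) i b)"
  have hdU: "is_unitary ?d (hd (nmU A))" using U by (simp add: nm_qubits_def)
  have lin: "nm_run d Q (\<lambda>i. k * z i) Us i = k * nm_run d Q z Us i" for d Q k z Us i
  proof -
    have ap: "mat_app d M (\<lambda>i. k * z i) = (\<lambda>i. k * mat_app d M z i)" for M z
      by (simp add: mat_app_def sum_distrib_left algebra_simps)
    show ?thesis by (induction Us arbitrary: z) (simp_all add: ap)
  qed
  have u: "u x = nm_run ?d (query_mat ?Q (F x)) (v x) (tl (nmU A))" for x
    unfolding u_def v_def using fun_cong[OF nm_mat_column[of A "F x" b]] by (auto simp: lin nm_qubits_def)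
  have inner: "cinner ?d (v x) (v y) = cnj (c x) * c y" for x y
  proof -
    have "cinner ?d (v x) (v y) = cnj (c x) * c y * (\<Sum>a<?d. cnj (hd (nmU A) a b) * hd (nmU A) a b)"
      by (simp add: cinner_def v_def sum_distrib_left algebra_simps)
    thus ?thesis using hdU b by (simp add: is_unitary_def)
  qed
  have nrm: "normsq ?d (v x) = (cmod (c x))\<^sup>2" for x
  proof -
    have "complex_of_real (normsq ?d (v x)) = complex_of_real ((cmod (c x))\<^sup>2)"
      using inner[of x x] unfolding cinner_self by (metis complex_norm_square mult.commute)
    thus ?thesis using of_real_eq_iff by blast
  qed
  show ?thesis
    using run_step[OF U(3), of "tl (nmU A)" v] U(1,2)
    by (simp add: nm_qubits_def[symmetric] u inner nrm nm_queries_def list.set_sel(2))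
qed

definition overlap :: "('d, 'k, 'g) qalg \<Rightarrow> nat \<Rightarrow> 'x \<Rightarrow> 'x \<Rightarrow> complex" where
  "overlap A l x y = (\<Sum>h\<in>outs A l. cnj (amp A l (F x) h) * amp A l (F y) h)"

text \<open>For a fixed sequence \<open>h\<close> of outcomes the change of the inner product is
  bounded in terms of the squared amplitudes of \<open>h\<close>. These sum to 1 over
  \<open>h\<close> for each input, so a query costs no more with intermediate measurements than
  without.\<close>

lemma overlap_bound:
  assumes A: "is_qalg D A" and "l \<le> length (qA A)"
  shows "(\<Sum>\<rho>\<in>R. cmod (overlap A l (lft \<rho>) (rgt \<rho>) - 1))
    \<le> real (\<Sum>i<l. nm_queries (qA A ! i)) * (\<alpha> * real (card X) + 1 / \<alpha> * real (card Y))"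
  using assms(2)
proof (induction l)
  case 0
  show ?case by (simp add: overlap_def amp_def)
next
  case (Suc l)
  let ?B = "\<alpha> * real (card X) + 1 / \<alpha> * real (card Y)"
  let ?A = "qA A ! l"
  let ?u = "\<lambda>h x i. amp A l (F x) h * nm_mat ?A (F x) i (qb A h)"
  have nA: "is_nm_alg D ?A" using A Suc.prems by (auto simp: is_qalg_def)
  have nb: "qb A h < 2 ^ nm_qubits ?A" if "h \<in> outs A l" for h
    using A Suc.prems that unfolding is_qalg_def outs_def by force
  have ov: "overlap A (Suc l) x y = (\<Sum>h\<in>outs A l. cinner (2 ^ nm_qubits ?A) (?u h x) (?u h y))" for x y
    unfolding overlap_def sum_outs_Suc cinner_def
    by (intro sum.cong refl) (simp add: amp_snoc outs_def)
  have one: "(\<Sum>h\<in>outs A l. (cmod (amp A l (F x) h))\<^sup>2) = 1" for x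
    by (rule amp_normsq[OF A]) (use Suc.prems in simp)
  have "(\<Sum>\<rho>\<in>R. cmod (overlap A (Suc l) (lft \<rho>) (rgt \<rho>) - overlap A l (lft \<rho>) (rgt \<rho>)))
    \<le> (\<Sum>\<rho>\<in>R. \<Sum>h\<in>outs A l. cmod (cinner (2 ^ nm_qubits ?A) (?u h (lft \<rho>)) (?u h (rgt \<rho>))
           - cnj (amp A l (F (lft \<rho>)) h) * amp A l (F (rgt \<rho>)) h))"
    unfolding ov unfolding overlap_def sum_subtractf[symmetric] by (intro sum_mono norm_sum)
  also have "\<dots> = (\<Sum>h\<in>outs A l. \<Sum>\<rho>\<in>R. cmod (cinner (2 ^ nm_qubits ?A) (?u h (lft \<rho>)) (?u h (rgt \<rho>))
           - cnj (amp A l (F (lft \<rho>)) h) * amp A l (F (rgt \<rho>)) h))"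
    by (rule sum.swap)
  also have "\<dots> \<le> (\<Sum>h\<in>outs A l. real (nm_queries ?A) * (\<alpha> * (\<Sum>x\<in>X. (cmod (amp A l (F x) h))\<^sup>2)
      + 1 / \<alpha> * (\<Sum>y\<in>Y. (cmod (amp A l (F y) h))\<^sup>2)))"
    by (intro sum_mono nm_step[OF nA nb])
  also have "\<dots> = real (nm_queries ?A) * (\<alpha> * (\<Sum>x\<in>X. \<Sum>h\<in>outs A l. (cmod (amp A l (F x) h))\<^sup>2)
      + 1 / \<alpha> * (\<Sum>y\<in>Y. \<Sum>h\<in>outs A l. (cmod (amp A l (F y) h))\<^sup>2))"
    unfolding sum_distrib_left[symmetric] sum.distrib
    by (subst (2 4) sum.swap) (rule refl)
  also have "\<dots> = real (nm_queries ?A) * ?B" by (simp add: one)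
  finally have 1: "(\<Sum>\<rho>\<in>R. cmod (overlap A (Suc l) (lft \<rho>) (rgt \<rho>) - overlap A l (lft \<rho>) (rgt \<rho>)))
    \<le> real (nm_queries ?A) * ?B" .
  have 2: "(\<Sum>\<rho>\<in>R. cmod (overlap A l (lft \<rho>) (rgt \<rho>) - 1)) \<le> real (\<Sum>i<l. nm_queries (qA A ! i)) * ?B"
    using Suc by simp
  have "(\<Sum>\<rho>\<in>R. cmod (overlap A (Suc l) (lft \<rho>) (rgt \<rho>) - 1))
    \<le> (\<Sum>\<rho>\<in>R. cmod (overlap A (Suc l) (lft \<rho>) (rgt \<rho>) - overlap A l (lft \<rho>) (rgt \<rho>))
        + cmod (overlap A l (lft \<rho>) (rgt \<rho>) - 1))"
    by (intro sum_mono) (rule norm_diff_split)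
  also have "\<dots> \<le> real (nm_queries ?A) * ?B + real (\<Sum>i<l. nm_queries (qA A ! i)) * ?B"
    unfolding sum.distrib using 1 2 by (rule add_mono)
  finally show ?case by (simp add: distrib_right)
qed

end

text \<open>An event that is likely under one input and unlikely under the other keeps the two final
  states away from being parallel.\<close>

lemma amp_overlap_le:
  assumes A: "is_qalg D A" and "qalg_prob A f (\<lambda>z. \<not> E z) \<le> 1/4" and "qalg_prob A g E \<le> 1/4"
  defines "l \<equiv> length (qA A)"
  shows "cmod (\<Sum>h\<in>outs A l. cnj (amp A l f h) * amp A l g h) \<le> 7/8"
proof -
  let ?E = "{h\<in>outs A l. E (qphi A h)}" and ?N = "{h\<in>outs A l. \<not> E (qphi A h)}"
  let ?s = "\<lambda>f S. \<Sum>h\<in>S. (cmod (amp A l f h))\<^sup>2"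
  have p: "qalg_prob A f E = ?s f {h\<in>outs A l. E (qphi A h)}" for f E
    unfolding qalg_prob_def qalg_outcomes_outs l_def qalg_weight_amp
    by (rule sum.inter_filter[symmetric]) (rule finite_outs)
  have EN: "?E \<union> ?N = outs A l" "?E \<inter> ?N = {}" "finite ?E" "finite ?N" by (auto simp: finite_outs)
  have split: "sum G (outs A l) = sum G ?E + sum G ?N" for G :: "nat list \<Rightarrow> complex"
    using sum.union_disjoint[OF EN(3,4,2), of G] by (simp only: EN(1))
  have tot: "?s f ?E + ?s f ?N = 1" for f
    using amp_normsq[OF A, of l f] sum.union_disjoint[OF EN(3,4,2), of "\<lambda>h. (cmod (amp A l f h))\<^sup>2"]
    unfolding EN(1) by (simp add: l_def)
  have "cmod (\<Sum>h\<in>outs A l. cnj (amp A l f h) * amp A l g h)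
    \<le> cmod (\<Sum>h\<in>?E. cnj (amp A l f h) * amp A l g h) + cmod (\<Sum>h\<in>?N. cnj (amp A l f h) * amp A l g h)"
    unfolding split by (rule norm_triangle_ineq)
  \<comment> \<open>In each part the large probability gets the weight 1/4 and the small one the
    weight 1. With error probabilities \<open>x\<close> and \<open>y\<close> the total is
    \<open>1/2 + 3/4 * (x + y)\<close>, which is at most 7/8.\<close>
  also have "\<dots> \<le> ((1/2) / 2 * ?s f ?E + 1 / (2 * (1/2)) * ?s g ?E) + (2 / 2 * ?s f ?N + 1 / (2 * 2) * ?s g ?N)"
    by (intro add_mono norm_sum_prod_le) auto
  also have "\<dots> \<le> 7/8"
    using tot[of f] tot[of g] assms(2,3) unfolding p by simp
  finally show ?thesis .
qed

section \<open>The hard instances: multiples of indicator functions\<close>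

definition bump :: "real \<Rightarrow> nat set \<Rightarrow> nat \<Rightarrow> real" where
  "bump h S = (\<lambda>i. if i \<in> S then h else 0)"

text \<open>Sets of size \<open>k\<close> are joined to the sets of size \<open>k + 1\<close> that
  contain them. Every edge must lose 1/8 of its initial inner product 1, while the sum over all
  edges drops by at most \<open>2 * card R / sqrt ((N - k) (k + 1))\<close> per query.\<close>

lemma bump_query_bound:
  fixes A :: "(nat, real, real) qalg" and h :: real
  assumes A: "is_qalg {..<N} A" and k: "k < N" and h: "h > 0"
    and acc: "\<And>S. S \<subseteq> {..<N} \<Longrightarrow> card S \<in> {k, Suc k} \<Longrightarrow>
       qalg_prob A (bump h S) (\<lambda>z. norm (sumN N (bump h S) - z) \<ge> h / (2 * real N)) \<le> 1/4"
  shows "sqrt (real (N - k) * real (Suc k)) \<le> 16 * real (qalg_queries A)"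
proof -
  define X where "X = {S. S \<subseteq> {..<N} \<and> card S = k}"
  define Y where "Y = {S. S \<subseteq> {..<N} \<and> card S = Suc k}"
  define R where "R = (SIGMA S:X. {..<N} - S)"
  \<comment> \<open>The degrees are \<open>N - k\<close> on the left and \<open>k + 1\<close> on the
    right. Counting edges from either end turns \<open>card X\<close> and \<open>card Y\<close> into
    \<open>card R\<close> over these degrees, and this \<alpha> makes the two terms of the bound
    equal.\<close>
  define \<alpha> where "\<alpha> = sqrt (real (N - k) / real (Suc k))"
  have \<alpha>: "\<alpha> > 0" using k by (simp add: \<alpha>_def)
  have finS: "finite S" if "S \<in> X \<union> Y" for S
  proof -
    have "S \<subseteq> {..<N}" using that unfolding X_def Y_def by blast
    thus ?thesis by (rule finite_subset) simp
  qed
  have finX: "finite X" and finY: "finite Y" by (auto simp: X_def Y_def)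
  have RY: "insert e S \<in> Y" if "(S, e) \<in> R" for S e
  proof -
    have "S \<in> X" "e \<in> {..<N} - S" using that by (simp_all add: R_def)
    moreover from this have "finite S" using finS by blast
    ultimately show ?thesis unfolding X_def Y_def by simp
  qed
  interpret adversary "{..<N}" "bump h" X Y R fst "\<lambda>(S, e). insert e S" snd \<alpha>
  proof
    show "finite R" using finX by (simp add: R_def)
    show "inj_on snd {\<rho> \<in> R. (case \<rho> of (S, e) \<Rightarrow> insert e S) = y}" for y
    proof (rule inj_onI)
      fix \<rho> \<sigma> assume "\<rho> \<in> {\<rho> \<in> R. (case \<rho> of (S, e) \<Rightarrow> insert e S) = y}"
        "\<sigma> \<in> {\<rho> \<in> R. (case \<rho> of (S, e) \<Rightarrow> insert e S) = y}" "snd \<rho> = snd \<sigma>"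
      moreover obtain S e where "\<rho> = (S, e)" by (cases \<rho>)
      moreover obtain S' e' where "\<sigma> = (S', e')" by (cases \<sigma>)
      ultimately have "\<rho> = (S, e)" "\<sigma> = (S', e)" "insert e S = insert e S'" "e \<notin> S" "e \<notin> S'"
        by (simp_all add: R_def)
      thus "\<rho> = \<sigma>" by (simp add: insert_ident)
    qed
    show "inj_on snd {\<rho> \<in> R. fst \<rho> = x}" for x by (auto simp: inj_on_def)
    show "fst \<rho> \<in> X" "(case \<rho> of (S, e) \<Rightarrow> insert e S) \<in> Y" if "\<rho> \<in> R" for \<rho>
      using that RY by (auto simp: R_def)
    show "bump h (fst \<rho>) z = bump h (case \<rho> of (S, e) \<Rightarrow> insert e S) z"
      if "\<rho> \<in> R" "z \<in> {..<N}" "z \<noteq> snd \<rho>" for \<rho> z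
      using that by (cases \<rho>) (auto simp: bump_def)
  qed (use finX finY \<alpha> in auto)
  have cR: "real (card R) = real (card X) * real (N - k)"
  proof -
    have "card R = (\<Sum>S\<in>X. card ({..<N} - S))" unfolding R_def
      by (rule card_SigmaI) (use finX in auto)
    also have "\<dots> = (\<Sum>S\<in>X. N - k)"
    proof (intro sum.cong refl)
      fix S assume "S \<in> X"
      hence "finite S" "S \<subseteq> {..<N}" "card S = k" using finS unfolding X_def by blast+
      thus "card ({..<N} - S) = N - k" by (simp only: card_Diff_subset card_lessThan)
    qed
    finally show ?thesis by simp
  qed
  have cR': "real (card R) = real (card Y) * real (Suc k)"
  proof -
    have "bij_betw (\<lambda>(S, e). (insert e S, e)) R (SIGMA S:Y. S)"
    proof (rule bij_betw_byWitness[where f' = "\<lambda>(S, e). (S - {e}, e)"])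
      show "(\<lambda>(S, e). (insert e S, e)) ` R \<subseteq> (SIGMA S:Y. S)" using RY by auto
      have "S - {e} \<in> X \<and> e \<in> {..<N} - (S - {e})" if "S \<in> Y" "e \<in> S" for S e
        using that unfolding X_def Y_def by auto
      thus "(\<lambda>(S, e). (S - {e}, e)) ` (SIGMA S:Y. S) \<subseteq> R" unfolding R_def by auto
    qed (auto simp: R_def insert_absorb)
    hence "card R = card (SIGMA S:Y. S)" by (rule bij_betw_same_card)
    also have "\<dots> = (\<Sum>S\<in>Y. card S)" by (rule card_SigmaI) (use finY finS in auto)
    also have "\<dots> = (\<Sum>S\<in>Y. Suc k)" by (intro sum.cong refl) (auto simp: Y_def)
    finally show ?thesis by (simp add: distrib_left)
  qed
  have "{..<k} \<in> X" using k by (auto simp: X_def)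
  hence "card X > 0" using finX by (auto simp: card_gt_0_iff)
  hence Rpos: "real (card R) > 0" using k by (simp add: cR)
  let ?n = "real (qalg_queries A)" and ?q = "sqrt (real (N - k) * real (Suc k))"
  have qpos: "?q > 0" using k by simp
  \<comment> \<open>The two means differ by \<open>h / N\<close>, so no output is closer than
    \<open>h / (2 * N)\<close> to both; correctness on both inputs provides the separating
    event.\<close>
  have "1/8 \<le> cmod (overlap A (length (qA A)) (fst \<rho>) (case \<rho> of (S, e) \<Rightarrow> insert e S) - 1)"
    if "\<rho> \<in> R" for \<rho>
  proof -
    obtain S e where \<rho>: "\<rho> = (S, e)" by (cases \<rho>)
    have S: "S \<subseteq> {..<N}" "card S = k" "e < N" "e \<notin> S" "finite S"
      using that finS[of S] by (auto simp: \<rho> R_def X_def)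
    let ?S' = "insert e S"
    have S': "?S' \<subseteq> {..<N}" "card ?S' = Suc k" using S by auto
    have sm: "sumN N (bump h S) = h * real (card S) / real N" if "S \<subseteq> {..<N}" for S
    proof -
      have "(\<Sum>i<N. bump h S i) = (\<Sum>i\<in>S. h)"
        unfolding bump_def using that by (simp add: sum.inter_restrict[symmetric] Int_absorb1)
      thus ?thesis by (simp add: sumN_def)
    qed
    have gap: "sumN N (bump h ?S') - sumN N (bump h S) = h / real N"
      using k by (simp add: sm S S' field_simps del: card_insert_disjoint)
    let ?E = "\<lambda>z. norm (sumN N (bump h S) - z) < h / (2 * real N)"
    have "qalg_prob A (bump h S) (\<lambda>z. \<not> ?E z) \<le> 1/4"
      using acc[of S] S by (simp add: not_less)
    moreover have "qalg_prob A (bump h ?S') ?E \<le> 1/4"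
    proof (rule order_trans[OF qalg_prob_mono acc[of ?S']])
      fix xs assume "norm (sumN N (bump h S) - qphi A xs) < h / (2 * real N)"
      thus "norm (sumN N (bump h ?S') - qphi A xs) \<ge> h / (2 * real N)"
        using gap by (simp add: field_simps abs_if split: if_splits)
    qed (use S' in auto)
    ultimately have "cmod (overlap A (length (qA A)) S ?S') \<le> 7/8"
      unfolding overlap_def by (rule amp_overlap_le[OF A])
    thus ?thesis
      using norm_triangle_ineq2[of 1 "overlap A (length (qA A)) S ?S'"] by (simp add: \<rho> norm_minus_commute)
  qed
  hence "(\<Sum>\<rho>\<in>R. 1/8) \<le> (\<Sum>\<rho>\<in>R. cmod (overlap A (length (qA A)) (fst \<rho>) (case \<rho> of (S, e) \<Rightarrow> insert e S) - 1))"
    by (intro sum_mono) auto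
  also have "\<dots> \<le> ?n * (\<alpha> * real (card X) + 1 / \<alpha> * real (card Y))"
    using overlap_bound[OF A order_refl] by (simp add: qalg_queries_def)
  also have "\<alpha> * real (card X) + 1 / \<alpha> * real (card Y) = 2 * real (card R) / ?q"
  proof -
    have x: "real (card X) = real (card R) / real (N - k)" using cR k by (simp add: field_simps)
    have y: "real (card Y) = real (card R) / real (Suc k)" using cR' by (simp add: field_simps)
    define a b where "a = sqrt (real (N - k))" and "b = sqrt (real (Suc k))"
    have ab: "a > 0" "b > 0" "real (N - k) = a * a" "real (Suc k) = b * b" using k by (auto simp: a_def b_def)
    have "\<alpha> = a / b" "?q = a * b" by (simp_all add: \<alpha>_def a_def b_def real_sqrt_divide real_sqrt_mult del: of_nat_Suc)
    thus ?thesis unfolding x y ab(3,4) using ab(1,2) by (simp add: field_simps)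
  qed
  finally have "real (card R) * (1/8) \<le> real (card R) * (2 * ?n / ?q)" by (simp add: mult_ac)
  hence "1/8 \<le> 2 * ?n / ?q" using Rpos by (simp only: mult_le_cancel_left_pos)
  moreover have "1/8 \<le> 2 * y / q \<Longrightarrow> q > 0 \<Longrightarrow> q \<le> 16 * y" for q y :: real
    by (simp add: field_simps)
  ultimately show ?thesis using qpos by blast
qed

section \<open>Elements of the unit ball and the lower bound\<close>

lemma Lp_ball_sum:
  assumes "f \<in> Lp_ball p N" "N \<ge> 1" "p \<ge> 1"
  shows "(\<Sum>i<N. \<bar>f i\<bar> powr p) \<le> real N"
proof -
  have "(1 / real N) * (\<Sum>i<N. \<bar>f i\<bar> powr p) \<le> 1"
  proof (rule ccontr)
    assume "\<not> ?thesis"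
    hence "((1 / real N) * (\<Sum>i<N. \<bar>f i\<bar> powr p)) powr (1 / p) > 1"
      using assms(3) by (intro gr_one_powr) auto
    thus False using assms(1) by (simp add: Lp_ball_def Lp_norm_def)
  qed
  thus ?thesis using assms(2) by (simp add: field_simps)
qed

text \<open>A crude bound that serves as the uniform bound on the solution which the supremum over
  the ball asks for; it follows from
  \<open>\<bar>x\<bar> \<le> 1 + \<bar>x\<bar> powr p\<close>.\<close>

lemma sumN_abs_le:
  assumes "f \<in> Lp_ball p N" "N \<ge> 1" "p \<ge> 1"
  shows "\<bar>sumN N f\<bar> \<le> 2"
proof -
  note s = Lp_ball_sum[OF assms]
  have le: "\<bar>x\<bar> \<le> 1 + \<bar>x\<bar> powr p" for x :: real
  proof (cases "\<bar>x\<bar> \<le> 1")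
    case False
    hence "\<bar>x\<bar> powr 1 \<le> \<bar>x\<bar> powr p" using assms(3) by (intro powr_mono) auto
    thus ?thesis using False by simp
  qed (simp add: add_increasing2)
  have "\<bar>\<Sum>i<N. f i\<bar> \<le> (\<Sum>i<N. 1 + \<bar>f i\<bar> powr p)"
    by (rule order_trans[OF sum_abs]) (intro sum_mono le)
  also have "\<dots> \<le> 2 * real N" using s by (simp add: sum.distrib)
  finally show ?thesis using assms(2) by (simp add: sumN_def abs_mult field_simps)
qed

text \<open>The height is tied to \<open>m\<close> and not to \<open>card S\<close>, so that one
  height serves the sets of both sizes \<open>k\<close> and \<open>k + 1\<close>.\<close>

lemma bump_in_ball:
  assumes "S \<subseteq> {..<N}" "card S \<le> m" "m > 0" "N \<ge> 1" "p \<ge> 1"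
  shows "bump ((real N / real m) powr (1 / p)) S \<in> Lp_ball p N"
proof -
  let ?h = "(real N / real m) powr (1 / p)"
  have "(\<Sum>i<N. \<bar>bump ?h S i\<bar> powr p) = (\<Sum>i<N. if i \<in> S then real N / real m else 0)"
    by (intro sum.cong refl) (use assms in \<open>auto simp: bump_def powr_powr\<close>)
  also have "\<dots> = real (card S) * (real N / real m)"
    using assms(1) by (simp add: sum.inter_restrict[symmetric] Int_absorb1)
  finally have "(1 / real N) * (\<Sum>i<N. \<bar>bump ?h S i\<bar> powr p) = real (card S) / real m"
    using assms(4) by simp
  also have "\<dots> \<le> 1" using assms(2,3) by simp
  finally have "Lp_norm p N (bump ?h S) \<le> 1"
    unfolding Lp_norm_def using assms(5)
    powr_mono2[of "1 / p" "(1 / real N) * (\<Sum>i<N. \<bar>bump ?h S i\<bar> powr p)" 1]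
    by (simp add: sum_nonneg)
  thus ?thesis using assms(1) by (auto simp: Lp_ball_def bump_def)
qed

text \<open>Needed because \<open>Inf\<close> of the empty set of reals is unspecified.\<close>

lemma trivial_qalg_ex:
  assumes "N \<ge> 1"
  shows "\<exists>A :: (nat, real, real) qalg. is_qalg {..<N} A \<and> qalg_queries A = 0"
proof
  let ?Q = "\<lparr>qm = 2, qm1 = 1, qm2 = 1, qZ = {0}, qtau = \<lambda>_. 0, qbeta = \<lambda>_. 0\<rparr> :: (nat, real) query"
  let ?A = "\<lparr>qA = [\<lparr>nmQ = ?Q, nmU = [\<lambda>a b. if a = b then 1 else 0]\<rparr>], qb = \<lambda>_. 0, qphi = \<lambda>_. 0\<rparr>
    :: (nat, real, real) qalg"
  have "is_unitary 4 (\<lambda>a b. if a = b then 1 else 0)"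
    unfolding is_unitary_def
  proof (intro allI impI)
    fix i j :: nat assume "i < 4" "j < 4"
    have "(\<Sum>k<4. cnj (if k = i then 1 else 0) * (if k = j then 1 else 0 :: complex)) = (\<Sum>k<4. if k = i then (if i = j then 1 else 0) else 0)"
      by (intro sum.cong refl) auto
    thus "(\<Sum>k<4. cnj (if k = i then 1 else 0) * (if k = j then 1 else 0 :: complex)) = (if i = j then 1 else 0)"
      using \<open>i < 4\<close> by simp
  qed
  thus "is_qalg {..<N} ?A \<and> qalg_queries ?A = 0"
    using assms by (simp add: is_qalg_def is_nm_alg_def is_query_def qalg_queries_def nm_queries_def nm_qubits_def)
qed

lemma lower_bound:
  fixes n N :: nat and p :: real
  assumes p: "1 \<le> p" and N: "N \<ge> 1" and n1: "64 * sqrt (real N) \<le> 64 * real n" and n2: "real n \<le> 1/64 * real N"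
  shows "1/2 * 1000 powr (- 1 / p) * real n powr (- 2 / p) * real N powr (2 / p - 1)
    \<le> min_query_err n {..<N} (sumN N) (Lp_ball p N)"
proof -
  have nN: "real N \<le> (real n)\<^sup>2" by (rule sqrt_le_D) (use n1 in simp)
  have n0: "real n > 0" using n1 N by (smt (verit) real_sqrt_gt_zero of_nat_0_less_iff less_le_trans zero_less_one less_numeral_extra(1))
  \<comment> \<open>The range of \<open>n\<close> is empty for small \<open>N\<close>. Large
    \<open>N\<close> absorbs the 1 lost by rounding \<open>k\<close> up.\<close>
  have NN: "real N \<ge> 4096"
  proof -
    have "real N \<le> real n * real n" using nN by (simp add: power2_eq_square)
    also have "\<dots> \<le> (1/64 * real N) * (1/64 * real N)" using n2 by (intro mult_mono) auto
    finally have "real N * 4096 \<le> real N * real N" by simp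
    thus ?thesis using N by simp
  qed
  \<comment> \<open>The factor 512 makes \<open>(N - k) * (k + 1)\<close> exceed
    \<open>N / 2 * 512 * n\<^sup>2 / N = (16 * n)\<^sup>2\<close>. The estimate
    \<open>k \<le> N / 2\<close> behind this is where \<open>n \<le> N / 64\<close> enters.\<close>
  define k where "k = nat \<lceil>512 * (real n)\<^sup>2 / real N\<rceil>"
  have nn: "(real n)\<^sup>2 \<le> (real N)\<^sup>2 / 4096"
  proof -
    have "(real n)\<^sup>2 \<le> (1/64 * real N)\<^sup>2" using n2 by (intro power_mono) auto
    thus ?thesis by (simp add: power_divide power_mult_distrib)
  qed
  have k1: "real k \<ge> 512 * (real n)\<^sup>2 / real N" unfolding k_def by (rule real_nat_ceiling_ge)
  have k2: "real k \<le> 512 * (real n)\<^sup>2 / real N + 1"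
  proof -
    have "0 \<le> 512 * (real n)\<^sup>2 / real N" by simp
    thus ?thesis unfolding k_def by linarith
  qed
  have "512 * (real n)\<^sup>2 / real N \<le> real N / 8"
    using nn N by (simp add: field_simps power2_eq_square)
  hence kN: "real k \<le> real N / 2" using k2 NN by linarith
  hence kN': "k < N" using NN by linarith
  define h where "h = (real N / real (Suc k)) powr (1 / p)"
  have h: "h > 0" using N by (simp add: h_def)
  obtain A0 :: "(nat, real, real) qalg" where A0: "is_qalg {..<N} A0" "qalg_queries A0 = 0"
    using trivial_qalg_ex[OF N] by blast
  have "min_query_err n {..<N} (sumN N) (Lp_ball p N) \<ge> h / (2 * real N)"
  proof (rule min_query_err_ge[OF A0(1)])
    show "qalg_queries A0 \<le> n" by (simp add: A0)
    show "norm (sumN N f) \<le> 2" if "f \<in> Lp_ball p N" for f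
      using sumN_abs_le[OF that N p] by simp
    fix A :: "(nat, real, real) qalg" assume A: "is_qalg {..<N} A" "qalg_queries A \<le> n"
    show "\<exists>f\<in>Lp_ball p N. 1/4 < qalg_prob A f (\<lambda>z. h / (2 * real N) \<le> norm (sumN N f - z))"
    proof (rule ccontr)
      assume neg: "\<not> ?thesis"
      have "sqrt (real (N - k) * real (Suc k)) \<le> 16 * real (qalg_queries A)"
      proof (rule bump_query_bound[OF A(1) kN' h])
        fix S assume S: "S \<subseteq> {..<N}" "card S \<in> {k, Suc k}"
        hence "bump h S \<in> Lp_ball p N" unfolding h_def by (intro bump_in_ball) (use N p in auto)
        thus "qalg_prob A (bump h S) (\<lambda>z. h / (2 * real N) \<le> norm (sumN N (bump h S) - z)) \<le> 1/4"
          using neg by force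
      qed
      also have "\<dots> \<le> 16 * real n" using A(2) by simp
      finally have "real (N - k) * real (Suc k) \<le> (16 * real n)\<^sup>2"
        by (rule sqrt_le_D)
      moreover have "(16 * real n)\<^sup>2 < real (N - k) * real (Suc k)"
      proof -
        have "(16 * real n)\<^sup>2 = real N / 2 * (512 * (real n)\<^sup>2 / real N)"
          using N by (simp add: power_mult_distrib field_simps)
        also have "\<dots> \<le> real N / 2 * real k" using k1 by (intro mult_left_mono) auto
        also have "\<dots> \<le> real (N - k) * real k" using kN kN' by (intro mult_right_mono) auto
        also have "\<dots> < real (N - k) * real (Suc k)" using kN' by simp
        finally show ?thesis .
      qed
      ultimately show False by linarith
    qed
  qed
  moreover have "1/2 * 1000 powr (- 1 / p) * real n powr (- 2 / p) * real N powr (2 / p - 1) \<le> h / (2 * real N)"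
  proof -
    have "real (Suc k) \<le> 514 * (real n)\<^sup>2 / real N"
    proof -
      have "1 \<le> (real n)\<^sup>2 / real N" using nN N by simp
      thus ?thesis using k2 by simp
    qed
    also have "\<dots> \<le> 1000 * (real n)\<^sup>2 / real N" by (simp add: divide_right_mono)
    finally have "real N / (1000 * (real n)\<^sup>2 / real N) \<le> real N / real (Suc k)"
      using N n0 by (intro divide_left_mono mult_pos_pos divide_pos_pos) auto
    hence "(real N / (1000 * (real n)\<^sup>2 / real N)) powr (1 / p) \<le> h"
      unfolding h_def using p by (intro powr_mono2) auto
    moreover have "(real N / (1000 * (real n)\<^sup>2 / real N)) powr (1 / p)
        = 1000 powr (- 1 / p) * real n powr (- 2 / p) * real N powr (2 / p)"
    proof -
      have "real N / (1000 * (real n)\<^sup>2 / real N) = 1000 powr (-1) * real n powr (-2) * real N powr 2"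
        using N n0 by (simp add: powr_minus powr_numeral field_simps power2_eq_square)
      thus ?thesis by (simp only: powr_mult powr_powr) simp
    qed
    ultimately have "1000 powr (- 1 / p) * real n powr (- 2 / p) * real N powr (2 / p) \<le> h" by simp
    moreover have "real N powr (2 / p - 1) = real N powr (2 / p) / real N"
      using N by (simp add: powr_diff)
    ultimately show ?thesis using N by (simp add: divide_right_mono)
  qed
  ultimately show ?thesis by linarith
qed

section \<open>Controlled Grover iterations\<close>

text \<open>All algorithms built for the upper bound start in the basis state 0.\<close>

abbreviation nm_prob :: "('d, 'k) nm_alg \<Rightarrow> ('d \<Rightarrow> 'k) \<Rightarrow> nat \<Rightarrow> real" where
  "nm_prob A f x \<equiv> (cmod (nm_mat A f x 0))\<^sup>2"

lemma sum_lessThan_mult: "(\<Sum>a<A * B. g a) = (\<Sum>q<A. \<Sum>r<B. g (q * B + r))" for A B :: nat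
  by (simp add: sum.nat_group[symmetric] sum.atLeastLessThan_shift_0[of g "_ * B"] atLeast0LessThan comp_def add.commute)

lemma mat_app_cong: "(\<And>k. k < d \<Longrightarrow> v k = v' k) \<Longrightarrow> mat_app d M v = mat_app d M v'"
  unfolding mat_app_def by (intro ext sum.cong refl) auto

text \<open>For an orthonormal family this is the reflection that negates its span. A family is
  allowed instead of one vector because a controlled diffusion reflects simultaneously in one vector
  for each active counter value.\<close>

definition refl_mat :: "'t set \<Rightarrow> ('t \<Rightarrow> nat \<Rightarrow> real) \<Rightarrow> nat \<Rightarrow> nat \<Rightarrow> complex" where
  "refl_mat S v = (\<lambda>a b. of_real ((if a = b then 1 else 0) - 2 * (\<Sum>t\<in>S. v t a * v t b)))"

text \<open>The matrix is \<open>1 - 2 P\<close>, where \<open>P\<close> is real, symmetric and, by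
  orthonormality, idempotent.\<close>

lemma refl_mat_unitary:
  assumes "\<And>s t. s \<in> S \<Longrightarrow> t \<in> S \<Longrightarrow> (\<Sum>a<d. v s a * v t a) = (if s = t then 1 else 0)" and S: "finite S"
  shows "is_unitary d (refl_mat S v)"
  unfolding is_unitary_def
proof (intro allI impI)
  fix i j assume ij: "i < d" "j < d"
  define P where "P = (\<lambda>a b. \<Sum>t\<in>S. v t a * v t b)"
  have Psym: "P a b = P b a" for a b by (simp add: P_def mult.commute)
  have "(\<Sum>k<d. P k i * P k j) = (\<Sum>k<d. \<Sum>s\<in>S. \<Sum>t\<in>S. v s i * v t j * (v s k * v t k))"
    unfolding P_def sum_product by (intro sum.cong refl) (simp add: algebra_simps)
  also have "\<dots> = (\<Sum>s\<in>S. \<Sum>t\<in>S. \<Sum>k<d. v s i * v t j * (v s k * v t k))"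
    by (subst sum.swap, rule sum.cong[OF refl], subst sum.swap, rule refl)
  also have "\<dots> = (\<Sum>s\<in>S. \<Sum>t\<in>S. v s i * v t j * (if s = t then 1 else 0))"
    unfolding sum_distrib_left[symmetric] by (intro sum.cong refl) (simp add: assms(1))
  also have "\<dots> = P i j"
    by (simp add: P_def S if_distrib[where f = "\<lambda>z. _ * z"] cong: if_cong)
  finally have PP: "(\<Sum>k<d. P k i * P k j) = P i j" .
  have "(\<Sum>k<d. cnj (refl_mat S v k i) * refl_mat S v k j)
    = of_real (\<Sum>k<d. ((if k = i then 1 else 0) - 2 * P k i) * ((if k = j then 1 else 0) - 2 * P k j))"
    by (simp add: refl_mat_def P_def)
  also have "(\<Sum>k<d. ((if k = i then 1 else 0) - 2 * P k i) * ((if k = j then 1 else 0) - 2 * P k j))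
    = (\<Sum>k<d. (if k = i then (if i = j then 1 else 0) else 0) - (if k = j then 2 * P j i else 0)
         - (if k = i then 2 * P i j else 0) + 4 * (P k i * P k j))"
    by (intro sum.cong refl) (auto simp: algebra_simps)
  also have "\<dots> = (if i = j then 1 else 0)"
    using ij by (simp add: sum.distrib sum_subtractf sum_distrib_left[symmetric] PP Psym[of j i])
  finally show "(\<Sum>k<d. cnj (refl_mat S v k i) * refl_mat S v k j) = (if i = j then 1 else 0)" by simp
qed

lemma refl_mat_app:
  assumes "a < d"
  shows "mat_app d (refl_mat S v) w a = w a - 2 * (\<Sum>t\<in>S. of_real (v t a) * (\<Sum>k<d. of_real (v t k) * w k))"
proof -
  have "mat_app d (refl_mat S v) w a = (\<Sum>k<d. (if k = a then w a else 0) - 2 * (\<Sum>t\<in>S. of_real (v t a) * (of_real (v t k) * w k)))"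
    unfolding mat_app_def refl_mat_def
    by (intro sum.cong refl) (auto simp: algebra_simps sum_distrib_left)
  also have "\<dots> = w a - 2 * (\<Sum>k<d. \<Sum>t\<in>S. of_real (v t a) * (of_real (v t k) * w k))"
    using assms by (simp add: sum_subtractf sum_distrib_left)
  finally show ?thesis by (subst (asm) sum.swap) (simp add: sum_distrib_left)
qed

text \<open>Householder reflection: reflecting in the direction of \<open>e - u\<close>, where
  \<open>e\<close> is the first basis vector, exchanges \<open>e\<close> and the unit vector
  \<open>u\<close>. The direction degenerates only for \<open>u = e\<close>, where the identity
  does.\<close>

lemma unitary_with_first_column:
  fixes u :: "nat \<Rightarrow> real"
  assumes "(\<Sum>a<d. (u a)\<^sup>2) = 1" "d > 0"
  shows "\<exists>U. is_unitary d U \<and> (\<forall>a<d. U a 0 = of_real (u a))"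
proof (cases "u 0 = 1")
  case True
  have split: "(\<Sum>a<d. (u a)\<^sup>2) = (u 0)\<^sup>2 + (\<Sum>a\<in>{..<d} - {0}. (u a)\<^sup>2)"
    using assms(2) by (intro sum.remove) auto
  hence "(\<Sum>a\<in>{..<d} - {0}. (u a)\<^sup>2) = 0" using assms(1) True by simp
  hence z: "u a = 0" if "a < d" "a \<noteq> 0" for a
    using that by (subst (asm) sum_nonneg_eq_0_iff) auto
  have "is_unitary d (refl_mat {} (\<lambda>(_::nat) _. 0))" by (rule refl_mat_unitary) auto
  moreover have "refl_mat {} (\<lambda>(_::nat) _. 0) a 0 = of_real (u a)" if "a < d" for a
    using that z True by (simp add: refl_mat_def)
  ultimately show ?thesis by blast
next
  case False
  have "(u 0)\<^sup>2 \<le> (\<Sum>a<d. (u a)\<^sup>2)" by (rule member_le_sum) (use assms(2) in auto)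
  hence "u 0 \<le> 1" using assms(1) by (simp add: abs_square_le_1 abs_le_iff)
  hence lt: "u 0 < 1" using False by simp
  define z where "z = (\<lambda>a. (if a = 0 then 1 else 0) - u a)"
  define s where "s = sqrt (2 * (1 - u 0))"
  have s: "s > 0" "s * s = 2 * (1 - u 0)" using lt by (auto simp: s_def)
  have "(\<Sum>a<d. z a * z a) = (\<Sum>a<d. (if a = 0 then 1 - 2 * u 0 else 0) + (u a)\<^sup>2)"
    by (intro sum.cong refl) (auto simp: z_def power2_eq_square algebra_simps)
  also have "\<dots> = 2 * (1 - u 0)" using assms by (simp add: sum.distrib)
  finally have zz: "(\<Sum>a<d. z a * z a) = s * s" using s by simp
  let ?U = "refl_mat {0::nat} (\<lambda>_ a. z a / s)"
  have "is_unitary d ?U"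
    by (rule refl_mat_unitary) (use s(1) zz in \<open>auto simp: sum_divide_distrib[symmetric]\<close>)
  moreover have "?U a 0 = of_real (u a)" if "a < d" for a
  proof -
    have "2 * (z a * z 0) = s * s * z a" unfolding s(2) by (simp add: z_def)
    hence "2 * (z a / s * (z 0 / s)) = z a" using s(1) by (simp add: field_simps)
    hence "(if a = 0 then 1 else 0) - 2 * (z a / s * (z 0 / s)) = u a" by (simp add: z_def)
    thus ?thesis by (simp add: refl_mat_def del: of_real_diff of_real_mult of_real_divide)
  qed
  ultimately show ?thesis by blast
qed

text \<open>Unnormalised amplitudes on marked and unmarked basis states after \<open>n\<close> Grover iterations
  started in the uniform superposition, where \<open>a\<close> is the marked fraction.\<close>

fun grover_amp :: "real \<Rightarrow> nat \<Rightarrow> real \<times> real" where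
  "grover_amp a 0 = (1, 1)"
| "grover_amp a (Suc n) = (let (x, y) = grover_amp a n
     in ((1 - 2 * a) * x + 2 * (1 - a) * y, (1 - 2 * a) * y - 2 * a * x))"

abbreviation sel :: "bool \<Rightarrow> 'a \<times> 'a \<Rightarrow> 'a" where
  "sel b p \<equiv> (if b then fst p else snd p)"

text \<open>A basis state holds an argument \<open>i\<close>, a function value \<open>x\<close>, a counter \<open>t\<close> and an auxiliary
  index \<open>j\<close>. The pair \<open>(i, j)\<close> is marked if \<open>\<chi> (\<beta> (f i)) j\<close>; the Grover iteration number \<open>s\<close> is
  executed only on the counter values with \<open>ctl s t\<close>.\<close>

locale amplification =
  fixes N m1 m2 \<delta> \<nu> L :: nat and \<beta> :: "real \<Rightarrow> nat" and \<chi> :: "nat \<Rightarrow> nat \<Rightarrow> bool"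
    and ctl :: "nat \<Rightarrow> nat \<Rightarrow> bool" and w :: "nat \<Rightarrow> real" and Fm :: "nat \<Rightarrow> nat \<Rightarrow> complex"
  assumes N: "N \<ge> 1" "N \<le> 2 ^ m1" and m1: "m1 \<ge> 1" and m2: "m2 \<ge> 1" and \<beta>: "\<And>y. \<beta> y < 2 ^ m2"
    and w: "(\<Sum>t<2 ^ \<delta>. (w t)\<^sup>2) = 1" and Fm: "is_unitary (2 ^ \<delta>) Fm"
begin

text \<open>The blocks \<open>i\<close> and \<open>x\<close> lead, as in the definition of a query;
  the counter \<open>t\<close> and the index \<open>j\<close> together form the block that the query
  leaves alone.\<close>

definition enc :: "nat \<Rightarrow> nat \<Rightarrow> nat \<Rightarrow> nat \<Rightarrow> nat" where
  "enc i x t j = ((i * 2 ^ m2 + x) * 2 ^ \<delta> + t) * 2 ^ \<nu> + j"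

definition "dj a = a mod (2::nat) ^ \<nu>"
definition "dt a = a div 2 ^ \<nu> mod (2::nat) ^ \<delta>"
definition "dx a = a div 2 ^ \<nu> div 2 ^ \<delta> mod (2::nat) ^ m2"
definition "di a = a div 2 ^ \<nu> div 2 ^ \<delta> div (2::nat) ^ m2"

lemma dec_enc [simp]:
  assumes "x < 2 ^ m2" "t < 2 ^ \<delta>" "j < 2 ^ \<nu>"
  shows "di (enc i x t j) = i" "dx (enc i x t j) = x" "dt (enc i x t j) = t" "dj (enc i x t j) = j"
proof -
  have 1: "enc i x t j div 2 ^ \<nu> = (i * 2 ^ m2 + x) * 2 ^ \<delta> + t"
    unfolding enc_def using assms(3) by simp
  have 2: "((i * 2 ^ m2 + x) * 2 ^ \<delta> + t) div 2 ^ \<delta> = i * 2 ^ m2 + x"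
    using assms(2) by simp
  show "di (enc i x t j) = i" unfolding di_def 1 2 using assms(1) by simp
  show "dx (enc i x t j) = x" unfolding dx_def 1 2 using assms(1) by simp
  show "dt (enc i x t j) = t" unfolding dt_def 1 using assms(2) by simp
  show "dj (enc i x t j) = j" unfolding dj_def enc_def using assms(3) by simp
qed

lemma enc_dec [simp]: "enc (di a) (dx a) (dt a) (dj a) = a"
  unfolding enc_def di_def dx_def dt_def dj_def by (simp only: div_mult_mod_eq)

lemma dec_less [simp]: "dx a < 2 ^ m2" "dt a < 2 ^ \<delta>" "dj a < 2 ^ \<nu>"
  by (simp_all add: dx_def dt_def dj_def)

definition "hdim = (2::nat) ^ (m1 + m2 + \<delta> + \<nu>)"

lemma di_less_iff: "a < hdim \<longleftrightarrow> di a < 2 ^ m1"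
  unfolding di_def hdim_def by (simp add: div_less_iff_less_mult power_add mult.assoc)

lemma enc_less_iff [simp]:
  assumes "x < 2 ^ m2" "t < 2 ^ \<delta>" "j < 2 ^ \<nu>"
  shows "enc i x t j < hdim \<longleftrightarrow> i < 2 ^ m1"
  using assms by (simp add: di_less_iff)

lemma sum_enc: "(\<Sum>a<hdim. g a) = (\<Sum>i<2 ^ m1. \<Sum>x<2 ^ m2. \<Sum>t<2 ^ \<delta>. \<Sum>j<2 ^ \<nu>. g (enc i x t j))"
  unfolding hdim_def power_add sum_lessThan_mult enc_def by (rule refl)

definition qry :: "(nat, real) query" where
  "qry = \<lparr>qm = m1 + m2 + \<delta> + \<nu>, qm1 = m1, qm2 = m2, qZ = {..<N}, qtau = id, qbeta = \<beta>\<rparr>"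

lemma is_query_qry: "is_query {..<N} qry"
  unfolding is_query_def qry_def using N m1 m2 \<beta> by (auto simp: lessThan_empty_iff)

lemma qm_qry [simp]: "2 ^ qm qry = hdim" by (simp add: qry_def hdim_def)

lemma query_perm_enc:
  assumes "x < 2 ^ m2" "t < 2 ^ \<delta>" "j < 2 ^ \<nu>"
  shows "query_perm qry f (enc i x t j) = (if i < N then enc i ((x + \<beta> (f i)) mod 2 ^ m2) t j else enc i x t j)"
proof -
  have e: "enc i x t j = i * 2 ^ (m2 + (\<delta> + \<nu>)) + x * 2 ^ (\<delta> + \<nu>) + (t * 2 ^ \<nu> + j)" for i x
    by (simp add: enc_def power_add algebra_simps)
  have "t * 2 ^ \<nu> + j < Suc t * 2 ^ \<nu>" using assms(3) by simp
  also have "\<dots> \<le> 2 ^ \<delta> * 2 ^ \<nu>" using assms(2) by (intro mult_right_mono) auto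
  finally have y: "t * 2 ^ \<nu> + j < 2 ^ (\<delta> + \<nu>)" by (simp add: power_add)
  note J = join_index[OF assms(1) y, of i, folded e]
  have r: "qm qry - qm1 qry - qm2 qry = \<delta> + \<nu>" "qm qry - qm1 qry = m2 + (\<delta> + \<nu>)"
    "qm2 qry = m2" "qZ qry = {..<N}" "qtau qry = id" "qbeta qry = \<beta>"
    by (simp_all add: qry_def)
  show ?thesis unfolding query_perm_def Let_def r(1) unfolding r(2-) J by (simp add: e)
qed

text \<open>Negation of the value register. Between two queries it makes the second query add
  \<open>\<beta> (f i)\<close> to \<open>- \<beta> (f i)\<close>, so the value register returns to 0
  although the same query is used twice and no inverse query is available.\<close>

definition "neg_perm a = enc (di a) ((2 ^ m2 - dx a) mod 2 ^ m2) (dt a) (dj a)"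

text \<open>The sign is put on unmarked states, and \<open>diffusion\<close> negates the uniform
  vector; these two signs together give the usual Grover iteration exactly. A leftover global sign
  would not be harmless, since it would become a relative phase between counter values that undergo
  different numbers of iterations.\<close>

definition "phase s a = (if ctl s (dt a) \<and> \<not> \<chi> (dx a) (dj a) then -1 else 1 :: complex)"

definition "oracle_mat s = mono_mat neg_perm (phase s)"

definition "unif t a = (if dx a = 0 \<and> di a < N \<and> dt a = t then 1 / sqrt (real N * 2 ^ \<nu>) else 0)"

definition "diffusion s = refl_mat {t. t < 2 ^ \<delta> \<and> ctl s t} unif"

definition "init_amp a = (if dx a = 0 \<and> di a < N then w (dt a) / sqrt (real N * 2 ^ \<nu>) else 0)"

text \<open>Only the first column matters, as the algorithm starts in the basis state 0; any unitary
  completion will do.\<close>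

definition "prep = (SOME U. is_unitary hdim U \<and> (\<forall>a<hdim. U a 0 = of_real (init_amp a)))"

definition "final_mat a b = (if di a = di b \<and> dx a = dx b \<and> dj a = dj b then Fm (dt a) (dt b) else 0)"

text \<open>Each listed matrix is preceded by a query, so one iteration uses two: one before the
  phase and one that erases the value register. The query before \<open>final_mat\<close> in
  \<open>alg\<close> writes the value of \<open>f\<close>, to be read off by the
  measurement.\<close>

definition "grover_steps l = concat (map (\<lambda>s. [oracle_mat s, diffusion s]) [0..<l])"

definition alg :: "(nat, real) nm_alg" where
  "alg = \<lparr>nmQ = qry, nmU = prep # grover_steps L @ [final_mat]\<rparr>"

lemma neg_perm_less: "a < hdim \<Longrightarrow> neg_perm a < hdim"
  unfolding neg_perm_def by (simp add: di_less_iff)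

lemma neg_perm_inj: "inj neg_perm"
proof (rule injI)
  fix a b assume eq: "neg_perm a = neg_perm b"
  have d: "di (neg_perm a) = di a" "dx (neg_perm a) = (2 ^ m2 - dx a) mod 2 ^ m2"
    "dt (neg_perm a) = dt a" "dj (neg_perm a) = dj a" for a
    by (simp_all add: neg_perm_def)
  have xx: "(2 ^ m2 - dx a) mod 2 ^ m2 = (2 ^ m2 - dx b) mod 2 ^ m2"
    using arg_cong[OF eq, of dx] by (simp only: d)
  have neg: "y = z" if "(K - y) mod K = (K - z) mod K" "y < K" "z < K" for y z K :: nat
  proof -
    have m: "(K - y) mod K = (if y = 0 then 0 else K - y)" if "y < K" for y using that by simp
    have "(if y = 0 then 0 else K - y) = (if z = 0 then 0 else K - z)"
      using that(1) unfolding m[OF that(2)] m[OF that(3)] .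
    thus ?thesis using that(2,3) by presburger
  qed
  have "dx a = dx b" by (rule neg[OF xx dec_less(1) dec_less(1)])
  moreover have "di a = di b" using arg_cong[OF eq, of di] by (simp only: d)
  moreover have "dt a = dt b" using arg_cong[OF eq, of dt] by (simp only: d)
  moreover have "dj a = dj b" using arg_cong[OF eq, of dj] by (simp only: d)
  ultimately show "a = b" using enc_dec[of a] enc_dec[of b] by metis
qed

lemma oracle_unitary: "is_unitary hdim (oracle_mat s)"
  unfolding oracle_mat_def
  by (rule mono_mat_unitary) (auto simp: phase_def neg_perm_less intro: inj_on_subset[OF neg_perm_inj])

lemma sum_unif:
  fixes h :: "nat \<Rightarrow> 'z::comm_monoid_add"
  assumes "t < 2 ^ \<delta>"
  shows "(\<Sum>a<hdim. if dx a = 0 \<and> di a < N \<and> dt a = t then h a else 0) = (\<Sum>i<N. \<Sum>j<2 ^ \<nu>. h (enc i 0 t j))"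
proof -
  let ?S = "\<lambda>i x t' j. if dx (enc i x t' j) = 0 \<and> di (enc i x t' j) < N \<and> dt (enc i x t' j) = t then h (enc i x t' j) else 0"
  have "(\<Sum>a<hdim. if dx a = 0 \<and> di a < N \<and> dt a = t then h a else 0)
    = (\<Sum>i<2 ^ m1. if i < N then (\<Sum>j<2 ^ \<nu>. h (enc i 0 t j)) else 0)"
    unfolding sum_enc
  proof (intro sum.cong refl)
    fix i assume "i \<in> {..<(2::nat) ^ m1}"
    have "(\<Sum>x<2 ^ m2. \<Sum>t'<2 ^ \<delta>. \<Sum>j<2 ^ \<nu>. ?S i x t' j)
      = (\<Sum>x<(2::nat) ^ m2. if x = 0 then (\<Sum>t'<(2::nat) ^ \<delta>. if t' = t then (\<Sum>j<2 ^ \<nu>. if i < N then h (enc i 0 t j) else 0) else 0) else 0)"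
    proof (rule sum.cong[OF refl])
      fix x assume "x \<in> {..<(2::nat) ^ m2}"
      hence x: "x < 2 ^ m2" by simp
      show "(\<Sum>t'<2 ^ \<delta>. \<Sum>j<2 ^ \<nu>. ?S i x t' j)
        = (if x = 0 then (\<Sum>t'<(2::nat) ^ \<delta>. if t' = t then (\<Sum>j<2 ^ \<nu>. if i < N then h (enc i 0 t j) else 0) else 0) else 0)"
      proof (cases "x = 0")
        case True
        have "(\<Sum>j<2 ^ \<nu>. ?S i x t' j)
          = (if t' = t then (\<Sum>j<2 ^ \<nu>. if i < N then h (enc i 0 t j) else 0) else 0)" if "t' < 2 ^ \<delta>" for t'
          using that True by (cases "t' = t") (auto intro!: sum.cong)
        thus ?thesis using True by simp
      qed (use x in simp)
    qed
    thus "(\<Sum>x<2 ^ m2. \<Sum>t'<2 ^ \<delta>. \<Sum>j<2 ^ \<nu>. ?S i x t' j) = (if i < N then (\<Sum>j<2 ^ \<nu>. h (enc i 0 t j)) else 0)"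
      using assms by simp
  qed
  also have "\<dots> = (\<Sum>i<N. \<Sum>j<2 ^ \<nu>. h (enc i 0 t j))"
    using N(2) by (simp add: sum.If_cases Int_absorb1 lessThan_def Int_absorb2 subset_iff less_le_trans)
  finally show ?thesis .
qed

lemma diffusion_unitary: "is_unitary hdim (diffusion s)"
  unfolding diffusion_def
proof (rule refl_mat_unitary)
  fix s' t assume st: "s' \<in> {t. t < 2 ^ \<delta> \<and> ctl s t}" "t \<in> {t. t < 2 ^ \<delta> \<and> ctl s t}"
  have NJ: "sqrt (real N * 2 ^ \<nu>) * sqrt (real N * 2 ^ \<nu>) = real N * 2 ^ \<nu>" "real N * 2 ^ \<nu> > 0" using N by auto
  have "(\<Sum>a<hdim. unif s' a * unif t a) = (\<Sum>a<hdim. if dx a = 0 \<and> di a < N \<and> dt a = t then (if s' = t then 1 / (real N * 2 ^ \<nu>) else 0) else 0)"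
    by (intro sum.cong refl) (auto simp: unif_def NJ)
  also have "\<dots> = (if s' = t then 1 else 0)"
    using st NJ(2) by (subst sum_unif) auto
  finally show "(\<Sum>a<hdim. unif s' a * unif t a) = (if s' = t then 1 else 0)" .
qed simp

lemma prep: "is_unitary hdim prep" "a < hdim \<Longrightarrow> prep a 0 = of_real (init_amp a)"
proof -
  have NJ: "(sqrt (real N * 2 ^ \<nu>))\<^sup>2 = real N * 2 ^ \<nu>" "real N * 2 ^ \<nu> > 0" using N by auto
  have "(\<Sum>a<hdim. (init_amp a)\<^sup>2) = (\<Sum>a<hdim. \<Sum>t<2 ^ \<delta>. if dx a = 0 \<and> di a < N \<and> dt a = t then (w t)\<^sup>2 / (real N * 2 ^ \<nu>) else 0)"
    by (intro sum.cong refl) (auto simp: init_amp_def power_divide NJ)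
  also have "\<dots> = (\<Sum>t<2 ^ \<delta>. \<Sum>a<hdim. if dx a = 0 \<and> di a < N \<and> dt a = t then (w t)\<^sup>2 / (real N * 2 ^ \<nu>) else 0)"
    by (rule sum.swap)
  also have "\<dots> = (\<Sum>t<2 ^ \<delta>. (w t)\<^sup>2)"
    by (intro sum.cong refl, subst sum_unif) (use NJ(2) in auto)
  finally have "(\<Sum>a<hdim. (init_amp a)\<^sup>2) = 1" using w by simp
  hence "\<exists>U. is_unitary hdim U \<and> (\<forall>a<hdim. U a 0 = of_real (init_amp a))"
    by (rule unitary_with_first_column) (simp add: hdim_def)
  from someI_ex[OF this, folded prep_def]
  show "is_unitary hdim prep" "a < hdim \<Longrightarrow> prep a 0 = of_real (init_amp a)" by blast+
qed

lemma sum_fibre: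
  fixes g :: "nat \<Rightarrow> 'z::comm_monoid_add" and i x j :: nat
  assumes "i < 2 ^ m1" "x < 2 ^ m2" "j < 2 ^ \<nu>"
  shows "(\<Sum>i'<2 ^ m1. \<Sum>x'<2 ^ m2. \<Sum>t<2 ^ \<delta>. \<Sum>j'<2 ^ \<nu>. if j' = j \<and> x' = x \<and> i' = i then g t else 0) = (\<Sum>t<2 ^ \<delta>. g t)"
proof -
  have 1: "(\<Sum>j'<2 ^ \<nu>. if j' = j \<and> x' = x \<and> i' = i then g t else 0) = (if x' = x \<and> i' = i then g t else 0)" for i' x' t
    using assms(3) by (cases "x' = x \<and> i' = i") auto
  have 2: "(\<Sum>t<2 ^ \<delta>. if x' = x \<and> i' = i then g t else 0) = (if x' = x \<and> i' = i then \<Sum>t<2 ^ \<delta>. g t else 0)" for i' x'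
    by auto
  have 3: "(\<Sum>x'<2 ^ m2. if x' = x \<and> i' = i then \<Sum>t<2 ^ \<delta>. g t else 0) = (if i' = i then \<Sum>t<2 ^ \<delta>. g t else 0)" for i'
    using assms(2) by (cases "i' = i") auto
  show ?thesis unfolding 1 2 3 using assms(1) by simp
qed

lemma final_mat_unitary: "is_unitary hdim final_mat"
  unfolding is_unitary_def
proof (intro allI impI)
  fix a b assume ab: "a < hdim" "b < hdim"
  have "(\<Sum>k<hdim. cnj (final_mat k a) * final_mat k b)
    = (\<Sum>i<2 ^ m1. \<Sum>x<2 ^ m2. \<Sum>t<2 ^ \<delta>. \<Sum>j<2 ^ \<nu>. cnj (final_mat (enc i x t j) a) * final_mat (enc i x t j) b)"
    by (rule sum_enc)
  also have "\<dots> = (\<Sum>i<2 ^ m1. \<Sum>x<2 ^ m2. \<Sum>t<2 ^ \<delta>. \<Sum>j<2 ^ \<nu>.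
      if j = dj a \<and> x = dx a \<and> i = di a then if di a = di b \<and> dx a = dx b \<and> dj a = dj b then cnj (Fm t (dt a)) * Fm t (dt b) else 0 else 0)"
    by (intro sum.cong refl) (auto simp: final_mat_def)
  also have "\<dots> = (\<Sum>t<2 ^ \<delta>. if di a = di b \<and> dx a = dx b \<and> dj a = dj b then cnj (Fm t (dt a)) * Fm t (dt b) else 0)"
    using ab by (intro sum_fibre) (simp_all add: di_less_iff)
  also have "\<dots> = (if a = b then 1 else 0)"
  proof (cases "di a = di b \<and> dx a = dx b \<and> dj a = dj b")
    case True
    hence "a = b \<longleftrightarrow> dt a = dt b" using enc_dec[of a] enc_dec[of b] by metis
    thus ?thesis using True Fm by (simp add: is_unitary_def)
  qed auto
  finally show "(\<Sum>k<hdim. cnj (final_mat k a) * final_mat k b) = (if a = b then 1 else 0)" .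
qed

lemma length_rounds: "length (grover_steps l) = 2 * l"
  by (induction l) (auto simp: grover_steps_def)

lemma is_nm_alg_alg: "is_nm_alg {..<N} alg"
  unfolding is_nm_alg_def alg_def grover_steps_def
  using is_query_qry prep(1) oracle_unitary diffusion_unitary final_mat_unitary by auto

lemma nm_queries_alg: "nm_queries alg = 2 * L + 1"
  using length_rounds[of L] by (simp add: nm_queries_def alg_def)

lemma nm_qubits_alg: "2 ^ nm_qubits alg = hdim"
  by (simp add: nm_qubits_def alg_def)

section \<open>Evolution of the state under the Grover iterations\<close>

definition marked :: "(nat \<Rightarrow> real) \<Rightarrow> nat \<Rightarrow> nat \<Rightarrow> bool" where "marked f i j = \<chi> (\<beta> (f i)) j"

definition mfrac :: "(nat \<Rightarrow> real) \<Rightarrow> real" where "mfrac f = (\<Sum>i<N. \<Sum>j<2 ^ \<nu>. if marked f i j then 1 else 0) / (real N * 2 ^ \<nu>)"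

definition "rounds s t = card {s'. s' < s \<and> ctl s' t}"

text \<open>The invariant after \<open>s\<close> iterations: for every counter value the amplitudes
  take just two values, one on marked and one on unmarked pairs, and they depend on \<open>s\<close>
  only through the number of iterations executed on that counter value.\<close>

definition state :: "(nat \<Rightarrow> real) \<Rightarrow> nat \<Rightarrow> nat \<Rightarrow> complex" where
  "state f s a = (if dx a = 0 \<and> di a < N
     then of_real (w (dt a) * sel (marked f (di a) (dj a)) (grover_amp (mfrac f) (rounds s (dt a)))
            / sqrt (real N * 2 ^ \<nu>)) else 0)"

abbreviation marking :: "(nat \<Rightarrow> real) \<Rightarrow> nat \<Rightarrow> (nat \<Rightarrow> complex) \<Rightarrow> nat \<Rightarrow> complex" where
  "marking f s v \<equiv> mat_app hdim (query_mat qry f) (mat_app hdim (oracle_mat s) (mat_app hdim (query_mat qry f) v))"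

text \<open>On states with value register 0 the permutation composed of query, negation and query is
  the identity, so just the sign remains. On other basis states it is not the identity, which is why
  \<open>v\<close> is assumed to vanish there.\<close>

lemma oracle_app:
  assumes v: "\<And>a. a < hdim \<Longrightarrow> dx a \<noteq> 0 \<Longrightarrow> v a = 0" and a: "a < hdim"
  shows "marking f s v a
    = (if ctl s (dt a) \<and> di a < N \<and> \<not> marked f (di a) (dj a) then - v a
       else if di a < N then v a else phase s a * v a)"
proof -
  let ?q = "query_perm qry f"
  let ?p = "\<lambda>b. ?q (neg_perm (?q b))"
  have qinj: "inj_on ?q S" for S using query_perm_inj[OF is_query_qry] inj_on_subset by blast
  have ninj: "inj_on neg_perm S" for S using neg_perm_inj inj_on_subset by blast
  have qless: "?q b < hdim" if "b < hdim" for b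
    using query_perm_less[OF is_query_qry, of b f] that by simp
  have app: "marking f s v (?p b)
      = phase s (?q b) * v b" if "b < hdim" for b
    unfolding query_mat_mono oracle_mat_def
    by (subst mono_mat_app[OF qinj], use that qless neg_perm_less in blast)
       (subst mono_mat_app[OF ninj], use that qless in blast, subst mono_mat_app[OF qinj that], simp)
  have fixed: "?p b = b" if "b < hdim" "dx b = 0" for b
  proof -
    have b: "b = enc (di b) 0 (dt b) (dj b)" using enc_dec[of b] that(2) by simp
    have q: "?q b = (if di b < N then enc (di b) (\<beta> (f (di b))) (dt b) (dj b) else b)"
      by (subst b, subst query_perm_enc) (use \<beta> b in auto)
    have "((2 ^ m2 - y) mod 2 ^ m2 + y) mod 2 ^ m2 = 0" if "y < 2 ^ m2" for y :: nat
      using that by (simp add: mod_add_left_eq)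
    thus ?thesis unfolding q using that b \<beta>
      by (simp add: neg_perm_def query_perm_enc split: if_splits)
  qed
  show ?thesis
  proof (cases "dx a = 0")
    case True
    have b: "a = enc (di a) 0 (dt a) (dj a)" using enc_dec[of a] True by simp
    have q: "?q a = (if di a < N then enc (di a) (\<beta> (f (di a))) (dt a) (dj a) else a)"
      by (subst b, subst query_perm_enc) (use \<beta> b in auto)
    have "marking f s v a = phase s (?q a) * v a"
      using app[OF a] unfolding fixed[OF a True] .
    thus ?thesis unfolding q using \<beta> by (simp add: phase_def marked_def)
  next
    case False
    \<comment> \<open>The composite is a bijection that fixes all basis states with value register
      0. Hence a state with a nonzero register comes from one of the same kind, where
      \<open>v\<close> vanishes.\<close>
    have "?p ` {..<hdim} = {..<hdim}"
    proof (rule endo_inj_surj)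
      show "?p ` {..<hdim} \<subseteq> {..<hdim}" using qless neg_perm_less by auto
      show "inj_on ?p {..<hdim}"
        by (rule inj_onI) (rule injD[OF query_perm_inj[OF is_query_qry, of f]],
            rule injD[OF neg_perm_inj], rule injD[OF query_perm_inj[OF is_query_qry, of f]])
    qed simp
    then obtain b where b: "b < hdim" "a = ?p b" using a by blast
    have "dx b \<noteq> 0" using fixed[OF b(1)] b(2) False by metis
    hence "v b = 0" using v b(1) by blast
    thus ?thesis using app[OF b(1)] b(2) v[OF a False] by simp
  qed
qed

lemma sum_marked:
  "(\<Sum>i<N. \<Sum>j<2 ^ \<nu>. if marked f i j then A else B) = real N * 2 ^ \<nu> * (mfrac f * A + (1 - mfrac f) * B)"
proof -
  have NJ: "real N * 2 ^ \<nu> > 0" using N by simp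
  have "(\<Sum>i<N. \<Sum>j<2 ^ \<nu>. if marked f i j then A else B)
    = (\<Sum>i<N. \<Sum>j<2 ^ \<nu>. B + (if marked f i j then 1 else 0) * (A - B))"
    by (intro sum.cong refl) auto
  also have "\<dots> = real N * 2 ^ \<nu> * B + (\<Sum>i<N. \<Sum>j<2 ^ \<nu>. if marked f i j then 1 else 0) * (A - B)"
    by (simp add: sum.distrib sum_distrib_right)
  also have "(\<Sum>i<N. \<Sum>j<2 ^ \<nu>. if marked f i j then 1 else 0) = real N * 2 ^ \<nu> * mfrac f"
    using NJ by (simp add: mfrac_def)
  finally show ?thesis by (simp add: algebra_simps)
qed

lemma rounds_Suc: "rounds (Suc s) t = (if ctl s t then Suc (rounds s t) else rounds s t)"
proof -
  have "{s'. s' < Suc s \<and> ctl s' t} = (if ctl s t then insert s {s'. s' < s \<and> ctl s' t} else {s'. s' < s \<and> ctl s' t})"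
    by (auto simp: less_Suc_eq)
  thus ?thesis by (simp add: rounds_def)
qed

text \<open>For an active counter value the marking negates the unmarked amplitude and the diffusion
  subtracts twice the mean, which is the recursion of \<open>grover_amp\<close>. For an inactive
  value both matrices act as the identity.\<close>

lemma round_app:
  assumes a: "a < hdim"
  shows "mat_app hdim (diffusion s) (marking f s (state f s)) a = state f (Suc s) a"
proof -
  define v where "v = marking f s (state f s)"
  let ?NJ = "real N * 2 ^ \<nu>"
  have NJ: "?NJ > 0" "sqrt ?NJ * sqrt ?NJ = ?NJ" using N by auto
  define al be where "al = (\<lambda>t. fst (grover_amp (mfrac f) (rounds s t)))" and "be = (\<lambda>t. snd (grover_amp (mfrac f) (rounds s t)))"
  have v: "v a = (if dx a = 0 \<and> di a < N
     then of_real (w (dt a) * (if marked f (di a) (dj a) then al (dt a) else if ctl s (dt a) then - be (dt a) else be (dt a)) / sqrt ?NJ) else 0)"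
    if "a < hdim" for a
    unfolding v_def by (subst oracle_app[OF _ that]) (auto simp: state_def al_def be_def)
  have inner: "(\<Sum>k<hdim. of_real (unif t k) * v k) = of_real (w t * (mfrac f * al t - (1 - mfrac f) * be t))"
    if t: "t < 2 ^ \<delta>" "ctl s t" for t
  proof -
    have "(\<Sum>k<hdim. of_real (unif t k) * v k)
      = (\<Sum>k<hdim. if dx k = 0 \<and> di k < N \<and> dt k = t then of_real (w t / ?NJ * (if marked f (di k) (dj k) then al t else - be t)) else 0)"
      using t NJ by (intro sum.cong refl) (auto simp: v unif_def field_simps simp flip: of_real_mult)
    also have "\<dots> = (\<Sum>i<N. \<Sum>j<2 ^ \<nu>. of_real (w t / ?NJ * (if marked f i j then al t else - be t)))"
      using t by (subst sum_unif) (auto intro!: sum.cong)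
    also have "\<dots> = of_real (w t / ?NJ * (\<Sum>i<N. \<Sum>j<2 ^ \<nu>. if marked f i j then al t else - be t))"
      by (simp add: sum_distrib_left)
    also have "w t / ?NJ * (\<Sum>i<N. \<Sum>j<2 ^ \<nu>. if marked f i j then al t else - be t) = w t * (mfrac f * al t - (1 - mfrac f) * be t)"
    proof -
      have "w t / ?NJ * (?NJ * z) = w t * z" for z using N(1) by simp
      thus ?thesis unfolding sum_marked by simp
    qed
    finally show ?thesis .
  qed
  have "mat_app hdim (diffusion s) v a = v a - 2 * (\<Sum>t\<in>{t. t < 2 ^ \<delta> \<and> ctl s t}. of_real (unif t a) * (\<Sum>k<hdim. of_real (unif t k) * v k))"
    unfolding diffusion_def by (rule refl_mat_app[OF a])
  also have "(\<Sum>t\<in>{t. t < 2 ^ \<delta> \<and> ctl s t}. of_real (unif t a) * (\<Sum>k<hdim. of_real (unif t k) * v k))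
    = (\<Sum>t\<in>{t. t < 2 ^ \<delta> \<and> ctl s t}. if t = dt a then (if dx a = 0 \<and> di a < N then of_real (w (dt a) * (mfrac f * al (dt a) - (1 - mfrac f) * be (dt a)) / sqrt ?NJ) else 0) else 0)"
    by (intro sum.cong refl) (auto simp: inner unif_def[where a = a])
  also have "\<dots> = (if ctl s (dt a) \<and> dx a = 0 \<and> di a < N then of_real (w (dt a) * (mfrac f * al (dt a) - (1 - mfrac f) * be (dt a)) / sqrt ?NJ) else 0)"
    by (simp add: sum.delta)
  finally have D: "mat_app hdim (diffusion s) v a = v a - 2 * (if ctl s (dt a) \<and> dx a = 0 \<and> di a < N then of_real (w (dt a) * (mfrac f * al (dt a) - (1 - mfrac f) * be (dt a)) / sqrt ?NJ) else 0)" .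
  have g: "grover_amp (mfrac f) (Suc (rounds s t)) = ((1 - 2 * mfrac f) * al t + 2 * (1 - mfrac f) * be t, (1 - 2 * mfrac f) * be t - 2 * mfrac f * al t)" for t
    by (simp add: al_def be_def case_prod_unfold Let_def)
  have "mat_app hdim (diffusion s) v a = state f (Suc s) a"
  proof (cases "dx a = 0 \<and> di a < N")
    case True
    show ?thesis
    proof (cases "ctl s (dt a)")
      case c: True
      have "rounds (Suc s) (dt a) = Suc (rounds s (dt a))" using c by (simp add: rounds_Suc)
      hence "state f (Suc s) a = of_real (w (dt a) * sel (marked f (di a) (dj a))
          ((1 - 2 * mfrac f) * al (dt a) + 2 * (1 - mfrac f) * be (dt a), (1 - 2 * mfrac f) * be (dt a) - 2 * mfrac f * al (dt a)) / sqrt ?NJ)"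
        unfolding state_def g[symmetric] using True by simp
      thus ?thesis unfolding D v[OF a] using True c
        by (simp add: diff_divide_distrib[symmetric] add_divide_distrib[symmetric] algebra_simps)
    next
      case False
      thus ?thesis unfolding D v[OF a] state_def rounds_Suc using True by (simp add: al_def be_def)
    qed
  next
    case False
    thus ?thesis unfolding D v[OF a] state_def by auto
  qed
  thus ?thesis by (simp add: v_def)
qed

lemma rounds_app:
  assumes "\<And>a. a < hdim \<Longrightarrow> v a = of_real (init_amp a)" "a < hdim"
  shows "nm_run hdim (query_mat qry f) v (grover_steps l) a = state f l a"
  using assms(2)
proof (induction l arbitrary: a)
  case 0
  thus ?case using assms(1)[of a] by (simp add: init_amp_def state_def rounds_def grover_steps_def)
next
  case (Suc l)
  let ?v = "nm_run hdim (query_mat qry f) v (grover_steps l)"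
  have "mat_app hdim (query_mat qry f) ?v = mat_app hdim (query_mat qry f) (state f l)"
    by (rule mat_app_cong) (rule Suc.IH)
  thus ?case using round_app[OF Suc.prems, of l f] by (simp add: nm_run_append grover_steps_def)
qed

definition "out_amp f b t = (\<Sum>t'<2 ^ \<delta>. Fm t t' * of_real (w t' * sel b (grover_amp (mfrac f) (rounds L t'))))"

text \<open>An outcome of nonzero probability carries an argument together with its own correct
  code, so the measured pair can be trusted without further queries.\<close>

theorem alg_amplitude:
  assumes "i < 2 ^ m1" "x < 2 ^ m2" "t < 2 ^ \<delta>" "j < 2 ^ \<nu>"
  shows "nm_mat alg f (enc i x t j) 0 = (if i < N \<and> x = \<beta> (f i)
    then out_amp f (marked f i j) t / of_real (sqrt (real N * 2 ^ \<nu>)) else 0)"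
proof -
  let ?v = "nm_run hdim (query_mat qry f) (\<lambda>i. prep i 0) (grover_steps L)"
  let ?q = "query_perm qry f"
  define u where "u = mat_app hdim (query_mat qry f) (state f L)"
  have cg: "mat_app hdim (query_mat qry f) ?v = u" unfolding u_def
    by (rule mat_app_cong) (rule rounds_app, rule prep(2))
  have "nm_mat alg f (enc i x t j) 0 = mat_app hdim final_mat u (enc i x t j)"
    using fun_cong[OF nm_mat_column[of alg f 0], of "enc i x t j"]
    by (simp add: alg_def nm_run_append cg del: upt_Suc)
  also have "\<dots> = (\<Sum>i'<2 ^ m1. \<Sum>x'<2 ^ m2. \<Sum>t'<2 ^ \<delta>. \<Sum>j'<2 ^ \<nu>.
      if j' = j \<and> x' = x \<and> i' = i then Fm t t' * u (enc i x t' j) else 0)"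
    unfolding mat_app_def sum_enc
    by (intro sum.cong refl) (use assms in \<open>auto simp: final_mat_def\<close>)
  also have "\<dots> = (\<Sum>t'<2 ^ \<delta>. Fm t t' * u (enc i x t' j))"
    using assms by (intro sum_fibre)
  also have "\<dots> = (\<Sum>t'<2 ^ \<delta>. Fm t t' * (if i < N \<and> x = \<beta> (f i) then state f L (enc i 0 t' j) else 0))"
  proof (intro sum.cong refl arg_cong[where f = "\<lambda>z. Fm t _ * z"])
    fix t' assume "t' \<in> {..<(2::nat) ^ \<delta>}"
    hence t': "t' < 2 ^ \<delta>" by simp
    have qinj: "inj_on ?q {..<hdim}" using query_perm_inj[OF is_query_qry] inj_on_subset by blast
    have app: "u (?q b) = state f L b" if "b < hdim" for b
      unfolding u_def query_mat_mono by (subst mono_mat_app[OF qinj that]) simp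
    show "u (enc i x t' j) = (if i < N \<and> x = \<beta> (f i) then state f L (enc i 0 t' j) else 0)"
    proof (cases "i < N \<and> x = \<beta> (f i)")
      case True
      hence "?q (enc i 0 t' j) = enc i x t' j" using t' assms by (subst query_perm_enc) auto
      thus ?thesis using app[of "enc i 0 t' j"] True assms t' by simp
    next
      case False
      have "?q ` {..<hdim} = {..<hdim}"
        by (rule endo_inj_surj[OF _ _ qinj]) (use query_perm_less[OF is_query_qry] in auto)
      moreover have "enc i x t' j \<in> {..<hdim}" using assms t' by simp
      ultimately obtain b where b: "b < hdim" "enc i x t' j = ?q b" by blast
      have "state f L b = 0"
      proof (rule ccontr)
        assume "state f L b \<noteq> 0"
        hence c: "dx b = 0" "di b < N" by (auto simp: state_def split: if_splits)
        have "enc (di b) 0 (dt b) (dj b) = b" using enc_dec[of b] c(1) by simp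
        hence "?q b = enc (di b) (\<beta> (f (di b))) (dt b) (dj b)"
          using query_perm_enc[of 0 "dt b" "dj b" f "di b"] c \<beta> by simp
        hence "di (enc i x t' j) = di b" "dx (enc i x t' j) = \<beta> (f (di b))"
          unfolding b(2) using \<beta> by simp_all
        thus False using False assms t' c(2) by simp
      qed
      thus ?thesis using False app[OF b(1)] b(2) by auto
    qed
  qed
  also have "\<dots> = (if i < N \<and> x = \<beta> (f i)
    then out_amp f (marked f i j) t / of_real (sqrt (real N * 2 ^ \<nu>)) else 0)"
    using assms by (auto simp: state_def out_amp_def sum_divide_distrib intro!: sum.cong)
  finally show ?thesis .
qed

text \<open>The measured counter depends on \<open>f\<close> only through the marked fraction, so
  reading it can serve to estimate this fraction.\<close>

lemma counter_distribution:
  "(\<Sum>a<hdim. if B (dt a) then nm_prob alg f a else 0)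
   = (\<Sum>t<2 ^ \<delta>. if B t then mfrac f * (cmod (out_amp f True t))\<^sup>2 + (1 - mfrac f) * (cmod (out_amp f False t))\<^sup>2 else 0)"
proof -
  let ?NJ = "real N * 2 ^ \<nu>"
  have NJ: "?NJ > 0" using N by simp
  define G where "G = (\<lambda>i t j. if B t then (if marked f i j then (cmod (out_amp f True t))\<^sup>2 else (cmod (out_amp f False t))\<^sup>2) / ?NJ else 0)"
  let ?S = "\<lambda>i x t j. if B (dt (enc i x t j)) then nm_prob alg f (enc i x t j) else 0" and ?G = "\<lambda>i. if i < N then \<Sum>t<2 ^ \<delta>. \<Sum>j<2 ^ \<nu>. G i t j else 0"
  have "(\<Sum>a<hdim. if B (dt a) then nm_prob alg f a else 0)
    = (\<Sum>i<2 ^ m1. ?G i)"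
    unfolding sum_enc
  proof (intro sum.cong refl)
    fix i assume i: "i \<in> {..<(2::nat) ^ m1}"
    have "(\<Sum>x<2 ^ m2. \<Sum>t<2 ^ \<delta>. \<Sum>j<2 ^ \<nu>. ?S i x t j)
      = (\<Sum>x<2 ^ m2. if x = \<beta> (f i) then (?G i) else 0)"
    proof (rule sum.cong[OF refl])
      fix x assume x: "x \<in> {..<(2::nat) ^ m2}"
      have "(?S i x t j)
        = (if x = \<beta> (f i) \<and> i < N then G i t j else 0)" if "t < 2 ^ \<delta>" "j < 2 ^ \<nu>" for t j
        using i x that NJ by (simp add: alg_amplitude G_def norm_divide power_divide)
      thus "(\<Sum>t<2 ^ \<delta>. \<Sum>j<2 ^ \<nu>. ?S i x t j)
        = (if x = \<beta> (f i) then (?G i) else 0)"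
        by simp
    qed
    thus "(\<Sum>x<2 ^ m2. \<Sum>t<2 ^ \<delta>. \<Sum>j<2 ^ \<nu>. ?S i x t j)
      = (?G i)"
      using \<beta>[of "f i"] by simp
  qed
  also have "\<dots> = (\<Sum>i<N. \<Sum>t<2 ^ \<delta>. \<Sum>j<2 ^ \<nu>. G i t j)"
    using N(2) by (simp add: sum.If_cases Int_absorb1 lessThan_def Int_absorb2 subset_iff less_le_trans)
  also have "\<dots> = (\<Sum>t<2 ^ \<delta>. \<Sum>i<N. \<Sum>j<2 ^ \<nu>. G i t j)" by (rule sum.swap)
  also have "\<dots> = (\<Sum>t<2 ^ \<delta>. if B t then mfrac f * (cmod (out_amp f True t))\<^sup>2 + (1 - mfrac f) * (cmod (out_amp f False t))\<^sup>2 else 0)"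
  proof (intro sum.cong refl)
    fix t
    have "(\<Sum>i<N. \<Sum>j<2 ^ \<nu>. G i t j) = (if B t then (\<Sum>i<N. \<Sum>j<2 ^ \<nu>. if marked f i j then (cmod (out_amp f True t))\<^sup>2 else (cmod (out_amp f False t))\<^sup>2) / ?NJ else 0)"
      by (simp add: G_def sum_divide_distrib)
    thus "(\<Sum>i<N. \<Sum>j<2 ^ \<nu>. G i t j) = (if B t then mfrac f * (cmod (out_amp f True t))\<^sup>2 + (1 - mfrac f) * (cmod (out_amp f False t))\<^sup>2 else 0)"
      unfolding sum_marked using N(1) by simp
  qed
  finally show ?thesis .
qed

end

section \<open>Search and amplitude estimation\<close>

text \<open>Iteration rotates by the angle \<open>2 * \<theta>\<close>. The unnormalised amplitudes
  are multiplied by \<open>sin \<theta>\<close> and \<open>cos \<theta>\<close>, instead of dividing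
  on the other side, so that vanishing sines and cosines fit in.\<close>

lemma grover_amp_sin:
  "sin \<theta> * fst (grover_amp ((sin \<theta>)\<^sup>2) n) = sin ((2 * real n + 1) * \<theta>)
   \<and> cos \<theta> * snd (grover_amp ((sin \<theta>)\<^sup>2) n) = cos ((2 * real n + 1) * \<theta>)"
proof (induction n)
  case (Suc n)
  let ?a = "(sin \<theta>)\<^sup>2" and ?z = "(2 * real n + 1) * \<theta>"
  let ?x = "fst (grover_amp ?a n)" and ?y = "snd (grover_amp ?a n)"
  have z: "(2 * real (Suc n) + 1) * \<theta> = ?z + 2 * \<theta>" by (simp add: algebra_simps)
  have c2: "1 - 2 * ?a = cos (2 * \<theta>)" by (simp add: cos_double_sin)
  have c1: "1 - ?a = (cos \<theta>)\<^sup>2" by (simp add: cos_squared_eq)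
  have s: "grover_amp ?a (Suc n) = (cos (2 * \<theta>) * ?x + 2 * (cos \<theta>)\<^sup>2 * ?y, cos (2 * \<theta>) * ?y - 2 * ?a * ?x)"
    by (simp add: case_prod_unfold Let_def c2 c1)
  have "sin \<theta> * fst (grover_amp ?a (Suc n)) = cos (2 * \<theta>) * (sin \<theta> * ?x) + 2 * sin \<theta> * cos \<theta> * (cos \<theta> * ?y)"
    unfolding s by (simp add: algebra_simps power2_eq_square)
  also have "\<dots> = sin (?z + 2 * \<theta>)" using Suc.IH by (simp add: sin_add sin_double)
  finally have 1: "sin \<theta> * fst (grover_amp ?a (Suc n)) = sin (?z + 2 * \<theta>)" .
  have "cos \<theta> * snd (grover_amp ?a (Suc n)) = cos (2 * \<theta>) * (cos \<theta> * ?y) - 2 * sin \<theta> * cos \<theta> * (sin \<theta> * ?x)"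
    unfolding s by (simp add: algebra_simps power2_eq_square)
  also have "\<dots> = cos (?z + 2 * \<theta>)" using Suc.IH by (simp add: cos_add sin_double)
  finally show ?case unfolding z using 1 by simp
qed simp

lemma sin_ge_half:
  assumes "0 \<le> x" "x \<le> (1::real)"
  shows "x / 2 \<le> sin x"
proof -
  have "(\<lambda>x. sin x - x / 2) 0 \<le> (\<lambda>x. sin x - x / 2) x"
  proof (rule DERIV_nonneg_imp_nondecreasing[OF assms(1)])
    fix y assume y: "0 \<le> y" "y \<le> x"
    have "\<bar>sin (y / 2)\<bar> \<le> 1 / 2" using abs_sin_x_le_abs_x[of "y / 2"] y assms(2) by simp
    hence "(sin (y / 2))\<^sup>2 \<le> (1 / 2)\<^sup>2" by (simp only: abs_le_square_iff[symmetric])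
    hence "0 \<le> cos y - 1 / 2" using cos_double_sin[of "y / 2"] by (simp add: power_divide)
    moreover have "((\<lambda>x. sin x - x / 2) has_real_derivative cos y - 1 / 2) (at y)"
      by (auto intro!: derivative_eq_intros)
    ultimately show "\<exists>d. ((\<lambda>x. sin x - x / 2) has_real_derivative d) (at y) \<and> 0 \<le> d" by blast
  qed
  thus ?thesis by simp
qed

text \<open>As long as the angle \<open>(2 * n + 1) * \<theta>\<close> is at most 1, its sine is at
  least half the angle, so amplification is linear in the number of iterations. Only an upper bound
  on \<open>a\<close> is assumed: the number of marked positions need not be known.\<close>

lemma grover_amp_large:
  assumes "0 < a" "(2 * real n + 1)\<^sup>2 * a \<le> 1 / 4"
  shows "fst (grover_amp a n) \<ge> (2 * real n + 1) / 2"
proof -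
  let ?m = "2 * real n + 1"
  define \<theta> where "\<theta> = arcsin (sqrt a)"
  have m: "?m \<ge> 1" by simp
  have "?m * sqrt a = sqrt (?m\<^sup>2 * a)" by (simp add: real_sqrt_mult)
  also have "\<dots> \<le> sqrt (1/4)" by (rule real_sqrt_le_mono[OF assms(2)])
  finally have ms: "?m * sqrt a \<le> 1/2" by (simp add: real_sqrt_divide)
  have "1 * sqrt a \<le> ?m * sqrt a" using m assms(1) by (intro mult_right_mono) auto
  hence s: "sqrt a \<le> 1/2" "0 < sqrt a" using ms assms(1) by (linarith, simp)
  have sin: "sin \<theta> = sqrt a" unfolding \<theta>_def by (rule sin_arcsin) (use s in linarith)+
  have "\<theta> \<le> arcsin (1/2)" unfolding \<theta>_def by (rule arcsin_le_arcsin) (use s in linarith)+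
  also have "arcsin (1/2) = pi / 6" by (rule arcsin_unique) (auto simp: sin_30)
  finally have \<theta>1: "\<theta> \<le> 1" using pi_less_4 by simp
  have "arcsin 0 < \<theta>" unfolding \<theta>_def by (rule arcsin_less_arcsin) (use s in linarith)+
  hence \<theta>0: "0 < \<theta>" by simp
  have \<theta>2: "\<theta> \<le> 2 * sqrt a" using sin_ge_half[of \<theta>] \<theta>0 \<theta>1 sin by simp
  have "?m * \<theta> \<le> ?m * (2 * sqrt a)" using \<theta>2 m by (intro mult_left_mono) auto
  also have "\<dots> = 2 * (?m * sqrt a)" by simp
  also have "\<dots> \<le> 1" using ms by linarith
  finally have m1: "?m * \<theta> \<le> 1" .
  have "?m * \<theta> / 2 \<le> sin (?m * \<theta>)" by (rule sin_ge_half) (use m1 \<theta>0 in auto)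
  also have "\<dots> = sin \<theta> * fst (grover_amp ((sin \<theta>)\<^sup>2) n)" using grover_amp_sin by metis
  also have "(sin \<theta>)\<^sup>2 = a" using sin assms(1) by simp
  finally have 1: "?m * \<theta> / 2 \<le> sin \<theta> * fst (grover_amp a n)" .
  have "sin \<theta> * (?m / 2) \<le> \<theta> * (?m / 2)" using \<theta>0 by (intro mult_right_mono sin_x_le_x) auto
  also have "\<dots> \<le> sin \<theta> * fst (grover_amp a n)" using 1 by (simp add: mult.commute)
  finally show ?thesis using s sin by (simp only: mult_le_cancel_left_pos)
qed

text \<open>Positions with a nonzero code are marked. The probability bound concerns each marked
  position separately, as collecting all of them requires.\<close>

lemma find_stage_ex:
  fixes \<beta> :: "real \<Rightarrow> nat"
  assumes N: "N \<ge> 1" and m2: "m2 \<ge> 1" and \<beta>: "\<And>y. \<beta> y < 2 ^ m2"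
  obtains A :: "(nat, real) nm_alg" where "is_nm_alg {..<N} A" "nm_queries A = 2 * T + 1"
    "\<And>f a. a < 2 ^ nm_qubits A \<Longrightarrow> nm_mat A f a 0 \<noteq> 0 \<Longrightarrow> a div 2 ^ m2 < N \<and> a mod 2 ^ m2 = \<beta> (f (a div 2 ^ m2))"
    "\<And>i f. i < N \<Longrightarrow> i * 2 ^ m2 + \<beta> (f i) < 2 ^ nm_qubits A"
    "\<And>i f. i < N \<Longrightarrow> \<beta> (f i) \<noteq> 0 \<Longrightarrow> (2 * real T + 1)\<^sup>2 * real (card {i. i < N \<and> \<beta> (f i) \<noteq> 0}) \<le> real N / 4 \<Longrightarrow>
      nm_prob A f (i * 2 ^ m2 + \<beta> (f i)) \<ge> (2 * real T + 1)\<^sup>2 / (4 * real N)"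
proof -
  \<comment> \<open>There is no counter and no auxiliary index here, and every iteration is
    executed. Taking \<open>N\<close> qubits for the argument is generous, but qubits are not
    counted.\<close>
  interpret amplification N N m2 0 0 T \<beta> "\<lambda>x _. 0 < x" "\<lambda>_ _. True" "\<lambda>_. 1" "\<lambda>_ _. 1"
    by standard (use N m2 \<beta> in \<open>auto simp: is_unitary_def less_exp intro: less_imp_le\<close>)
  have enc: "enc i x 0 0 = i * 2 ^ m2 + x" for i x by (simp add: enc_def)
  have marked: "marked f i j \<longleftrightarrow> \<beta> (f i) \<noteq> 0" for f i j by (simp add: marked_def)
  have mfrac: "mfrac f = real (card {i. i < N \<and> \<beta> (f i) \<noteq> 0}) / real N" for f
  proof -
    have "(\<Sum>i<N. if \<beta> (f i) \<noteq> 0 then 1 else 0 :: real) = real (card {i. i < N \<and> \<beta> (f i) \<noteq> 0})"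
      by (simp add: sum.If_cases lessThan_def Int_def)
    thus ?thesis by (simp add: mfrac_def marked)
  qed
  have rounds: "rounds T 0 = T" by (simp add: rounds_def)
  show ?thesis
  proof (rule that[of alg])
    show "is_nm_alg {..<N} alg" by (rule is_nm_alg_alg)
    show "nm_queries alg = 2 * T + 1" by (rule nm_queries_alg)
    show "a div 2 ^ m2 < N \<and> a mod 2 ^ m2 = \<beta> (f (a div 2 ^ m2))"
      if "a < 2 ^ nm_qubits alg" "nm_mat alg f a 0 \<noteq> 0" for f a
    proof -
      have a: "a < hdim" using that(1) by (simp add: nm_qubits_alg)
      have z: "dt a = 0" "dj a = 0" using dec_less(2,3)[of a] by simp_all
      have "nm_mat alg f (enc (di a) (dx a) 0 0) 0 \<noteq> 0" using that(2) enc_dec[of a] z by simp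
      hence "di a < N \<and> dx a = \<beta> (f (di a))"
        using alg_amplitude[of "di a" "dx a" 0 0 f] a by (auto simp: di_less_iff split: if_splits)
      thus ?thesis by (simp add: di_def dx_def)
    qed
    show "i * 2 ^ m2 + \<beta> (f i) < 2 ^ nm_qubits alg" if "i < N" for i and f :: "nat \<Rightarrow> real"
      using that N \<beta> enc_less_iff[of "\<beta> (f i)" 0 0 i] less_trans[OF that less_exp[of N]] by (simp add: enc nm_qubits_alg)
    show "(2 * real T + 1)\<^sup>2 / (4 * real N) \<le> nm_prob alg f (i * 2 ^ m2 + \<beta> (f i))"
      if i: "i < N" "\<beta> (f i) \<noteq> 0" and c: "(2 * real T + 1)\<^sup>2 * real (card {i. i < N \<and> \<beta> (f i) \<noteq> 0}) \<le> real N / 4" for i f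
    proof -
      have "card {i. i < N \<and> \<beta> (f i) \<noteq> 0} > 0" using i by (auto simp: card_gt_0_iff)
      hence "mfrac f > 0" using N by (simp add: mfrac)
      moreover have "(2 * real T + 1)\<^sup>2 * mfrac f \<le> 1/4"
        using c N by (simp add: mfrac field_simps)
      ultimately have large: "fst (grover_amp (mfrac f) T) \<ge> (2 * real T + 1) / 2" by (rule grover_amp_large)
      have "nm_mat alg f (i * 2 ^ m2 + \<beta> (f i)) 0 = of_real (fst (grover_amp (mfrac f) T) / sqrt (real N))"
        using alg_amplitude[of i "\<beta> (f i)" 0 0 f] i \<beta> less_trans[OF i(1) less_exp[of N]]
        by (simp add: enc out_amp_def marked rounds)
      hence "nm_prob alg f (i * 2 ^ m2 + \<beta> (f i)) = (fst (grover_amp (mfrac f) T))\<^sup>2 / real N"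
        by (simp add: norm_divide power_divide)
      moreover have "((2 * real T + 1) / 2)\<^sup>2 \<le> (fst (grover_amp (mfrac f) T))\<^sup>2"
        using large by (intro power_mono) auto
      ultimately show ?thesis using N by (simp add: power_divide divide_right_mono field_simps)
    qed
  qed
qed

section \<open>Phase estimation with a sine window\<close>

definition dft :: "nat \<Rightarrow> nat \<Rightarrow> nat \<Rightarrow> complex" where
  "dft d = (\<lambda>s t. cis (- (2 * pi * real s * real t / real d)) / of_real (sqrt (real d)))"

lemma dft_unitary:
  assumes d: "d > 0"
  shows "is_unitary d (dft d)"
  unfolding is_unitary_def
proof (intro allI impI)
  fix i j assume ij: "i < d" "j < d"
  define z where "z = cis (2 * pi * real i / real d) / cis (2 * pi * real j / real d)"
  have zp: "cnj (dft d k i) * dft d k j = z ^ k / of_nat d" for k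
  proof -
    have "z = cis (2 * pi * real i / real d - 2 * pi * real j / real d)" by (simp add: z_def cis_divide)
    hence "z ^ k = cis (real k * (2 * pi * real i / real d - 2 * pi * real j / real d))" by (simp add: Complex.DeMoivre)
    moreover have "cnj (dft d k i) * dft d k j = cis (2 * pi * real k * real i / real d + - (2 * pi * real k * real j / real d)) / of_nat d"
      by (simp add: dft_def cis_cnj cis_mult flip: of_real_mult)
    moreover have "2 * pi * real k * real i / real d + - (2 * pi * real k * real j / real d) = real k * (2 * pi * real i / real d - 2 * pi * real j / real d)"
      by (simp add: algebra_simps)
    ultimately show ?thesis by simp
  qed
  have "z ^ d = 1" using d by (simp add: z_def power_divide Complex.DeMoivre)
  show "(\<Sum>k<d. cnj (dft d k i) * dft d k j) = (if i = j then 1 else 0)"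
  proof (cases "i = j")
    case True
    thus ?thesis unfolding zp using d by (simp add: z_def)
  next
    case False
    have "cis (2 * pi * real i / real d) \<noteq> cis (2 * pi * real j / real d)"
      using bij_betw_roots_unity[OF d] False ij by (auto simp: bij_betw_def inj_on_def)
    hence "z \<noteq> 1" by (simp add: z_def)
    hence "(\<Sum>k<d. z ^ k) = 0" using \<open>z ^ d = 1\<close> by (simp add: geometric_sum)
    thus ?thesis unfolding zp using False by (simp flip: sum_divide_distrib)
  qed
qed

text \<open>Initial amplitudes of the counter. The window vanishes at 0 and at \<open>d\<close> and
  varies slowly, which yields a second moment bound for the estimated phase.\<close>

definition sine_window :: "nat \<Rightarrow> nat \<Rightarrow> real" where
  "sine_window d t = sqrt (2 / real d) * sin (pi * real t / real d)"

text \<open>By the double angle formula the sum reduces to a full period of cosines, which vanishes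
  because the columns 0 and 1 of \<open>dft\<close> are orthogonal.\<close>

lemma sine_window_norm:
  assumes d: "d \<ge> 2"
  shows "(\<Sum>t<d. (sine_window d t)\<^sup>2) = 1"
proof -
  have "(\<Sum>k<d. cnj (dft d k 0) * dft d k 1) = 0"
    using dft_unitary[of d] d by (auto simp: is_unitary_def)
  hence "(\<Sum>k<d. cis (- (2 * pi * real k / real d)) / of_nat d) = 0"
    by (simp add: dft_def flip: of_real_mult)
  hence "(\<Sum>k<d. cis (- (2 * pi * real k / real d))) = 0" using d by (simp flip: sum_divide_distrib)
  hence "Re (\<Sum>k<d. cis (- (2 * pi * real k / real d))) = 0" by simp
  hence c: "(\<Sum>k<d. cos (2 * pi * real k / real d)) = 0" by simp
  have "(sine_window d t)\<^sup>2 = 1 / real d * (1 - cos (2 * pi * real t / real d))" for t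
  proof -
    have "cos (2 * pi * real t / real d) = 1 - 2 * (sin (pi * real t / real d))\<^sup>2"
      using cos_double_sin[of "pi * real t / real d"] by (simp add: mult.assoc)
    thus ?thesis using d by (simp add: sine_window_def power_mult_distrib)
  qed
  hence "(\<Sum>t<d. (sine_window d t)\<^sup>2) = 1 / real d * (real d - (\<Sum>k<d. cos (2 * pi * real k / real d)))"
    by (simp add: sum_subtractf flip: sum_divide_distrib)
  thus ?thesis using c d by simp
qed

lemma sine_window_step: "(sine_window d (Suc t) - sine_window d t)\<^sup>2 \<le> 2 / real d * (pi / real d)\<^sup>2"
proof -
  have "\<bar>sin (pi * real (Suc t) / real d) - sin (pi * real t / real d)\<bar> \<le> \<bar>pi * real (Suc t) / real d - pi * real t / real d\<bar>"
  proof -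
    have "\<bar>sin x - sin y\<bar> \<le> \<bar>x - y\<bar>" for x y :: real
    proof -
      have "\<bar>sin x - sin y\<bar> = 2 * \<bar>sin ((x - y) / 2)\<bar> * \<bar>cos ((x + y) / 2)\<bar>"
        by (simp add: sin_diff_sin abs_mult)
      also have "\<dots> \<le> 2 * \<bar>sin ((x - y) / 2)\<bar> * 1" by (intro mult_left_mono) auto
      also have "\<dots> \<le> 2 * \<bar>(x - y) / 2\<bar>" using abs_sin_x_le_abs_x[of "(x - y) / 2"] by simp
      finally show ?thesis by simp
    qed
    thus ?thesis .
  qed
  also have "pi * real (Suc t) / real d - pi * real t / real d = pi / real d"
    by (simp add: algebra_simps add_divide_distrib)
  finally have "(sin (pi * real (Suc t) / real d) - sin (pi * real t / real d))\<^sup>2 \<le> (pi / real d)\<^sup>2"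
    by (metis abs_le_square_iff)
  hence "2 / real d * (sin (pi * real (Suc t) / real d) - sin (pi * real t / real d))\<^sup>2 \<le> 2 / real d * (pi / real d)\<^sup>2"
    by (intro mult_left_mono) auto
  moreover have "(sine_window d (Suc t) - sine_window d t)\<^sup>2 = 2 / real d * (sin (pi * real (Suc t) / real d) - sin (pi * real t / real d))\<^sup>2"
    by (simp add: sine_window_def power_mult_distrib flip: right_diff_distrib)
  ultimately show ?thesis by simp
qed

text \<open>The amplitude of the counter outcome \<open>y\<close> when each unit of the counter has
  picked up the phase \<open>cis \<phi>\<close>.\<close>

definition window_dft :: "nat \<Rightarrow> real \<Rightarrow> nat \<Rightarrow> complex" where
  "window_dft d \<phi> y = (\<Sum>t<d. dft d y t * (of_real (sine_window d t) * cis (real t * \<phi>)))"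

text \<open>Summation by parts turns the weight \<open>cis \<phi> - cis (2\<pi>y/d)\<close> into the discrete derivative of
  the window, whose norm is preserved by the Fourier transform.\<close>

lemma window_dft_concentrated:
  assumes d: "d > 0"
  shows "(\<Sum>y<d. (cmod (cis \<phi> - cis (2 * pi * real y / real d)))\<^sup>2 * (cmod (window_dft d \<phi> y))\<^sup>2) \<le> 2 * pi\<^sup>2 / (real d)\<^sup>2"
proof -
  define g where "g = (\<lambda>t. of_real (sine_window d (Suc t) - sine_window d t) * cis (real t * \<phi>))"
  have key: "(1 - cis \<phi> * cis (- (2 * pi * real y / real d))) * window_dft d \<phi> y
    = cis \<phi> * cis (- (2 * pi * real y / real d)) * mat_app d (dft d) g y" for y
  proof -
    define z where "z = cis \<phi> * cis (- (2 * pi * real y / real d))"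
    have zk: "dft d y t * cis (real t * \<phi>) = z ^ t / of_real (sqrt (real d))" for t
    proof -
      have "z ^ t = cis (real t * (\<phi> + - (2 * pi * real y / real d)))" by (simp add: z_def cis_mult Complex.DeMoivre)
      moreover have "real t * (\<phi> + - (2 * pi * real y / real d)) = - (2 * pi * real y * real t / real d) + real t * \<phi>"
        by (simp add: algebra_simps)
      ultimately show ?thesis by (simp add: dft_def cis_mult)
    qed
    let ?w = "\<lambda>t. complex_of_real (sine_window d t)"
    have W: "window_dft d \<phi> y = (\<Sum>t<d. ?w t * z ^ t) / of_real (sqrt (real d))"
      unfolding window_dft_def sum_divide_distrib
      by (intro sum.cong refl) (use zk in \<open>simp add: mult.left_commute[of _ "?w _"]\<close>)
    have G: "mat_app d (dft d) g y = (\<Sum>t<d. (?w (Suc t) - ?w t) * z ^ t) / of_real (sqrt (real d))"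
      unfolding mat_app_def g_def sum_divide_distrib
      by (intro sum.cong refl) (use zk in \<open>simp add: mult.left_commute[of _ "_ - _"]\<close>)
    have "(1 - z) * (\<Sum>t<n. ?w t * z ^ t) = z * (\<Sum>t<n. (?w (Suc t) - ?w t) * z ^ t) + ?w 0 - ?w n * z ^ n" for n
    proof (induction n)
      case (Suc n)
      show ?case unfolding sum.lessThan_Suc distrib_left Suc.IH by (simp add: algebra_simps)
    qed simp
    \<comment> \<open>The zeros of the window at both ends remove the boundary terms of the
      summation by parts.\<close>
    moreover have "?w 0 = 0" "?w d = 0" using d by (simp_all add: sine_window_def)
    ultimately have "(1 - z) * (\<Sum>t<d. ?w t * z ^ t) = z * (\<Sum>t<d. (?w (Suc t) - ?w t) * z ^ t)" by simp
    thus ?thesis unfolding W G z_def[symmetric] by simp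
  qed
  have "(cmod (cis \<phi> - cis (2 * pi * real y / real d)))\<^sup>2 * (cmod (window_dft d \<phi> y))\<^sup>2 = (cmod (mat_app d (dft d) g y))\<^sup>2" for y
  proof -
    let ?\<alpha> = "2 * pi * real y / real d"
    have "cmod (cis \<phi> - cis ?\<alpha>) = cmod (cis \<phi> - cis ?\<alpha>) * cmod (cis (- ?\<alpha>))" by simp
    also have "\<dots> = cmod (cis \<phi> * cis (- ?\<alpha>) - 1)"
      by (simp only: norm_mult[symmetric] left_diff_distrib cis_mult[of ?\<alpha>]) simp
    also have "\<dots> = cmod (1 - cis \<phi> * cis (- ?\<alpha>))" by (rule norm_minus_commute)
    finally have "cmod (cis \<phi> - cis ?\<alpha>) * cmod (window_dft d \<phi> y) = cmod (mat_app d (dft d) g y)"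
      using arg_cong[OF key[of y], of cmod] by (simp add: norm_mult)
    thus ?thesis by (simp flip: power_mult_distrib)
  qed
  hence "(\<Sum>y<d. (cmod (cis \<phi> - cis (2 * pi * real y / real d)))\<^sup>2 * (cmod (window_dft d \<phi> y))\<^sup>2) = normsq d (mat_app d (dft d) g)"
    by (simp add: normsq_def)
  also have "\<dots> = normsq d g" by (rule unitary_normsq[OF dft_unitary[OF d]])
  also have "\<dots> = (\<Sum>t<d. (sine_window d (Suc t) - sine_window d t)\<^sup>2)"
    unfolding normsq_def g_def by (simp add: norm_mult del: of_real_diff)
  also have "\<dots> \<le> (\<Sum>t<d. 2 / real d * (pi / real d)\<^sup>2)" by (intro sum_mono sine_window_step)
  also have "\<dots> = 2 * pi\<^sup>2 / (real d)\<^sup>2" using d by (simp add: power_divide)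
  finally show ?thesis .
qed

text \<open>The chord from 1 to \<open>cis (2 * \<theta>)\<close> has length
  \<open>2 * \<bar>sin \<theta>\<bar>\<close>, so half a chord is a Lipschitz estimator of
  \<open>\<bar>sin \<theta>\<bar>\<close>. It does not see the sign of \<theta>, and the two
  eigenphases of the Grover iteration lead to the same estimate.\<close>

lemma phase_estimate:
  "\<bar>\<bar>sin \<theta>\<bar> - cmod (1 - cis \<alpha>) / 2\<bar> \<le> cmod (cis (2 * \<theta>) - cis \<alpha>) / 2"
proof -
  have "(cmod (1 - cis (2 * \<theta>)))\<^sup>2 = (1 - cos (2 * \<theta>))\<^sup>2 + (sin (2 * \<theta>))\<^sup>2"
    by (simp add: cmod_power2)
  also have "\<dots> = 2 * (1 - cos (2 * \<theta>))"
    using sin_cos_squared_add[of "2 * \<theta>"] by (simp add: power2_eq_square algebra_simps)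
  also have "\<dots> = (2 * \<bar>sin \<theta>\<bar>)\<^sup>2" by (simp add: cos_double_sin power_mult_distrib)
  finally have "cmod (1 - cis (2 * \<theta>)) = 2 * \<bar>sin \<theta>\<bar>" by (rule power2_eq_imp_eq) auto
  moreover have "\<bar>cmod (1 - cis (2 * \<theta>)) - cmod (1 - cis \<alpha>)\<bar> \<le> cmod ((1 - cis (2 * \<theta>)) - (1 - cis \<alpha>))"
    by (rule norm_triangle_ineq3)
  moreover have "cmod ((1 - cis (2 * \<theta>)) - (1 - cis \<alpha>)) = cmod (cis (2 * \<theta>) - cis \<alpha>)"
    by (simp add: norm_minus_commute)
  ultimately show ?thesis by linarith
qed

text \<open>The pair \<open>(i, j)\<close> is marked if \<open>j < \<beta> (f i)\<close>, so the
  marked fraction is the mean of \<open>\<beta> (f i) / 2 ^ m2\<close>. The guarantee concerns its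
  square root, that is \<open>sin \<theta>\<close>; this makes the estimate of a small mean much
  more accurate than that of a large one.\<close>

lemma est_stage_ex:
  fixes \<beta> :: "real \<Rightarrow> nat"
  assumes N: "N \<ge> 1" and m2: "m2 \<ge> 1" and \<beta>: "\<And>y. \<beta> y < 2 ^ m2" and \<delta>: "\<delta> \<ge> 1"
  obtains A :: "(nat, real) nm_alg" and est :: "nat \<Rightarrow> real" where "is_nm_alg {..<N} A" "nm_queries A = 2 * 2 ^ \<delta> - 1"
    "\<And>a. est a \<ge> 0"
    "\<And>f \<epsilon>. \<epsilon> > 0 \<Longrightarrow> (\<Sum>a<2 ^ nm_qubits A. if \<bar>sqrt ((\<Sum>i<N. real (\<beta> (f i))) / (real N * 2 ^ m2)) - est a\<bar> > \<epsilon> / 2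
        then nm_prob A f a else 0) \<le> 2 * pi\<^sup>2 / (2 ^ \<delta> * \<epsilon>)\<^sup>2"
proof -
  let ?D = "(2::nat) ^ \<delta>"
  have D: "?D \<ge> 2" using \<delta> power_increasing[of 1 \<delta> "2::nat"] by simp
  \<comment> \<open>Iteration \<open>s\<close> is executed on the counter values above
    \<open>s\<close>, so the value \<open>t\<close> receives exactly \<open>t\<close> iterations.
    The largest value is \<open>?D - 1\<close>, which is thus the total number.\<close>
  interpret amplification N N m2 \<delta> m2 "?D - Suc 0" \<beta> "\<lambda>x j. j < x" "\<lambda>s t. s < t" "sine_window ?D" "dft ?D"
    by standard (use N m2 \<beta> D in \<open>auto simp: less_exp sine_window_norm dft_unitary intro: less_imp_le\<close>)
  have mfrac: "mfrac f = (\<Sum>i<N. real (\<beta> (f i))) / (real N * 2 ^ m2)" for f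
  proof -
    have "(\<Sum>j<(2::nat) ^ m2. if marked f i j then 1 else 0 :: real) = real (\<beta> (f i))" for i
    proof -
      have "{..<(2::nat) ^ m2} \<inter> {j. j < \<beta> (f i)} = {..<\<beta> (f i)}" using \<beta>[of "f i"] by auto
      thus ?thesis by (simp add: marked_def sum.If_cases)
    qed
    thus ?thesis by (simp add: mfrac_def)
  qed
  have rounds: "rounds (?D - Suc 0) t = t" if "t < ?D" for t
  proof -
    have "{s'. s' < ?D - Suc 0 \<and> s' < t} = {..<t}" using that by auto
    thus ?thesis by (simp add: rounds_def)
  qed
  define est where "est = (\<lambda>a. cmod (1 - cis (2 * pi * real (dt a) / real ?D)) / 2)"
  show ?thesis
  proof (rule that[of alg est])
    show "is_nm_alg {..<N} alg" by (rule is_nm_alg_alg)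
    show "nm_queries alg = 2 * 2 ^ \<delta> - 1" using nm_queries_alg D by simp
    show "est a \<ge> 0" for a by (simp add: est_def)
    fix f :: "nat \<Rightarrow> real" and \<epsilon> :: real assume \<epsilon>: "\<epsilon> > 0"
    let ?a = "mfrac f"
    have a0: "0 \<le> ?a" by (simp add: mfrac sum_nonneg)
    have "(\<Sum>i<N. real (\<beta> (f i))) \<le> (\<Sum>i<N. 2 ^ m2)"
      using \<beta> by (intro sum_mono) (metis less_imp_le of_nat_le_iff of_nat_numeral of_nat_power)
    hence a1: "?a \<le> 1" using N by (simp add: mfrac field_simps)
    define \<theta> where "\<theta> = arcsin (sqrt ?a)"
    have s: "sin \<theta> = sqrt ?a" unfolding \<theta>_def using a0 a1 by (intro sin_arcsin) (auto intro: order_trans[of _ 0])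
    hence s2: "(sin \<theta>)\<^sup>2 = ?a" using a0 by simp
    hence c2: "(cos \<theta>)\<^sup>2 = 1 - ?a" by (simp add: cos_squared_eq)
    define bad where "bad = (\<lambda>y. \<bar>sqrt ?a - cmod (1 - cis (2 * pi * real y / real ?D)) / 2\<bar> > \<epsilon> / 2)"
    define p q where "p = (\<lambda>y. (cmod (window_dft ?D (2 * \<theta>) y))\<^sup>2)" and "q = (\<lambda>y. (cmod (window_dft ?D (2 * (- \<theta>)) y))\<^sup>2)"
    \<comment> \<open>Sine and cosine are the two combinations of the exponentials with phases
      \<open>2 * \<theta>\<close> and \<open>- 2 * \<theta>\<close>. By the parallelogram identity
      their interference cancels when marked and unmarked outcomes are added, leaving an equal
      mixture of two phase estimations.\<close>
    have prob: "?a * (cmod (out_amp f True y))\<^sup>2 + (1 - ?a) * (cmod (out_amp f False y))\<^sup>2 = (p y + q y) / 2" for y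
    proof -
      let ?P = "cis \<theta> * window_dft ?D (2 * \<theta>) y" and ?Q = "cis (- \<theta>) * window_dft ?D (2 * (- \<theta>)) y"
      have PQ: "?P = (\<Sum>t<?D. dft ?D y t * of_real (sine_window ?D t) * cis ((2 * real t + 1) * \<theta>))"
        "?Q = (\<Sum>t<?D. dft ?D y t * of_real (sine_window ?D t) * cis (- ((2 * real t + 1) * \<theta>)))"
        unfolding window_dft_def sum_distrib_left
        by (intro sum.cong refl; simp add: mult.left_commute[of "cis _"] cis_mult algebra_simps)+
      have S: "of_real (sin \<theta>) * out_amp f True y = (?P - ?Q) / (2 * \<i>)"
      proof -
        have "of_real (sin \<theta>) * out_amp f True y = (\<Sum>t<?D. dft ?D y t * of_real (sine_window ?D t) * of_real (sin ((2 * real t + 1) * \<theta>)))"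
          unfolding out_amp_def sum_distrib_left
        proof (intro sum.cong refl)
          fix t assume "t \<in> {..<?D}"
          hence "sin ((2 * real t + 1) * \<theta>) = sin \<theta> * fst (grover_amp ?a (rounds (?D - Suc 0) t))"
            using grover_amp_sin[of \<theta> t] s2 by (simp add: rounds)
          thus "of_real (sin \<theta>) * (dft ?D y t * of_real (sine_window ?D t * sel True (grover_amp ?a (rounds (?D - Suc 0) t))))
            = dft ?D y t * of_real (sine_window ?D t) * of_real (sin ((2 * real t + 1) * \<theta>))"
            by simp
        qed
        also have "\<dots> = (?P - ?Q) / (2 * \<i>)"
          unfolding PQ sum_subtractf[symmetric] sum_divide_distrib
          by (intro sum.cong refl) (simp add: complex_eq_iff)
        finally show ?thesis .
      qed
      have C: "of_real (cos \<theta>) * out_amp f False y = (?P + ?Q) / 2"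
      proof -
        have "of_real (cos \<theta>) * out_amp f False y = (\<Sum>t<?D. dft ?D y t * of_real (sine_window ?D t) * of_real (cos ((2 * real t + 1) * \<theta>)))"
          unfolding out_amp_def sum_distrib_left
        proof (intro sum.cong refl)
          fix t assume "t \<in> {..<?D}"
          hence "cos ((2 * real t + 1) * \<theta>) = cos \<theta> * snd (grover_amp ?a (rounds (?D - Suc 0) t))"
            using grover_amp_sin[of \<theta> t] s2 by (simp add: rounds)
          thus "of_real (cos \<theta>) * (dft ?D y t * of_real (sine_window ?D t * sel False (grover_amp ?a (rounds (?D - Suc 0) t))))
            = dft ?D y t * of_real (sine_window ?D t) * of_real (cos ((2 * real t + 1) * \<theta>))"
            by simp
        qed
        also have "\<dots> = (?P + ?Q) / 2"
          unfolding PQ sum.distrib[symmetric] sum_divide_distrib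
          by (intro sum.cong refl) (simp add: complex_eq_iff)
        finally show ?thesis .
      qed
      have "?a * (cmod (out_amp f True y))\<^sup>2 = (cmod ((?P - ?Q) / (2 * \<i>)))\<^sup>2"
        unfolding S[symmetric] by (simp add: norm_mult power_mult_distrib s2)
      moreover have "(1 - ?a) * (cmod (out_amp f False y))\<^sup>2 = (cmod ((?P + ?Q) / 2))\<^sup>2"
        unfolding C[symmetric] by (simp add: norm_mult power_mult_distrib c2)
      moreover have "(cmod ((u - v) / (2 * \<i>)))\<^sup>2 + (cmod ((u + v) / 2))\<^sup>2 = ((cmod u)\<^sup>2 + (cmod v)\<^sup>2) / 2" for u v
        by (simp add: norm_divide norm_mult power_divide power_mult_distrib cmod_power2) (simp add: power2_eq_square field_simps)
      ultimately show ?thesis by (simp add: p_def q_def norm_mult)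
    qed
    \<comment> \<open>Chebyshev's inequality: a bad outcome is at chord distance more than
      \<epsilon> from the true phase, and the second moment of this distance is bounded.\<close>
    have tail: "(\<Sum>y<?D. if bad y then (cmod (window_dft ?D (2 * \<psi>) y))\<^sup>2 else 0) \<le> 2 * pi\<^sup>2 / (real ?D)\<^sup>2 / \<epsilon>\<^sup>2"
      if \<psi>: "\<bar>sin \<psi>\<bar> = sqrt ?a" for \<psi>
    proof -
      have "\<epsilon>\<^sup>2 * (\<Sum>y<?D. if bad y then (cmod (window_dft ?D (2 * \<psi>) y))\<^sup>2 else 0)
        \<le> (\<Sum>y<?D. (cmod (cis (2 * \<psi>) - cis (2 * pi * real y / real ?D)))\<^sup>2 * (cmod (window_dft ?D (2 * \<psi>) y))\<^sup>2)"
        unfolding sum_distrib_left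
      proof (intro sum_mono)
        fix y
        have "\<epsilon>\<^sup>2 \<le> (cmod (cis (2 * \<psi>) - cis (2 * pi * real y / real ?D)))\<^sup>2" if "bad y"
          using that phase_estimate[of \<psi> "2 * pi * real y / real ?D"] \<epsilon> unfolding bad_def \<psi>
          by (intro power_mono) auto
        thus "\<epsilon>\<^sup>2 * (if bad y then (cmod (window_dft ?D (2 * \<psi>) y))\<^sup>2 else 0)
          \<le> (cmod (cis (2 * \<psi>) - cis (2 * pi * real y / real ?D)))\<^sup>2 * (cmod (window_dft ?D (2 * \<psi>) y))\<^sup>2"
          by (auto intro: mult_right_mono)
      qed
      also have "\<dots> \<le> 2 * pi\<^sup>2 / (real ?D)\<^sup>2" by (rule window_dft_concentrated) simp
      finally show ?thesis using \<epsilon> by (simp add: field_simps)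
    qed
    have "(\<Sum>a<2 ^ nm_qubits alg. if \<bar>sqrt ?a - est a\<bar> > \<epsilon> / 2 then nm_prob alg f a else 0)
      = (\<Sum>y<?D. if bad y then (p y + q y) / 2 else 0)"
      using counter_distribution[of bad f] unfolding prob nm_qubits_alg est_def by (simp only: bad_def)
    also have "\<dots> = ((\<Sum>y<?D. if bad y then p y else 0) + (\<Sum>y<?D. if bad y then q y else 0)) / 2"
      unfolding sum.distrib[symmetric] sum_divide_distrib by (intro sum.cong refl) auto
    also have "\<dots> \<le> (2 * pi\<^sup>2 / (real ?D)\<^sup>2 / \<epsilon>\<^sup>2 + 2 * pi\<^sup>2 / (real ?D)\<^sup>2 / \<epsilon>\<^sup>2) / 2"
      unfolding p_def q_def by (intro divide_right_mono add_mono tail) (use s a0 in auto)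
    finally show "(\<Sum>a<2 ^ nm_qubits alg. if \<bar>sqrt ((\<Sum>i<N. real (\<beta> (f i))) / (real N * 2 ^ m2)) - est a\<bar> > \<epsilon> / 2
        then nm_prob alg f a else 0) \<le> 2 * pi\<^sup>2 / (2 ^ \<delta> * \<epsilon>)\<^sup>2"
      by (simp add: mfrac power_mult_distrib mult.commute)
  qed
qed

section \<open>Nonadaptive algorithms and dyadic levels\<close>

definition nonadaptive :: "('d, 'k) nm_alg list \<Rightarrow> (nat list \<Rightarrow> 'g) \<Rightarrow> ('d, 'k, 'g) qalg" where
  "nonadaptive As \<phi> = \<lparr>qA = As, qb = \<lambda>_. 0, qphi = \<phi>\<rparr>"

lemma is_qalg_nonadaptive:
  assumes "As \<noteq> []" "\<And>A. A \<in> set As \<Longrightarrow> is_nm_alg D A"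
  shows "is_qalg D (nonadaptive As \<phi>)"
  using assms by (simp add: is_qalg_def nonadaptive_def)

text \<open>Independence of the runs: a sum of products over all outcome sequences factors.\<close>

lemma sum_outs_prod:
  "(\<Sum>xs\<in>outs A l. \<Prod>j<l. G j (xs ! j)) = (\<Prod>j<l. \<Sum>x<2 ^ nm_qubits (qA A ! j). G j x :: real)"
proof (induction l)
  case (Suc l)
  have "(\<Sum>xs\<in>outs A (Suc l). \<Prod>j<Suc l. G j (xs ! j))
    = (\<Sum>h\<in>outs A l. \<Sum>x<2 ^ nm_qubits (qA A ! l). (\<Prod>j<l. G j (h ! j)) * G l x)"
    unfolding sum_outs_Suc
    by (intro sum.cong refl) (auto simp: outs_def nth_append intro!: prod.cong)
  also have "\<dots> = (\<Sum>h\<in>outs A l. \<Prod>j<l. G j (h ! j)) * (\<Sum>x<2 ^ nm_qubits (qA A ! l). G l x)"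
    by (simp add: sum_product)
  finally show ?case by (simp add: Suc.IH)
qed simp

text \<open>Each bad event \<open>b\<close> is a product of conditions on single outcomes, so its
  probability factors. The covering is demanded only for sequences of nonzero amplitude, where
  outcomes of a search are known to be genuine.\<close>

lemma nonadaptive_union_bound:
  fixes S :: "'b \<Rightarrow> nat \<Rightarrow> nat \<Rightarrow> bool"
  assumes I: "finite I"
    and cover: "\<And>xs. length xs = length As \<Longrightarrow> (\<And>j. j < length As \<Longrightarrow> nm_mat (As ! j) f (xs ! j) 0 \<noteq> 0 \<and> xs ! j < 2 ^ nm_qubits (As ! j)) \<Longrightarrow> E (\<phi> xs) \<Longrightarrow>
      \<exists>b\<in>I. \<forall>j<length As. S b j (xs ! j)"
  shows "qalg_prob (nonadaptive As \<phi>) f E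
    \<le> (\<Sum>b\<in>I. \<Prod>j<length As. \<Sum>x<2 ^ nm_qubits (As ! j). if S b j x then nm_prob (As ! j) f x else 0)"
proof -
  let ?A = "nonadaptive As \<phi>" and ?k = "length As"
  let ?W = "\<lambda>b xs. \<Prod>j<?k. if S b j (xs ! j) then nm_prob (As ! j) f (xs ! j) else 0"
  have qA: "qA ?A = As" "qphi ?A = \<phi>" by (simp_all add: nonadaptive_def)
  have w: "qalg_weight ?A f xs = (\<Prod>j<?k. nm_prob (As ! j) f (xs ! j))" for xs
    by (simp add: qalg_weight_def nonadaptive_def)
  have "qalg_prob ?A f E = (\<Sum>xs\<in>outs ?A ?k. if E (\<phi> xs) then qalg_weight ?A f xs else 0)"
    by (simp add: qalg_prob_def qalg_outcomes_outs qA)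
  also have "\<dots> \<le> (\<Sum>xs\<in>outs ?A ?k. \<Sum>b\<in>I. ?W b xs)"
  proof (intro sum_mono)
    fix xs assume xs: "xs \<in> outs ?A ?k"
    have nn: "?W b xs \<ge> 0" for b by (intro prod_nonneg) auto
    show "(if E (\<phi> xs) then qalg_weight ?A f xs else 0) \<le> (\<Sum>b\<in>I. ?W b xs)"
    proof (cases "E (\<phi> xs) \<and> qalg_weight ?A f xs \<noteq> 0")
      case True
      hence "nm_mat (As ! j) f (xs ! j) 0 \<noteq> 0" if "j < ?k" for j using that by (auto simp: w)
      then obtain b where b: "b \<in> I" "\<forall>j<?k. S b j (xs ! j)"
        using cover[of xs] xs True by (auto simp: outs_def qA)
      hence "?W b xs = qalg_weight ?A f xs" by (simp add: w)
      thus ?thesis using member_le_sum[OF b(1), of "\<lambda>b. ?W b xs"] nn I True by simp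
    next
      case False
      thus ?thesis using nn by (auto intro: sum_nonneg)
    qed
  qed
  also have "\<dots> = (\<Sum>b\<in>I. \<Sum>xs\<in>outs ?A ?k. ?W b xs)" by (rule sum.swap)
  also have "\<dots> = (\<Sum>b\<in>I. \<Prod>j<?k. \<Sum>x<2 ^ nm_qubits (As ! j). if S b j x then nm_prob (As ! j) f x else 0)"
    by (intro sum.cong refl, subst sum_outs_prod) (simp add: qA)
  finally show ?thesis .
qed

lemma nm_prob_total:
  assumes "is_nm_alg D A"
  shows "(\<Sum>x<2 ^ nm_qubits A. nm_prob A f x) = 1"
  using nm_mat_normsq[OF assms, of 0 f] by (simp add: normsq_def)

text \<open>The failures are of two kinds: some position in \<open>H\<close> escapes all
  \<open>J\<close> independent searches, which has probability at most \<open>(1 - q) ^ J\<close>,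
  or one of the estimators is off.\<close>

lemma assembly:
  assumes F: "is_nm_alg D A" and Es: "\<And>m. m < M \<Longrightarrow> is_nm_alg D (Es m)" and J: "J \<ge> 1"
  defines "As \<equiv> replicate J A @ map Es [0..<M]"
  shows "is_qalg D (nonadaptive As \<phi>)"
    "qalg_queries (nonadaptive As \<phi>) = J * nm_queries A + (\<Sum>m<M. nm_queries (Es m))"
    "\<lbrakk>finite H; \<And>i. i \<in> H \<Longrightarrow> code i < 2 ^ nm_qubits A \<and> nm_prob A f (code i) \<ge> q; 
      \<And>m. m < M \<Longrightarrow> (\<Sum>x<2 ^ nm_qubits (Es m). if bad m x then nm_prob (Es m) f x else 0) \<le> \<gamma> m;
      \<And>xs. (\<And>j. j < J \<Longrightarrow> xs ! j < 2 ^ nm_qubits A \<and> nm_mat A f (xs ! j) 0 \<noteq> 0) \<Longrightarrow> (\<And>i. i \<in> H \<Longrightarrow> \<exists>j<J. xs ! j = code i)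
         \<Longrightarrow> (\<And>m. m < M \<Longrightarrow> \<not> bad m (xs ! (J + m))) \<Longrightarrow> \<not> E (\<phi> xs)\<rbrakk>
     \<Longrightarrow> qalg_prob (nonadaptive As \<phi>) f E \<le> real (card H) * (1 - q) ^ J + (\<Sum>m<M. \<gamma> m)"
proof -
  have len: "length As = J + M" by (simp add: As_def)
  have nth: "As ! j = (if j < J then A else Es (j - J))" if "j < J + M" for j
    using that by (simp add: As_def nth_append)
  show "is_qalg D (nonadaptive As \<phi>)"
    by (rule is_qalg_nonadaptive) (use F Es J in \<open>auto simp: As_def\<close>)
  have splitJ: "{..<J + M} = {..<J} \<union> (\<lambda>m. J + m) ` {..<M}" "{..<J} \<inter> (\<lambda>m. J + m) ` {..<M} = {}"
  proof -
    have "x \<in> (\<lambda>m. J + m) ` {..<M}" if "x < J + M" "\<not> x < J" for x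
      using that by (intro image_eqI[of _ _ "x - J"]) auto
    thus "{..<J + M} = {..<J} \<union> (\<lambda>m. J + m) ` {..<M}" by auto
  qed auto
  have sums: "(\<Sum>j<J + M. g j) = (\<Sum>j<J. g j) + (\<Sum>m<M. g (J + m))" for g :: "nat \<Rightarrow> nat"
    unfolding splitJ(1) by (subst sum.union_disjoint) (use splitJ(2) in \<open>auto simp: sum.reindex\<close>)
  have prods: "(\<Prod>j<J + M. g j) = (\<Prod>j<J. g j) * (\<Prod>m<M. g (J + m))" for g :: "nat \<Rightarrow> real"
    unfolding splitJ(1) by (subst prod.union_disjoint) (use splitJ(2) in \<open>auto simp: prod.reindex\<close>)
  have "qalg_queries (nonadaptive As \<phi>) = (\<Sum>j<J + M. nm_queries (As ! j))"
    by (simp add: qalg_queries_def nonadaptive_def len)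
  thus "qalg_queries (nonadaptive As \<phi>) = J * nm_queries A + (\<Sum>m<M. nm_queries (Es m))"
    unfolding sums by (simp add: nth)
  assume H: "finite H" and code: "\<And>i. i \<in> H \<Longrightarrow> code i < 2 ^ nm_qubits A \<and> nm_prob A f (code i) \<ge> q"
    and bad: "\<And>m. m < M \<Longrightarrow> (\<Sum>x<2 ^ nm_qubits (Es m). if bad m x then nm_prob (Es m) f x else 0) \<le> \<gamma> m"
    and good: "\<And>xs. (\<And>j. j < J \<Longrightarrow> xs ! j < 2 ^ nm_qubits A \<and> nm_mat A f (xs ! j) 0 \<noteq> 0) \<Longrightarrow> (\<And>i. i \<in> H \<Longrightarrow> \<exists>j<J. xs ! j = code i)
         \<Longrightarrow> (\<And>m. m < M \<Longrightarrow> \<not> bad m (xs ! (J + m))) \<Longrightarrow> \<not> E (\<phi> xs)"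
  \<comment> \<open>An escaping position restricts all search outcomes and no estimator; a failing
    estimator restricts a single outcome. All other factors of the product are 1.\<close>
  define S where "S = (\<lambda>b j x. case b of Inl i \<Rightarrow> (j < J \<longrightarrow> x \<noteq> code i) | Inr m \<Rightarrow> (j = J + m \<longrightarrow> bad m x))"
  define I where "I = Inl ` H \<union> Inr ` {..<M}"
  have totA: "(\<Sum>x<2 ^ nm_qubits A. nm_prob A f x) = 1" by (rule nm_prob_total[OF F])
  have totE: "(\<Sum>x<2 ^ nm_qubits (Es m). nm_prob (Es m) f x) = 1" if "m < M" for m by (rule nm_prob_total[OF Es[OF that]])
  let ?P = "\<lambda>b. \<Prod>j<length As. \<Sum>x<2 ^ nm_qubits (As ! j). if S b j x then nm_prob (As ! j) f x else 0"
  have P1: "?P (Inl i) \<le> (1 - q) ^ J" if "i \<in> H" for i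
  proof -
    have r: "(\<Sum>x<2 ^ nm_qubits A. if x \<noteq> code i then nm_prob A f x else 0) = 1 - nm_prob A f (code i)"
    proof -
      have "(\<Sum>x<2 ^ nm_qubits A. nm_prob A f x) = (\<Sum>x<2 ^ nm_qubits A. (if x \<noteq> code i then nm_prob A f x else 0) + (if x = code i then nm_prob A f (code i) else 0))"
        by (intro sum.cong refl) auto
      thus ?thesis using code[OF that] totA by (simp add: sum.distrib)
    qed
    have "?P (Inl i) = (\<Prod>j<J. \<Sum>x<2 ^ nm_qubits A. if x \<noteq> code i then nm_prob A f x else 0) * (\<Prod>m<M. 1)"
      unfolding len prods by (intro arg_cong2[of _ _ _ _ "(*)"] prod.cong refl) (auto simp: nth S_def totE intro!: sum.cong)
    also have "\<dots> = (1 - nm_prob A f (code i)) ^ J" unfolding r by simp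
    also have "\<dots> \<le> (1 - q) ^ J"
    proof (rule power_mono)
      have "0 \<le> (\<Sum>x<2 ^ nm_qubits A. if x \<noteq> code i then nm_prob A f x else 0)" by (intro sum_nonneg) auto
      thus "0 \<le> 1 - nm_prob A f (code i)" unfolding r .
    qed (use code[OF that] in simp)
    finally show ?thesis .
  qed
  have P2: "?P (Inr m) \<le> \<gamma> m" if m: "m < M" for m
  proof -
    let ?g = "\<Sum>x<2 ^ nm_qubits (Es m). if bad m x then nm_prob (Es m) f x else 0"
    have "?P (Inr m) = (\<Prod>j<J. 1) * (\<Prod>m'<M. if m' = m then ?g else 1)"
      unfolding len prods by (intro arg_cong2[of _ _ _ _ "(*)"] prod.cong refl) (use m in \<open>auto simp: nth S_def totE totA intro!: sum.cong\<close>)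
    also have "\<dots> = ?g" using m by simp
    finally show ?thesis using bad[OF m] by simp
  qed
  have "qalg_prob (nonadaptive As \<phi>) f E \<le> (\<Sum>b\<in>I. ?P b)"
  proof (rule nonadaptive_union_bound)
    show "finite I" using H by (simp add: I_def)
    fix xs assume xs: "length xs = length As" "\<And>j. j < length As \<Longrightarrow> nm_mat (As ! j) f (xs ! j) 0 \<noteq> 0 \<and> xs ! j < 2 ^ nm_qubits (As ! j)" "E (\<phi> xs)"
    have "xs ! j < 2 ^ nm_qubits A \<and> nm_mat A f (xs ! j) 0 \<noteq> 0" if "j < J" for j
      using xs(2)[of j] that by (simp add: len nth)
    hence "(\<exists>i\<in>H. \<forall>j<J. xs ! j \<noteq> code i) \<or> (\<exists>m<M. bad m (xs ! (J + m)))"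
      using good[of xs] xs(3) by blast
    thus "\<exists>b\<in>I. \<forall>j<length As. S b j (xs ! j)"
    proof
      assume "\<exists>i\<in>H. \<forall>j<J. xs ! j \<noteq> code i"
      then obtain i where "i \<in> H" "\<forall>j<J. xs ! j \<noteq> code i" by blast
      thus ?thesis by (intro bexI[of _ "Inl i"]) (auto simp: S_def I_def)
    next
      assume "\<exists>m<M. bad m (xs ! (J + m))"
      then obtain m where "m < M" "bad m (xs ! (J + m))" by blast
      thus ?thesis by (intro bexI[of _ "Inr m"]) (auto simp: S_def I_def)
    qed
  qed
  also have "\<dots> = (\<Sum>i\<in>H. ?P (Inl i)) + (\<Sum>m<M. ?P (Inr m))"
    unfolding I_def by (subst sum.union_disjoint) (use H in \<open>auto simp: sum.reindex\<close>)
  also have "\<dots> \<le> (\<Sum>i\<in>H. (1 - q) ^ J) + (\<Sum>m<M. \<gamma> m)"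
    by (intro add_mono sum_mono P1 P2) auto
  finally show "qalg_prob (nonadaptive As \<phi>) f E \<le> real (card H) * (1 - q) ^ J + (\<Sum>m<M. \<gamma> m)" by simp
qed

text \<open>The sign \<open>s\<close> is 1 or -1. Positive and negative values are kept apart
  because a marked fraction can only encode the mean of a nonnegative function.\<close>

definition dyadic_part :: "real \<Rightarrow> real \<Rightarrow> real \<Rightarrow> real" where
  "dyadic_part h s y = (if h / 2 \<le> s * y \<and> s * y < h then s * y else 0)"

lemma dyadic_decomposition:
  assumes "t > 0"
  shows "(if \<bar>y\<bar> < t then y else 0)
    = (\<Sum>l<n. dyadic_part (t / 2 ^ l) 1 y - dyadic_part (t / 2 ^ l) (-1) y) + (if \<bar>y\<bar> < t / 2 ^ n then y else 0)"
proof (induction n)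
  case (Suc n)
  have "(if \<bar>y\<bar> < h then y else 0) = (dyadic_part h 1 y - dyadic_part h (-1) y) + (if \<bar>y\<bar> < h / 2 then y else 0)"
    if "h > 0" for h
    using that by (auto simp: dyadic_part_def abs_if split: if_splits)
  from this[of "t / 2 ^ n"] show ?case using assms Suc.IH by (simp add: mult.commute)
qed simp

abbreviation level_mean :: "nat \<Rightarrow> real \<Rightarrow> real \<Rightarrow> (nat \<Rightarrow> real) \<Rightarrow> real" where
  "level_mean N h s f \<equiv> sumN N (\<lambda>i. dyadic_part h s (f i))"

text \<open>Values are scaled by \<open>h\<close> to the unit interval and rounded down to
  \<open>m2\<close> bits, at the price \<eta>. At most a fraction \<open>K\<close> of them is
  nonzero, so the mean \<open>a\<close> is at most \<open>K\<close>, and precision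
  \<open>\<epsilon> / 2\<close> in \<open>sqrt a\<close> becomes
  \<open>\<epsilon> * sqrt K + \<epsilon>\<^sup>2\<close> in \<open>a\<close>. The algorithm depends
  neither on \<epsilon> nor on \<open>K\<close>.\<close>

lemma est_level_ex:
  assumes N: "N \<ge> 1" and h: "h > 0" and s: "s = 1 \<or> s = (-1::real)" and \<delta>: "\<delta> \<ge> 1" and \<eta>: "\<eta> > 0"
  obtains A :: "(nat, real) nm_alg" and est :: "nat \<Rightarrow> real" where "is_nm_alg {..<N} A" "nm_queries A \<le> 2 * 2 ^ \<delta>"
    "\<And>f \<epsilon> K. \<epsilon> > 0 \<Longrightarrow> real (card {i. i < N \<and> h / 2 \<le> \<bar>f i\<bar>}) \<le> K * real N \<Longrightarrow>
      (\<Sum>a<2 ^ nm_qubits A. if \<bar>level_mean N h s f - est a\<bar> > h * (\<epsilon> * sqrt K + \<epsilon>\<^sup>2) + \<eta>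
        then nm_prob A f a else 0) \<le> 2 * pi\<^sup>2 / (2 ^ \<delta> * \<epsilon>)\<^sup>2"
proof -
  obtain m where m: "h / \<eta> < 2 ^ m" using real_arch_pow[of 2 "h / \<eta>"] by auto
  define m2 where "m2 = Suc m"
  have m2: "m2 \<ge> 1" "h \<le> \<eta> * 2 ^ m2"
  proof -
    have "h / \<eta> < 2 ^ m2" using m unfolding m2_def by (rule less_le_trans) simp
    thus "h \<le> \<eta> * 2 ^ m2" using \<eta> by (simp add: field_simps)
  qed (simp add: m2_def)
  let ?M = "(2::real) ^ m2"
  define g where "g = (\<lambda>y. dyadic_part h s y / h)"
  have g: "0 \<le> g y" "g y < 1" "h / 2 \<le> \<bar>y\<bar> \<or> g y = 0" for y
    using h s by (auto simp: g_def dyadic_part_def)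
  define \<beta> where "\<beta> = (\<lambda>y. nat \<lfloor>?M * g y\<rfloor>)"
  have b1: "real (\<beta> y) \<le> ?M * g y" for y using g(1)[of y] by (simp add: \<beta>_def)
  have b2: "?M * g y - 1 \<le> real (\<beta> y)" for y using g(1)[of y] by (simp add: \<beta>_def)
  have \<beta>: "\<beta> y < 2 ^ m2" for y
  proof -
    have "real (\<beta> y) < ?M * 1" using b1[of y] g(2)[of y] by (intro le_less_trans[OF b1] mult_strict_left_mono) auto
    hence "real (\<beta> y) < real (2 ^ m2)" by simp
    thus ?thesis by (simp only: of_nat_less_iff)
  qed
  obtain A est where A: "is_nm_alg {..<N} A" "nm_queries A = 2 * 2 ^ \<delta> - 1" "\<And>a. est a \<ge> 0"
    "\<And>f \<epsilon>. \<epsilon> > 0 \<Longrightarrow> (\<Sum>a<2 ^ nm_qubits A. if \<bar>sqrt ((\<Sum>i<N. real (\<beta> (f i))) / (real N * 2 ^ m2)) - est a\<bar> > \<epsilon> / 2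
        then nm_prob A f a else 0) \<le> 2 * pi\<^sup>2 / (2 ^ \<delta> * \<epsilon>)\<^sup>2"
    using est_stage_ex[where \<beta> = \<beta>, OF N m2(1) \<beta> \<delta>] by blast
  show ?thesis
  proof (rule that[of A "\<lambda>a. h * (est a)\<^sup>2"])
    show "is_nm_alg {..<N} A" by fact
    show "nm_queries A \<le> 2 * 2 ^ \<delta>" by (simp add: A)
    fix f :: "nat \<Rightarrow> real" and \<epsilon> K :: real
    assume \<epsilon>: "\<epsilon> > 0" and K: "real (card {i. i < N \<and> h / 2 \<le> \<bar>f i\<bar>}) \<le> K * real N"
    define a where "a = (\<Sum>i<N. real (\<beta> (f i))) / (real N * ?M)"
    define \<mu> where "\<mu> = (\<Sum>i<N. g (f i)) / real N"
    have Np: "real N > 0" using N by simp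
    have a0: "0 \<le> a" by (simp add: a_def sum_nonneg)
    have sm: "level_mean N h s f = h * \<mu>"
      using h by (simp add: sumN_def \<mu>_def g_def sum_divide_distrib[symmetric])
    have am: "a \<le> \<mu>"
    proof -
      have "(\<Sum>i<N. real (\<beta> (f i))) \<le> (\<Sum>i<N. ?M * g (f i))" by (intro sum_mono b1)
      hence "(\<Sum>i<N. real (\<beta> (f i))) \<le> ?M * (\<Sum>i<N. g (f i))" by (simp only: sum_distrib_left)
      thus ?thesis using Np by (simp add: a_def \<mu>_def field_simps)
    qed
    have ma: "\<mu> - 1 / ?M \<le> a"
    proof -
      have "(\<Sum>i<N. ?M * g (f i) - 1) \<le> (\<Sum>i<N. real (\<beta> (f i)))" by (intro sum_mono b2)
      hence "?M * (\<Sum>i<N. g (f i)) - real N \<le> (\<Sum>i<N. real (\<beta> (f i)))"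
        by (simp add: sum_subtractf sum_distrib_left)
      hence "(?M * (\<Sum>i<N. g (f i)) - real N) / (real N * ?M) \<le> a"
        unfolding a_def using Np by (intro divide_right_mono) auto
      moreover have "(?M * (\<Sum>i<N. g (f i)) - real N) / (real N * ?M) = \<mu> - 1 / ?M"
        using Np by (simp add: \<mu>_def field_simps)
      ultimately show ?thesis by simp
    qed
    have aK: "a \<le> K"
    proof -
      have "(\<Sum>i<N. g (f i)) \<le> (\<Sum>i<N. if h / 2 \<le> \<bar>f i\<bar> then 1 else 0)"
      proof (intro sum_mono)
        fix i
        show "g (f i) \<le> (if h / 2 \<le> \<bar>f i\<bar> then 1 else 0)"
          using g(1,2,3)[of "f i"] by auto
      qed
      also have "\<dots> = real (card {i. i < N \<and> h / 2 \<le> \<bar>f i\<bar>})"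
        by (simp add: sum.If_cases lessThan_def Int_def)
      finally have "\<mu> \<le> K" using K Np by (simp add: \<mu>_def divide_le_eq)
      thus ?thesis using am by simp
    qed
    have close: "\<bar>h * \<mu> - h * (est x)\<^sup>2\<bar> \<le> h * (\<epsilon> * sqrt K + \<epsilon>\<^sup>2) + \<eta>"
      if x: "\<bar>sqrt a - est x\<bar> \<le> \<epsilon> / 2" for x
    proof -
      have "\<bar>a - (est x)\<^sup>2\<bar> = \<bar>sqrt a - est x\<bar> * \<bar>sqrt a + est x\<bar>"
        using a0 by (simp add: abs_mult[symmetric] power2_eq_square algebra_simps)
      also have "\<dots> \<le> (\<epsilon> / 2) * (2 * sqrt K + \<epsilon> / 2)"
      proof (rule mult_mono[OF x])
        have "sqrt a \<le> sqrt K" "0 \<le> sqrt a" using aK a0 by simp_all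
        thus "\<bar>sqrt a + est x\<bar> \<le> 2 * sqrt K + \<epsilon> / 2" using x A(3)[of x] by linarith
      qed (use \<epsilon> in auto)
      also have "\<dots> \<le> \<epsilon> * sqrt K + \<epsilon>\<^sup>2" by (simp add: algebra_simps power2_eq_square)
      finally have 1: "\<bar>a - (est x)\<^sup>2\<bar> \<le> \<epsilon> * sqrt K + \<epsilon>\<^sup>2" .
      have 2: "h * \<bar>\<mu> - a\<bar> \<le> \<eta>"
      proof -
        have "h * \<bar>\<mu> - a\<bar> \<le> h * (1 / ?M)" using am ma h by (intro mult_left_mono) auto
        also have "\<dots> \<le> \<eta>" using m2(2) by (simp add: field_simps)
        finally show ?thesis .
      qed
      have "\<bar>h * \<mu> - h * (est x)\<^sup>2\<bar> = \<bar>h * (\<mu> - a) + h * (a - (est x)\<^sup>2)\<bar>" by (simp add: algebra_simps)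
      also have "\<dots> \<le> h * \<bar>\<mu> - a\<bar> + h * \<bar>a - (est x)\<^sup>2\<bar>"
        using h by (intro order_trans[OF abs_triangle_ineq]) (simp add: abs_mult)
      also have "\<dots> \<le> \<eta> + h * (\<epsilon> * sqrt K + \<epsilon>\<^sup>2)" using 1 2 h by (intro add_mono mult_left_mono) auto
      finally show ?thesis by simp
    qed
    have "(\<Sum>x<2 ^ nm_qubits A. if \<bar>level_mean N h s f - h * (est x)\<^sup>2\<bar> > h * (\<epsilon> * sqrt K + \<epsilon>\<^sup>2) + \<eta>
        then nm_prob A f x else 0)
      \<le> (\<Sum>x<2 ^ nm_qubits A. if \<bar>sqrt a - est x\<bar> > \<epsilon> / 2 then nm_prob A f x else 0)"
      unfolding sm by (intro sum_mono) (use close in \<open>auto simp: not_less[symmetric]\<close>)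
    also have "\<dots> \<le> 2 * pi\<^sup>2 / (2 ^ \<delta> * \<epsilon>)\<^sup>2" unfolding a_def by (rule A(4)[OF \<epsilon>])
    finally show "(\<Sum>x<2 ^ nm_qubits A. if \<bar>level_mean N h s f - h * (est x)\<^sup>2\<bar> > h * (\<epsilon> * sqrt K + \<epsilon>\<^sup>2) + \<eta>
        then nm_prob A f x else 0) \<le> 2 * pi\<^sup>2 / (2 ^ \<delta> * \<epsilon>)\<^sup>2" .
  qed
qed

section \<open>Large values: their number, size and encoding\<close>

lemma Lp_ball_card:
  assumes f: "f \<in> Lp_ball p N" "N \<ge> 1" "p \<ge> 1" and u: "u > 0"
  shows "real (card {i. i < N \<and> u \<le> \<bar>f i\<bar>}) \<le> u powr (- p) * real N"
proof -
  have "(\<Sum>i\<in>{i. i < N \<and> u \<le> \<bar>f i\<bar>}. u powr p) \<le> (\<Sum>i\<in>{i. i < N \<and> u \<le> \<bar>f i\<bar>}. \<bar>f i\<bar> powr p)"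
    using u f(3) by (intro sum_mono powr_mono2) auto
  also have "\<dots> \<le> (\<Sum>i<N. \<bar>f i\<bar> powr p)" by (intro sum_mono2) auto
  also have "\<dots> \<le> real N" by (rule Lp_ball_sum[OF f])
  finally have "u powr (- p) * (real (card {i. i < N \<and> u \<le> \<bar>f i\<bar>}) * u powr p) \<le> u powr (- p) * real N"
    by (intro mult_left_mono) auto
  moreover have "u powr (- p) * u powr p = 1" using u by (simp flip: powr_add)
  ultimately show ?thesis by (simp add: mult.left_commute[of _ "real _"])
qed

text \<open>This confines the large values to a bounded range, so that finitely many codes
  suffice.\<close>

lemma Lp_ball_abs_le:
  assumes f: "f \<in> Lp_ball p N" "N \<ge> 1" "p \<ge> 1" and i: "i < N"
  shows "\<bar>f i\<bar> \<le> real N"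
proof (cases "\<bar>f i\<bar> \<le> 1")
  case False
  hence "\<bar>f i\<bar> powr 1 \<le> \<bar>f i\<bar> powr p" using f(3) by (intro powr_mono) auto
  also have "\<dots> \<le> (\<Sum>i<N. \<bar>f i\<bar> powr p)" by (rule member_le_sum) (use i in auto)
  also have "\<dots> \<le> real N" by (rule Lp_ball_sum[OF f])
  finally show ?thesis by simp
qed (use f(2) in auto)

text \<open>Code 0 is reserved for values below the threshold, so that a nonzero code is exactly the
  marking of the search; the grid starts at code 1, hence the shift by 1 in \<beta> and
  \<open>dec\<close>. Values beyond \<open>B\<close> receive the dummy code 1.\<close>

lemma quantizer_ex:
  fixes t B \<eta> :: real
  assumes "t > 0" "\<eta> > 0" "B \<ge> 0"
  obtains m2 :: nat and \<beta> :: "real \<Rightarrow> nat" and dec :: "nat \<Rightarrow> real" where "m2 \<ge> 1" "\<And>y. \<beta> y < 2 ^ m2"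
    "\<And>y. \<beta> y = 0 \<longleftrightarrow> \<bar>y\<bar> < t" "\<And>y. t \<le> \<bar>y\<bar> \<Longrightarrow> \<bar>y\<bar> \<le> B \<Longrightarrow> \<bar>y - dec (\<beta> y)\<bar> \<le> \<eta>"
proof -
  obtain m where m: "2 * B / \<eta> + 2 < 2 ^ m" using real_arch_pow[of 2 "2 * B / \<eta> + 2"] by auto
  define \<beta> where "\<beta> = (\<lambda>y. if \<bar>y\<bar> < t then 0 else if \<bar>y\<bar> \<le> B then 1 + nat \<lfloor>(y + B) / \<eta>\<rfloor> else 1)"
  define dec where "dec = (\<lambda>x. real (x - 1) * \<eta> - B)"
  have m1: "m \<ge> 1"
  proof (rule ccontr)
    assume "\<not> m \<ge> 1"
    hence "m = 0" by simp
    hence "2 * B / \<eta> + 2 < 1" using m by simp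
    moreover have "0 \<le> 2 * B / \<eta>" using assms by simp
    ultimately show False by linarith
  qed
  show ?thesis
  proof (rule that[of m \<beta> dec])
    show "m \<ge> 1" by fact
    show "\<beta> y = 0 \<longleftrightarrow> \<bar>y\<bar> < t" for y by (simp add: \<beta>_def)
    show "\<beta> y < 2 ^ m" for y
    proof (cases "\<bar>y\<bar> < t \<or> \<not> \<bar>y\<bar> \<le> B")
      case True
      thus ?thesis using one_less_power[of "2::nat" m] m1 by (auto simp: \<beta>_def)
    next
      case False
      hence y: "0 \<le> (y + B) / \<eta>" "(y + B) / \<eta> \<le> 2 * B / \<eta>" using assms(2) by (auto simp: divide_right_mono)
      have "real (nat \<lfloor>(y + B) / \<eta>\<rfloor>) \<le> (y + B) / \<eta>" using y(1) by simp
      hence "1 + real (nat \<lfloor>(y + B) / \<eta>\<rfloor>) < 2 ^ m" using m y by linarith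
      hence "real (\<beta> y) < real (2 ^ m)" using False by (auto simp: \<beta>_def)
      thus ?thesis by (simp only: of_nat_less_iff)
    qed
    fix y assume y: "t \<le> \<bar>y\<bar>" "\<bar>y\<bar> \<le> B"
    have q: "0 \<le> (y + B) / \<eta>" using y assms(2) by simp
    define r where "r = real (nat \<lfloor>(y + B) / \<eta>\<rfloor>)"
    have r: "r \<le> (y + B) / \<eta>" "(y + B) / \<eta> \<le> r + 1" using q unfolding r_def by linarith+
    hence "r * \<eta> \<le> y + B" "y + B \<le> (r + 1) * \<eta>" using assms(2) by (simp_all add: field_simps)
    moreover have "dec (\<beta> y) = r * \<eta> - B" using y by (simp add: \<beta>_def dec_def r_def)
    ultimately show "\<bar>y - dec (\<beta> y)\<bar> \<le> \<eta>" using assms(2) by (simp add: algebra_simps abs_le_iff)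
  qed
qed

text \<open>All parameters are free here. The conditions \<open>c1\<close> and \<open>c2\<close>
  make the search find every large value with failure probability 1/8, \<open>c3\<close> gives the
  estimators of all levels another 1/8, and \<open>c4\<close> counts the queries. The factors of 2
  in the bound come from the two signs at each level.\<close>

lemma upper_core:
  fixes p t \<eta> :: real and \<epsilon> :: "nat \<Rightarrow> real" and \<delta> :: "nat \<Rightarrow> nat" and T J \<Lambda> n N :: nat
  assumes p: "1 \<le> p" and N: "N \<ge> 1" and t: "t > 0" and J: "J \<ge> 1" and \<delta>: "\<And>l. l < \<Lambda> \<Longrightarrow> \<delta> l \<ge> 1"
    and \<epsilon>: "\<And>l. l < \<Lambda> \<Longrightarrow> \<epsilon> l > 0" and \<eta>: "\<eta> > 0"
  defines "k \<equiv> t powr (- p) * real N"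
  assumes k: "k \<ge> 1"
    and c1: "(2 * real T + 1)\<^sup>2 * k \<le> real N / 4"
    and c2: "k * (1 - (2 * real T + 1)\<^sup>2 / (4 * real N)) ^ J \<le> 1 / 8"
    and c3: "(\<Sum>l<\<Lambda>. 4 * pi\<^sup>2 / (2 ^ \<delta> l * \<epsilon> l)\<^sup>2) \<le> 1 / 8"
    and c4: "J * (2 * T + 1) + (\<Sum>l<\<Lambda>. 4 * 2 ^ \<delta> l) \<le> n"
  shows "min_query_err n {..<N} (sumN N) (Lp_ball p N)
    \<le> (\<Sum>l<\<Lambda>. 2 * (t / 2 ^ l * (\<epsilon> l * sqrt ((t / 2 ^ l / 2) powr (- p)) + (\<epsilon> l)\<^sup>2))) + t / 2 ^ \<Lambda> + \<eta>"
proof -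
  \<comment> \<open>The rounding error is shared by the \<open>2 * \<Lambda>\<close> estimators and
    the sum of the large values.\<close>
  define \<eta>' where "\<eta>' = \<eta> / (2 * real \<Lambda> + 1)"
  have "2 * real \<Lambda> + 1 > 0" by (intro add_nonneg_pos) auto
  hence "(2 * real \<Lambda> + 1) * \<eta>' = \<eta>" "\<eta>' > 0" using \<eta> by (simp_all add: \<eta>'_def)
  hence \<eta>': "\<eta>' > 0" "\<eta>' + real (\<Lambda> * 2) * \<eta>' = \<eta>" by (simp_all add: algebra_simps)
  have N0: "real N \<ge> 0" by simp
  obtain m2 :: nat and \<beta> :: "real \<Rightarrow> nat" and dec :: "nat \<Rightarrow> real" where Qz: "m2 \<ge> 1" "\<And>y. \<beta> y < 2 ^ m2"
    "\<And>y. \<beta> y = 0 \<longleftrightarrow> \<bar>y\<bar> < t" "\<And>y. t \<le> \<bar>y\<bar> \<Longrightarrow> \<bar>y\<bar> \<le> real N \<Longrightarrow> \<bar>y - dec (\<beta> y)\<bar> \<le> \<eta>'"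
    using quantizer_ex[OF t \<eta>'(1) N0] by blast
  obtain F :: "(nat, real) nm_alg" where F: "is_nm_alg {..<N} F" "nm_queries F = 2 * T + 1"
    "\<And>f a. a < 2 ^ nm_qubits F \<Longrightarrow> nm_mat F f a 0 \<noteq> 0 \<Longrightarrow> a div 2 ^ m2 < N \<and> a mod 2 ^ m2 = \<beta> (f (a div 2 ^ m2))"
    "\<And>i f. i < N \<Longrightarrow> i * 2 ^ m2 + \<beta> (f i) < 2 ^ nm_qubits F"
    "\<And>i f. i < N \<Longrightarrow> \<beta> (f i) \<noteq> 0 \<Longrightarrow> (2 * real T + 1)\<^sup>2 * real (card {i. i < N \<and> \<beta> (f i) \<noteq> 0}) \<le> real N / 4 \<Longrightarrow>
      nm_prob F f (i * 2 ^ m2 + \<beta> (f i)) \<ge> (2 * real T + 1)\<^sup>2 / (4 * real N)"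
    using find_stage_ex[where \<beta> = \<beta> and T = T, OF N Qz(1,2)] by blast
  \<comment> \<open>One index \<open>m\<close> runs over levels and signs: the level is
    \<open>m div 2\<close> and the parity gives the sign.\<close>
  define h where "h = (\<lambda>m. t / 2 ^ (m div 2 :: nat))"
  define sg where "sg = (\<lambda>m::nat. if even m then 1 else (-1::real))"
  define K where "K = (\<lambda>m. (h m / 2) powr (- p))"
  define b where "b = (\<lambda>m. h m * (\<epsilon> (m div 2) * sqrt (K m) + (\<epsilon> (m div 2))\<^sup>2) + \<eta>')"
  let ?M = "\<Lambda> * 2"
  have "\<forall>m. \<exists>Ee :: (nat, real) nm_alg \<times> (nat \<Rightarrow> real). m < ?M \<longrightarrow> is_nm_alg {..<N} (fst Ee) \<and> nm_queries (fst Ee) \<le> 2 * 2 ^ \<delta> (m div 2) \<and>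
    (\<forall>f. real (card {i. i < N \<and> h m / 2 \<le> \<bar>f i\<bar>}) \<le> K m * real N \<longrightarrow>
      (\<Sum>a<2 ^ nm_qubits (fst Ee). if \<bar>level_mean N (h m) (sg m) f - snd Ee a\<bar> > b m
        then nm_prob (fst Ee) f a else 0) \<le> 2 * pi\<^sup>2 / (2 ^ \<delta> (m div 2) * \<epsilon> (m div 2))\<^sup>2)"
    (is "\<forall>m. \<exists>Ee. ?P m Ee")
  proof
    fix m
    show "\<exists>Ee. ?P m Ee"
    proof (cases "m < ?M")
      case True
      hence l: "m div 2 < \<Lambda>" by auto
      have hm: "h m > 0" using t by (simp add: h_def)
      have sgm: "sg m = 1 \<or> sg m = -1" by (simp add: sg_def)
      obtain A est where A: "is_nm_alg {..<N} A" "nm_queries A \<le> 2 * 2 ^ \<delta> (m div 2)"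
        "\<And>f \<epsilon> K. \<epsilon> > 0 \<Longrightarrow> real (card {i. i < N \<and> h m / 2 \<le> \<bar>f i\<bar>}) \<le> K * real N \<Longrightarrow>
          (\<Sum>a<2 ^ nm_qubits A. if \<bar>level_mean N (h m) (sg m) f - est a\<bar> > h m * (\<epsilon> * sqrt K + \<epsilon>\<^sup>2) + \<eta>'
            then nm_prob A f a else 0) \<le> 2 * pi\<^sup>2 / (2 ^ \<delta> (m div 2) * \<epsilon>)\<^sup>2"
        using est_level_ex[OF N hm sgm \<delta>[OF l] \<eta>'(1)] by blast
      show ?thesis
        by (rule exI[of _ "(A, est)"], unfold fst_conv snd_conv b_def) (use A(1,2) A(3)[OF \<epsilon>[OF l]] in blast)
    qed simp
  qed
  from choice[OF this] obtain Ee :: "nat \<Rightarrow> (nat, real) nm_alg \<times> (nat \<Rightarrow> real)" where Ee: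
    "\<And>m. m < ?M \<Longrightarrow> is_nm_alg {..<N} (fst (Ee m))" "\<And>m. m < ?M \<Longrightarrow> nm_queries (fst (Ee m)) \<le> 2 * 2 ^ \<delta> (m div 2)"
    "\<And>m f. m < ?M \<Longrightarrow> real (card {i. i < N \<and> h m / 2 \<le> \<bar>f i\<bar>}) \<le> K m * real N \<Longrightarrow>
      (\<Sum>a<2 ^ nm_qubits (fst (Ee m)). if \<bar>level_mean N (h m) (sg m) f - snd (Ee m) a\<bar> > b m
        then (cmod (nm_mat (fst (Ee m)) f a 0))\<^sup>2 else 0) \<le> 2 * pi\<^sup>2 / (2 ^ \<delta> (m div 2) * \<epsilon> (m div 2))\<^sup>2"
    by blast
  define Es where "Es = (\<lambda>m. fst (Ee m))"
  \<comment> \<open>A set of pairs, so a position that is hit repeatedly is counted once. Outcomes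
    with code 0 are unmarked positions and are dropped.\<close>
  define found where "found = (\<lambda>xs::nat list. (\<lambda>j. (xs ! j div 2 ^ m2, xs ! j mod 2 ^ m2)) ` {j. j < J \<and> xs ! j mod 2 ^ m2 \<noteq> 0})"
  define \<phi> where "\<phi> = (\<lambda>xs. (1 / real N) * (\<Sum>(i, v)\<in>found xs. dec v) + (\<Sum>m<?M. sg m * snd (Ee m) (xs ! (J + m))))"
  define A where "A = nonadaptive (replicate J F @ map Es [0..<?M]) \<phi>"
  have EsA: "\<And>m. m < ?M \<Longrightarrow> is_nm_alg {..<N} (Es m)" using Ee(1) by (simp add: Es_def)
  have pairs: "(\<Sum>m<?M. g m) = (\<Sum>l<\<Lambda>. g (l * 2) + g (Suc (l * 2)))" for g :: "nat \<Rightarrow> 'z::comm_monoid_add"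
    by (subst sum_lessThan_mult) (simp add: numeral_2_eq_2)
  have qA: "is_qalg {..<N} A" unfolding A_def by (rule assembly(1)[OF F(1) _ J]) (rule EsA)
  have qn: "qalg_queries A \<le> n"
  proof -
    have "qalg_queries A = J * nm_queries F + (\<Sum>m<?M. nm_queries (Es m))"
      unfolding A_def by (rule assembly(2)[OF F(1) _ J]) (rule EsA)
    also have "nm_queries F = 2 * T + 1" by (rule F(2))
    also have "(\<Sum>m<?M. nm_queries (Es m)) \<le> (\<Sum>m<?M. 2 * 2 ^ \<delta> (m div 2))"
      using Ee(2) by (intro sum_mono) (simp add: Es_def)
    also have "(\<Sum>m<?M. 2 * 2 ^ \<delta> (m div 2)) = (\<Sum>l<\<Lambda>. 4 * (2::nat) ^ \<delta> l)"
      unfolding pairs by (intro sum.cong refl) simp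
    finally show ?thesis using c4 by simp
  qed
  let ?B = "(\<Sum>l<\<Lambda>. 2 * (t / 2 ^ l * (\<epsilon> l * sqrt ((t / 2 ^ l / 2) powr (- p)) + (\<epsilon> l)\<^sup>2))) + t / 2 ^ \<Lambda> + \<eta>"
  have sumb: "\<eta>' + (\<Sum>m<?M. b m) + t / 2 ^ \<Lambda> = ?B"
  proof -
    have "(\<Sum>m<?M. b m) = (\<Sum>m<?M. h m * (\<epsilon> (m div 2) * sqrt (K m) + (\<epsilon> (m div 2))\<^sup>2)) + real ?M * \<eta>'"
      by (simp add: b_def sum.distrib)
    also have "(\<Sum>m<?M. h m * (\<epsilon> (m div 2) * sqrt (K m) + (\<epsilon> (m div 2))\<^sup>2))
      = (\<Sum>l<\<Lambda>. 2 * (t / 2 ^ l * (\<epsilon> l * sqrt ((t / 2 ^ l / 2) powr (- p)) + (\<epsilon> l)\<^sup>2)))"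
      unfolding pairs by (intro sum.cong refl) (simp add: h_def K_def)
    finally show ?thesis using \<eta>'(2) by linarith
  qed
  show ?thesis
  proof (rule min_query_err_le[OF qA qn])
    have "(\<lambda>_. 0) \<in> Lp_ball p N" using p by (simp add: Lp_ball_def Lp_norm_def)
    thus "Lp_ball p N \<noteq> {}" by blast
    show "norm (sumN N f) \<le> 2" if "f \<in> Lp_ball p N" for f using sumN_abs_le[OF that N p] by simp
    fix f assume f: "f \<in> Lp_ball p N"
    define H where "H = {i. i < N \<and> t \<le> \<bar>f i\<bar>}"
    have finH: "finite H" by (simp add: H_def)
    have H\<beta>: "{i. i < N \<and> \<beta> (f i) \<noteq> 0} = H" by (auto simp: H_def Qz(3))
    have cH: "real (card H) \<le> k" unfolding H_def k_def by (rule Lp_ball_card[OF f N p t])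
    let ?q = "(2 * real T + 1)\<^sup>2 / (4 * real N)"
    have q1: "?q \<le> 1"
    proof -
      have "(2 * real T + 1)\<^sup>2 * 1 \<le> (2 * real T + 1)\<^sup>2 * k" using k by (intro mult_left_mono) auto
      also have "\<dots> \<le> real N / 4" by (rule c1)
      also have "\<dots> \<le> 4 * real N" by simp
      finally have "(2 * real T + 1)\<^sup>2 \<le> 4 * real N" by simp
      thus ?thesis using N by (simp add: divide_le_eq)
    qed
    have cHT: "(2 * real T + 1)\<^sup>2 * real (card {i. i < N \<and> \<beta> (f i) \<noteq> 0}) \<le> real N / 4"
      unfolding H\<beta> by (rule order_trans[OF mult_left_mono[OF cH] c1]) simp
    have "qalg_prob A f (\<lambda>z. norm (sumN N f - z) > ?B) \<le> real (card H) * (1 - ?q) ^ J + (\<Sum>m<?M. 2 * pi\<^sup>2 / (2 ^ \<delta> (m div 2) * \<epsilon> (m div 2))\<^sup>2)"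
      unfolding A_def
    proof (rule assembly(3)[OF F(1) _ J, where code = "\<lambda>i. i * 2 ^ m2 + \<beta> (f i)" and bad = "\<lambda>m x. \<bar>level_mean N (h m) (sg m) f - snd (Ee m) x\<bar> > b m"])
      show "is_nm_alg {..<N} (Es m)" if "m < ?M" for m by (rule EsA[OF that])
      show "finite H" by (rule finH)
    next
      fix i assume "i \<in> H"
      hence "i < N" "\<beta> (f i) \<noteq> 0" by (auto simp: H_def Qz(3))
      thus "i * 2 ^ m2 + \<beta> (f i) < 2 ^ nm_qubits F \<and> ?q \<le> nm_prob F f (i * 2 ^ m2 + \<beta> (f i))"
        using F(4,5) cHT by blast
    next
      fix m assume m: "m < ?M"
      have "h m / 2 > 0" using t by (simp add: h_def)
      from Lp_ball_card[OF f N p this] have "real (card {i. i < N \<and> h m / 2 \<le> \<bar>f i\<bar>}) \<le> K m * real N" by (simp add: K_def)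
      from Ee(3)[OF m this] show "(\<Sum>x<2 ^ nm_qubits (Es m). if b m < \<bar>level_mean N (h m) (sg m) f - snd (Ee m) x\<bar>
          then nm_prob (Es m) f x else 0) \<le> 2 * pi\<^sup>2 / (2 ^ \<delta> (m div 2) * \<epsilon> (m div 2))\<^sup>2"
        unfolding Es_def .
    next
      fix xs :: "nat list"
      assume x1: "\<And>j. j < J \<Longrightarrow> xs ! j < 2 ^ nm_qubits F \<and> nm_mat F f (xs ! j) 0 \<noteq> 0"
        and x2: "\<And>i. i \<in> H \<Longrightarrow> \<exists>j<J. xs ! j = i * 2 ^ m2 + \<beta> (f i)"
        and x3: "\<And>m. m < ?M \<Longrightarrow> \<not> b m < \<bar>level_mean N (h m) (sg m) f - snd (Ee m) (xs ! (J + m))\<bar>"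
      \<comment> \<open>One inclusion holds because outcomes of nonzero amplitude carry correct
        codes, the other because no position in \<open>H\<close> was missed.\<close>
      have fnd: "found xs = (\<lambda>i. (i, \<beta> (f i))) ` H"
      proof (intro equalityI subsetI)
        fix z assume "z \<in> found xs"
        then obtain j where j: "j < J" "xs ! j mod 2 ^ m2 \<noteq> 0" "z = (xs ! j div 2 ^ m2, xs ! j mod 2 ^ m2)" by (auto simp: found_def)
        have "xs ! j div 2 ^ m2 < N \<and> xs ! j mod 2 ^ m2 = \<beta> (f (xs ! j div 2 ^ m2))" using F(3) x1[OF j(1)] by blast
        thus "z \<in> (\<lambda>i. (i, \<beta> (f i))) ` H" using j H\<beta> by (intro image_eqI[of _ _ "xs ! j div 2 ^ m2"]) auto
      next
        fix z assume "z \<in> (\<lambda>i. (i, \<beta> (f i))) ` H"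
        then obtain i where i: "i \<in> H" "z = (i, \<beta> (f i))" by blast
        then obtain j where j: "j < J" "xs ! j = i * 2 ^ m2 + \<beta> (f i)" using x2 by blast
        have "xs ! j div 2 ^ m2 = i" "xs ! j mod 2 ^ m2 = \<beta> (f i)" unfolding j(2) using Qz(2)[of "f i"] by simp_all
        moreover have "\<beta> (f i) \<noteq> 0" using i(1) H\<beta> by auto
        ultimately show "z \<in> found xs" unfolding found_def i(2) using j(1) by (intro image_eqI[of _ _ j]) auto
      qed
      have "(\<Sum>(i, v)\<in>found xs. dec v) = (\<Sum>i\<in>H. dec (\<beta> (f i)))"
        unfolding fnd by (subst sum.reindex) (auto simp: inj_on_def)
      hence \<phi>: "\<phi> xs = (1 / real N) * (\<Sum>i\<in>H. dec (\<beta> (f i))) + (\<Sum>m<?M. sg m * snd (Ee m) (xs ! (J + m)))" by (simp add: \<phi>_def)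
      define tail where "tail = (\<lambda>y. if \<bar>y\<bar> < t / 2 ^ \<Lambda> then y else (0::real))"
      have dec1: "f i = (if i \<in> H then f i else 0) + (\<Sum>m<?M. sg m * dyadic_part (h m) (sg m) (f i)) + tail (f i)" if "i < N" for i
      proof -
        have "(\<Sum>m<?M. sg m * dyadic_part (h m) (sg m) (f i)) = (\<Sum>l<\<Lambda>. dyadic_part (t / 2 ^ l) 1 (f i) - dyadic_part (t / 2 ^ l) (-1) (f i))"
          unfolding pairs by (intro sum.cong refl) (simp add: h_def sg_def)
        thus ?thesis using dyadic_decomposition[OF t, of "f i" \<Lambda>] that by (auto simp: H_def tail_def)
      qed
      have "(\<Sum>i<N. f i) = (\<Sum>i<N. (if i \<in> H then f i else 0) + (\<Sum>m<?M. sg m * dyadic_part (h m) (sg m) (f i)) + tail (f i))"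
        by (intro sum.cong refl) (use dec1 in blast)
      also have "\<dots> = (\<Sum>i<N. if i \<in> H then f i else 0) + (\<Sum>m<?M. sg m * (\<Sum>i<N. dyadic_part (h m) (sg m) (f i))) + (\<Sum>i<N. tail (f i))"
        unfolding sum.distrib sum_distrib_left by (subst sum.swap) (rule refl)
      also have "(\<Sum>i<N. if i \<in> H then f i else 0) = (\<Sum>i\<in>H. f i)"
        by (subst sum.inter_restrict[symmetric]) (auto simp: H_def intro!: sum.cong)
      finally have "sumN N f = (1 / real N) * (\<Sum>i\<in>H. f i) + (\<Sum>m<?M. sg m * level_mean N (h m) (sg m) f) + (1 / real N) * (\<Sum>i<N. tail (f i))"
        by (simp add: sumN_def distrib_left sum_distrib_left mult.left_commute)
      hence diff: "sumN N f - \<phi> xs = (1 / real N) * (\<Sum>i\<in>H. f i - dec (\<beta> (f i)))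
        + (\<Sum>m<?M. sg m * (level_mean N (h m) (sg m) f - snd (Ee m) (xs ! (J + m)))) + (1 / real N) * (\<Sum>i<N. tail (f i))"
        by (simp add: \<phi> sum_subtractf right_diff_distrib)
      have e1: "\<bar>(1 / real N) * (\<Sum>i\<in>H. f i - dec (\<beta> (f i)))\<bar> \<le> \<eta>'"
      proof -
        have "\<bar>\<Sum>i\<in>H. f i - dec (\<beta> (f i))\<bar> \<le> (\<Sum>i\<in>H. \<eta>')"
          by (rule order_trans[OF sum_abs]) (intro sum_mono Qz(4) Lp_ball_abs_le[OF f N p], auto simp: H_def)
        also have "\<dots> \<le> real N * \<eta>'"
        proof -
          have "card H \<le> card {..<N}" by (rule card_mono) (auto simp: H_def)
          thus ?thesis using \<eta>'(1) by simp
        qed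
        finally show ?thesis using N by (simp add: abs_mult field_simps)
      qed
      have abs_sg: "\<bar>sg m\<bar> = 1" for m by (simp add: sg_def)
      have e2: "\<bar>\<Sum>m<?M. sg m * (level_mean N (h m) (sg m) f - snd (Ee m) (xs ! (J + m)))\<bar> \<le> (\<Sum>m<?M. b m)"
        by (rule order_trans[OF sum_abs]) (intro sum_mono, use x3 abs_sg in \<open>auto simp: abs_mult not_less\<close>)
      have e3: "\<bar>(1 / real N) * (\<Sum>i<N. tail (f i))\<bar> \<le> t / 2 ^ \<Lambda>"
      proof -
        have "\<bar>\<Sum>i<N. tail (f i)\<bar> \<le> (\<Sum>i<N. t / 2 ^ \<Lambda>)"
          by (rule order_trans[OF sum_abs]) (intro sum_mono, use t in \<open>auto simp: tail_def\<close>)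
        thus ?thesis using N by (simp add: abs_mult field_simps)
      qed
      have "\<bar>sumN N f - \<phi> xs\<bar> \<le> ?B" unfolding diff using e1 e2 e3 sumb by linarith
      thus "\<not> ?B < norm (sumN N f - \<phi> xs)" by simp
    qed
    also have "\<dots> \<le> k * (1 - ?q) ^ J + (\<Sum>l<\<Lambda>. 4 * pi\<^sup>2 / (2 ^ \<delta> l * \<epsilon> l)\<^sup>2)"
    proof (rule add_mono)
      show "real (card H) * (1 - ?q) ^ J \<le> k * (1 - ?q) ^ J" using cH q1 by (intro mult_right_mono) auto
      show "(\<Sum>m<?M. 2 * pi\<^sup>2 / (2 ^ \<delta> (m div 2) * \<epsilon> (m div 2))\<^sup>2) \<le> (\<Sum>l<\<Lambda>. 4 * pi\<^sup>2 / (2 ^ \<delta> l * \<epsilon> l)\<^sup>2)"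
        unfolding pairs by (intro sum_mono) simp
    qed
    also have "\<dots> \<le> 1/4" using c2 c3 by simp
    finally show "qalg_prob A f (\<lambda>z. norm (sumN N f - z) > ?B) \<le> 1/4" .
  qed
qed

section \<open>Choice of the parameters\<close>

lemma sum_geometric_le:
  fixes r :: real
  assumes "0 \<le> r" "r < 1"
  shows "(\<Sum>l<n. r ^ l) \<le> 1 / (1 - r)"
proof -
  have "(\<Sum>l<n. r ^ l) = (1 - r ^ n) / (1 - r)"
    using assms by (simp add: sum_gp_strict)
  also have "\<dots> \<le> 1 / (1 - r)"
    using assms by (intro divide_right_mono) auto
  finally show ?thesis .
qed

text \<open>This inequality is what yields \<open>k \<ge> 1\<close> for the later choice of
  \<open>k\<close>. It follows from \<open>ln x \<le> x - 1\<close> at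
  \<open>x = z / 2 ^ 14\<close>, with 1/2 as a lower bound for \<open>ln 2\<close>.\<close>

lemma log2_bound:
  fixes z :: real
  assumes "z \<ge> 2 ^ 14"
  shows "1024 * log 2 z \<le> z"
proof -
  have z: "z > 0" using assms by (rule less_le_trans[rotated]) simp
  have "ln (z / 2 ^ 14) \<le> z / 2 ^ 14 - 1" by (rule ln_le_minus_one) (use z in simp)
  moreover have "1/2 \<le> ln (2::real)"
  proof -
    have "ln (1 / 2 :: real) \<le> 1 / 2 - 1" by (rule ln_le_minus_one) simp
    thus ?thesis by (simp add: ln_div)
  qed
  moreover have "0 \<le> z / 2 ^ 14 - 1" using assms by simp
  ultimately have "ln (z / 2 ^ 14) / ln 2 \<le> (z / 2 ^ 14 - 1) / (1/2)"
    by (intro frac_le) auto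
  hence "log 2 (z / 2 ^ 14) \<le> 2 * (z / 2 ^ 14 - 1)" by (simp add: log_def)
  moreover have "log 2 (z / 2 ^ 14) = log 2 z - 14"
    using z log_divide[of 2 z "2 ^ 14"] log_nat_power[of 2 2 14] by simp
  ultimately have "log 2 z \<le> 12 + z / 8192" by simp
  thus ?thesis using assms by simp
qed

text \<open>Level \<open>l\<close> receives a share of order \<open>n * r ^ l\<close> of the
  queries, which lets \<epsilon> grow like \<open>1 / (r ^ l)\<^sup>2\<close> while its failure
  probability decays like \<open>(r ^ l)\<^sup>2\<close>. The error of a level starts with a decay
  of \<open>(r ^ l) ^ 4\<close>, so \<open>(r ^ l)\<^sup>2\<close> is left and the sum over the
  levels converges with a bound depending on \<open>p\<close> only.\<close>

lemma upper_bound_ex: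
  fixes p :: real
  assumes p: "1 \<le> p" "p < 2"
  shows "\<exists>c0 C. c0 \<ge> 1 \<and> C > 0 \<and> (\<forall>n N :: nat. n \<ge> 1 \<and> N \<ge> 1 \<and> c0 * sqrt (real N) \<le> real n \<and> real n \<le> real N \<longrightarrow>
     min_query_err n {..<N} (sumN N) (Lp_ball p N)
       \<le> C * real n powr (-2 / p) * real N powr (2 / p - 1) * max (log 2 (real n / sqrt (real N))) 1 powr (2 / p - 1))"
proof -
  \<comment> \<open>The decay \<open>2 powr (- (1 - p / 2) * l)\<close> is split into four equal
    factors \<open>2 powr (- \<kappa> * l)\<close>. It is positive exactly because
    \<open>p < 2\<close>.\<close>
  define \<kappa> where "\<kappa> = (2 - p) / 8"
  have \<kappa>: "0 < \<kappa>" "\<kappa> \<le> 1 / 8" "1 - p / 2 = 4 * \<kappa>" using p by (auto simp: \<kappa>_def)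
  define r where "r = 2 powr (- \<kappa>)"
  have r: "0 < r" "r < 1" using \<kappa> by (auto simp: r_def powr_less_one)
  \<comment> \<open>Level \<open>l\<close> uses at most \<open>4 * b * n * r ^ l\<close> queries;
    the sum of the geometric series makes this half of \<open>n\<close> in total.\<close>
  define b where "b = (1 - r) / 8"
  have "1 - r = 8 * b" by (simp add: b_def)
  hence b: "0 < b" "b < 1" "1 / (1 - r) = 1 / (8 * b)" using r by auto
  \<comment> \<open>Chosen so that the failure probability
    \<open>4 * pi\<^sup>2 * (r ^ l)\<^sup>2 / S\<^sup>2\<close> of level \<open>l\<close> is at most
    \<open>b * r ^ l\<close>; these sum to at most 1/8.\<close>
  define S where "S = sqrt (64 / b)"
  have S: "S > 0" "S\<^sup>2 = 64 / b" using b by (auto simp: S_def)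
  \<comment> \<open>The square root 1/1024 serves twice: it matches \<open>1024 * L \<le> z\<close>,
    giving \<open>k \<ge> 1\<close>, and it is small enough for the searches to use at most
    \<open>n / 2\<close> queries.\<close>
  define c where "c = (1 / 2 ^ 20 :: real)"
  define C1 where "C1 = 2 * S / b"
  define C3 where "C3 = (4 * C1 + 2 * C1\<^sup>2) / (8 * b) + 4 / b\<^sup>2 + 1"
  \<comment> \<open>The first entry is for \<open>log2_bound\<close>, the second ensures
    \<open>b * n \<ge> 2\<close>, so that the top level can afford its estimators.\<close>
  define c0 where "c0 = max (2 ^ 14) (2 / b)"
  have C1: "C1 > 0" using S b by (simp add: C1_def)
  have C3: "C3 > 0" using C1 b by (auto simp: C3_def intro!: add_nonneg_pos add_nonneg_nonneg)
  have pow2: "(2 powr (- \<kappa> * real l) :: real) = r ^ l" for l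
  proof -
    have "r ^ l = r powr real l" using r(1) by (simp add: powr_realpow)
    thus ?thesis by (simp add: r_def powr_powr)
  qed
  have main: "min_query_err n {..<N} (sumN N) (Lp_ball p N)
       \<le> C3 * c powr (- 1 / p) * real n powr (-2 / p) * real N powr (2 / p - 1) * max (log 2 (real n / sqrt (real N))) 1 powr (2 / p - 1)"
    if n1: "n \<ge> 1" and N: "N \<ge> 1" and nN: "c0 * sqrt (real N) \<le> real n" "real n \<le> real N" for n N :: nat
  proof -
    have Np: "real N > 0" and np: "real n > 0" using N n1 by auto
    define z where "z = real n / sqrt (real N)"
    have zc: "c0 \<le> z" using nN(1) Np by (simp add: z_def pos_le_divide_eq)
    hence z: "z \<ge> 2 ^ 14" "z \<ge> 2 / b" by (auto simp: c0_def)
    have zp: "z > 0" using z(1) by (rule less_le_trans[rotated]) simp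
    have z2: "z\<^sup>2 = (real n)\<^sup>2 / real N" by (simp add: z_def power_divide)
    define L where "L = max (log 2 z) 1"
    have lz: "1024 * log 2 z \<le> z" by (rule log2_bound[OF z(1)])
    have L: "L \<ge> 1" "1024 * L \<le> z" "log 2 z \<le> L" using lz z(1) by (auto simp: L_def)
    define k where "k = c * z\<^sup>2 / L\<^sup>2"
    have k1: "k \<ge> 1"
    proof -
      have "(1024 * L)\<^sup>2 \<le> z\<^sup>2" using L by (intro power_mono) auto
      thus ?thesis using L(1) by (simp add: k_def c_def power_mult_distrib field_simps)
    qed
    have kz: "k \<le> c * z\<^sup>2"
    proof -
      have "k \<le> c * z\<^sup>2 / 1" unfolding k_def using L(1) by (intro divide_left_mono) (auto simp: c_def)
      thus ?thesis by simp
    qed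
    have kN: "16 * k \<le> real N"
    proof -
      have "16 * k \<le> 16 * (c * z\<^sup>2)" using kz by simp
      also have "\<dots> \<le> z\<^sup>2" by (simp add: c_def)
      also have "\<dots> = (real n)\<^sup>2 / real N" by (rule z2)
      also have "\<dots> \<le> (real N)\<^sup>2 / real N" using nN(2) by (intro divide_right_mono power_mono) auto
      also have "\<dots> = real N" using Np by (simp add: power2_eq_square)
      finally show ?thesis .
    qed
    define t where "t = (real N / k) powr (1 / p)"
    have t: "t > 0" using Np k1 by (simp add: t_def)
    have tp: "t powr (- p) = k / real N"
    proof -
      have "t powr (- p) = (real N / k) powr (-1)" using p by (simp add: t_def powr_powr)
      also have "\<dots> = k / real N" using Np k1 by (simp add: powr_minus)
      finally show ?thesis .
    qed
    have ktN: "t powr (- p) * real N = k" using tp Np by simp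
    \<comment> \<open>A fixed fraction of the number of Grover iterations that would be optimal for
      \<open>k\<close> marked positions, so the search cannot overshoot. From
      \<open>u \<ge> 1 / 2\<close>, rounding down keeps \<open>2 * T + 1\<close> between
      \<open>u\<close> and \<open>4 * u\<close>.\<close>
    define u where "u = sqrt (real N / k) / 8"
    have u: "u \<ge> 1 / 2" "u\<^sup>2 = real N / (64 * k)"
    proof -
      have "16 \<le> real N / k" using kN k1 by (simp add: pos_le_divide_eq)
      hence "sqrt 16 \<le> sqrt (real N / k)" by (rule real_sqrt_le_mono)
      moreover have "sqrt 16 = (4::real)" by (rule real_sqrt_unique) auto
      ultimately show "u \<ge> 1 / 2" by (simp add: u_def)
      show "u\<^sup>2 = real N / (64 * k)" using k1 Np by (simp add: u_def power_divide)
    qed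
    define T where "T = nat \<lfloor>u\<rfloor>"
    have T: "real T \<le> u" "u < real T + 1" using u(1) by (auto simp: T_def)
    have T1: "u \<le> 2 * real T + 1" "2 * real T + 1 \<le> 4 * u"
      using T u(1) by linarith+
    \<comment> \<open>A run hits a given large position with probability at least
      \<open>1 / (256 * k)\<close>, so after \<open>J\<close> runs it is missed with probability at
      most \<open>exp (- ln (8 * k))\<close>; the union over at most \<open>k\<close> positions
      gives 1/8.\<close>
    define J where "J = nat \<lceil>256 * k * ln (8 * k)\<rceil>"
    have ln8: "1 \<le> ln (8 * k)"
    proof -
      have "exp (1::real) \<le> 3" by (rule exp_le)
      also have "\<dots> \<le> 8 * k" using k1 by simp
      finally show ?thesis using k1 by (subst ln_ge_iff) auto
    qed
    have kl: "1 \<le> k * ln (8 * k)" using mult_mono[OF k1 ln8] k1 by simp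
    have J1: "256 * k * ln (8 * k) \<le> real J" unfolding J_def by (rule real_nat_ceiling_ge)
    have J2: "real J \<le> 256 * k * ln (8 * k) + 1" unfolding J_def using kl by linarith
    have J: "J \<ge> 1" using J1 kl by linarith
    have find1: "(2 * real T + 1)\<^sup>2 * k \<le> real N / 4"
    proof -
      have "(2 * real T + 1)\<^sup>2 \<le> (4 * u)\<^sup>2" using T1(2) by (intro power_mono) auto
      also have "\<dots> = real N / (4 * k)" using k1 by (simp add: power_mult_distrib u(2))
      finally have "(2 * real T + 1)\<^sup>2 * k \<le> real N / (4 * k) * k" using k1 by (intro mult_right_mono) auto
      thus ?thesis using k1 by simp
    qed
    have find2: "k * (1 - (2 * real T + 1)\<^sup>2 / (4 * real N)) ^ J \<le> 1 / 8"
    proof -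
      let ?q = "(2 * real T + 1)\<^sup>2 / (4 * real N)"
      have "u\<^sup>2 \<le> (2 * real T + 1)\<^sup>2" using T1(1) u(1) by (intro power_mono) auto
      hence "u\<^sup>2 / (4 * real N) \<le> ?q" by (intro divide_right_mono) auto
      hence q: "1 / (256 * k) \<le> ?q" using Np k1 by (simp add: u(2) field_simps)
      have "(2 * real T + 1)\<^sup>2 * 1 \<le> (2 * real T + 1)\<^sup>2 * k" using k1 by (intro mult_left_mono) auto
      also have "\<dots> \<le> real N / 4" by (rule find1)
      also have "\<dots> \<le> 4 * real N" by simp
      finally have "?q \<le> 1" using Np by simp
      hence "(1 - ?q) ^ J \<le> exp (- ?q) ^ J" using exp_ge_add_one_self[of "- ?q"] by (intro power_mono) auto
      also have "\<dots> = exp (- (real J * ?q))" by (simp add: exp_of_nat_mult[symmetric])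
      also have "\<dots> \<le> exp (- ln (8 * k))"
      proof -
        have "ln (8 * k) = 256 * k * ln (8 * k) * (1 / (256 * k))" using k1 by simp
        also have "\<dots> \<le> real J * ?q" using J1 q k1 ln8 by (intro mult_mono) auto
        finally show ?thesis by simp
      qed
      also have "\<dots> = 1 / (8 * k)" using k1 by (simp add: exp_minus inverse_eq_divide)
      finally have "k * (1 - ?q) ^ J \<le> k * (1 / (8 * k))" using k1 by (intro mult_left_mono) auto
      thus ?thesis using k1 by simp
    qed
    have find3: "real (J * (2 * T + 1)) \<le> real n / 2"
    proof -
      have lnk: "ln (8 * k) \<le> 2 * L"
      proof -
        have "8 * k \<le> z\<^sup>2" using kz k1 by (simp add: c_def)
        hence "ln (8 * k) \<le> ln (z\<^sup>2)" using k1 zp by (subst ln_le_cancel_iff) auto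
        also have "\<dots> = 2 * ln z" using zp by (simp add: ln_realpow)
        also have "\<dots> = 2 * (log 2 z * ln 2)" by (simp add: log_def)
        also have "\<dots> \<le> 2 * (L * 1)"
          using L ln_le_minus_one[of "2::real"] by (intro mult_left_mono mult_mono) auto
        finally show ?thesis by simp
      qed
      \<comment> \<open>This is where the factor \<open>L\<^sup>2\<close> in \<open>k\<close> pays:
        the product is \<open>n / (8192 * L)\<close>, and the remaining \<open>1 / L\<close> absorbs
        the logarithm \<open>ln (8 * k) \<le> 2 * L\<close> of the coupon collector.\<close>
      have ku: "k * u = z * sqrt (real N) / (8 * 1024 * L)"
      proof -
        have "(k * u)\<^sup>2 = (z * sqrt (real N) / (8 * 1024 * L))\<^sup>2"
          using k1 by (simp add: power_mult_distrib power_divide u(2)) (simp add: k_def c_def power2_eq_square)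
        thus ?thesis using k1 u(1) zp L(1) by (subst (asm) power2_eq_iff_nonneg) auto
      qed
      have zN: "z * sqrt (real N) = real n" using Np by (simp add: z_def)
      have "real (J * (2 * T + 1)) = real J * (2 * real T + 1)" by (simp add: distrib_left)
      also have "\<dots> \<le> (512 * (k * ln (8 * k))) * (4 * u)"
        using J2 kl T1(2) by (intro mult_mono) auto
      also have "\<dots> = 2048 * (k * u) * ln (8 * k)" by simp
      also have "\<dots> \<le> 2048 * (k * u) * (2 * L)" using lnk k1 u(1) by (intro mult_left_mono) auto
      also have "\<dots> = real n / 2" unfolding ku zN using L(1) by simp
      finally show ?thesis .
    qed
    have bn: "2 \<le> b * real n"
    proof -
      have "2 / b * 1 \<le> z * sqrt (real N)" using z(2) zp N b by (intro mult_mono) auto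
      hence "2 / b \<le> real n" using Np by (simp add: z_def)
      thus ?thesis using b(1) by (simp add: field_simps)
    qed
    define X where "X = (\<lambda>l. b * real n * r ^ l)"
    \<comment> \<open>The levels below \<Lambda> are those with a budget \<open>X l\<close> of at
      least 2, so that a counter with \<open>\<delta> l \<ge> 1\<close> qubits is
      affordable.\<close>
    define \<Lambda> where "\<Lambda> = Suc (nat \<lfloor>log 2 (b * real n / 2) / \<kappa>\<rfloor>)"
    have lb: "0 \<le> log 2 (b * real n / 2)" using bn by simp
    have X2: "2 \<le> X l" if "l < \<Lambda>" for l
    proof -
      have "real l \<le> log 2 (b * real n / 2) / \<kappa>"
      proof -
        have "l \<le> nat \<lfloor>log 2 (b * real n / 2) / \<kappa>\<rfloor>" using that by (simp add: \<Lambda>_def)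
        thus ?thesis using lb \<kappa>(1) by (simp add: le_nat_floor le_nat_iff le_floor_iff)
      qed
      hence "\<kappa> * real l \<le> log 2 (b * real n / 2)" using \<kappa>(1) by (simp add: field_simps)
      hence "2 powr (\<kappa> * real l) \<le> b * real n / 2" using bn by (simp add: le_log_iff)
      hence "2 * 2 powr (\<kappa> * real l) * 2 powr (- \<kappa> * real l) \<le> b * real n * 2 powr (- \<kappa> * real l)"
        by (intro mult_right_mono) auto
      moreover have "2 powr (\<kappa> * real l) * 2 powr (- \<kappa> * real l) = (1::real)" by (simp flip: powr_add)
      ultimately have "2 * 1 \<le> b * real n * 2 powr (- \<kappa> * real l)" by (simp only: mult.assoc)
      thus ?thesis unfolding X_def pow2[symmetric] by simp
    qed
    have "\<forall>l. \<exists>d. l < \<Lambda> \<longrightarrow> d \<ge> 1 \<and> 2 ^ d \<le> X l \<and> X l < 2 * 2 ^ d"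
    proof
      fix l
      show "\<exists>d. l < \<Lambda> \<longrightarrow> d \<ge> 1 \<and> 2 ^ d \<le> X l \<and> X l < 2 * 2 ^ d"
      proof (cases "l < \<Lambda>")
        case True
        define d where "d = nat \<lfloor>log 2 (X l)\<rfloor>"
        have x: "X l \<ge> 2" by (rule X2[OF True])
        hence lx: "1 \<le> log 2 (X l)" by simp
        have d: "real d \<le> log 2 (X l)" "log 2 (X l) < real d + 1" "d \<ge> 1" using lx unfolding d_def by linarith+
        have "2 powr real d \<le> X l" using d(1) x by (simp add: le_log_iff)
        moreover have "X l < 2 powr (real d + 1)" using d(2) x by (simp add: log_less_iff)
        ultimately have "2 ^ d \<le> X l" "X l < 2 * 2 ^ d" by (simp_all add: powr_realpow powr_add)
        thus ?thesis using d(3) by blast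
      qed auto
    qed
    from choice[OF this] obtain \<delta> where \<delta>: "\<And>l. l < \<Lambda> \<Longrightarrow> \<delta> l \<ge> 1"
      "\<And>l. l < \<Lambda> \<Longrightarrow> 2 ^ \<delta> l \<le> X l" "\<And>l. l < \<Lambda> \<Longrightarrow> X l < 2 * 2 ^ \<delta> l" by blast
    \<comment> \<open>The product \<open>2 ^ \<delta> l * \<epsilon> l\<close> is
      \<open>S / r ^ l\<close> exactly, whatever was lost in rounding the budget to a power of
      2.\<close>
    define \<epsilon> where "\<epsilon> = (\<lambda>l. S / (r ^ l * 2 ^ \<delta> l))"
    have \<epsilon>0: "\<epsilon> l > 0" for l using S(1) r(1) by (simp add: \<epsilon>_def)
    have \<epsilon>le: "\<epsilon> l \<le> C1 / real n / (r ^ l)\<^sup>2" if "l < \<Lambda>" for l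
    proof -
      have "\<epsilon> l \<le> S / (r ^ l * (X l / 2))"
        unfolding \<epsilon>_def using S(1) r(1) \<delta>(3)[OF that] X2[OF that] by (intro divide_left_mono mult_left_mono mult_pos_pos) auto
      also have "\<dots> = C1 / real n / (r ^ l)\<^sup>2" using b(1) np r(1) by (simp add: X_def C1_def power2_eq_square field_simps)
      finally show ?thesis .
    qed
    have geo: "(\<Sum>l<\<Lambda>. r ^ l) \<le> 1 / (8 * b)" using sum_geometric_le[of r \<Lambda>] r b(3) by simp
    have est1: "(\<Sum>l<\<Lambda>. 4 * pi\<^sup>2 / (2 ^ \<delta> l * \<epsilon> l)\<^sup>2) \<le> 1 / 8"
    proof -
      have "(\<Sum>l<\<Lambda>. 4 * pi\<^sup>2 / (2 ^ \<delta> l * \<epsilon> l)\<^sup>2) \<le> (\<Sum>l<\<Lambda>. b * r ^ l)"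
      proof (intro sum_mono)
        fix l
        have "2 ^ \<delta> l * \<epsilon> l = S / r ^ l" by (simp add: \<epsilon>_def)
        hence "4 * pi\<^sup>2 / (2 ^ \<delta> l * \<epsilon> l)\<^sup>2 = 4 * pi\<^sup>2 / 64 * b * (r ^ l)\<^sup>2" using b(1) by (simp add: power_divide S(2))
        also have "\<dots> \<le> 1 * b * (r ^ l * 1)"
        proof (intro mult_mono)
          have "pi\<^sup>2 \<le> 4\<^sup>2" using pi_less_4 pi_ge_zero by (intro power_mono) auto
          thus "4 * pi\<^sup>2 / 64 \<le> 1" by simp
          show "(r ^ l)\<^sup>2 \<le> r ^ l * 1" unfolding power2_eq_square using r by (intro mult_left_mono power_le_one) auto
        qed (use b r in auto)
        finally show "4 * pi\<^sup>2 / (2 ^ \<delta> l * \<epsilon> l)\<^sup>2 \<le> b * r ^ l" by simp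
      qed
      also have "\<dots> = b * (\<Sum>l<\<Lambda>. r ^ l)" by (simp add: sum_distrib_left)
      also have "\<dots> \<le> b * (1 / (8 * b))" using geo b(1) by (intro mult_left_mono) auto
      also have "\<dots> = 1 / 8" using b(1) by simp
      finally show ?thesis .
    qed
    have est2: "J * (2 * T + 1) + (\<Sum>l<\<Lambda>. 4 * 2 ^ \<delta> l) \<le> n"
    proof -
      have "real (\<Sum>l<\<Lambda>. 4 * 2 ^ \<delta> l) \<le> (\<Sum>l<\<Lambda>. 4 * (b * real n) * r ^ l)"
        unfolding of_nat_sum by (intro sum_mono) (use \<delta>(2) in \<open>simp add: X_def mult.assoc\<close>)
      also have "\<dots> = 4 * (b * real n) * (\<Sum>l<\<Lambda>. r ^ l)" by (simp add: sum_distrib_left)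
      also have "\<dots> \<le> 4 * (b * real n) * (1 / (8 * b))" using geo b(1) by (intro mult_left_mono) auto
      also have "\<dots> = real n / 2" using b(1) by simp
      finally have "real (J * (2 * T + 1) + (\<Sum>l<\<Lambda>. 4 * 2 ^ \<delta> l)) \<le> real n" using find3 by simp
      thus ?thesis by (simp only: of_nat_le_iff)
    qed
    \<comment> \<open>The target error. It also serves as the rounding error \<eta> of
      \<open>upper_core\<close>, which may be any positive number.\<close>
    define E where "E = t / (real N * L)"
    have E: "E > 0" using t Np L(1) by (simp add: E_def)
    have tn2: "t / (real n)\<^sup>2 \<le> E"
    proof -
      have "real N * L \<le> real N * z\<^sup>2"
      proof (intro mult_left_mono)
        have "L * 1 \<le> z * z" using L by (intro mult_mono) auto
        thus "L \<le> z\<^sup>2" by (simp add: power2_eq_square)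
      qed auto
      also have "\<dots> = (real n)\<^sup>2" using Np by (simp add: z2)
      finally show ?thesis unfolding E_def using t Np L(1) np by (intro divide_left_mono mult_pos_pos) auto
    qed
    have half: "(1 / 2 :: real) ^ l = (r ^ l) powr (1 / \<kappa>)" for l
    proof -
      have "(r ^ l) powr (1 / \<kappa>) = 2 powr (- \<kappa> * real l * (1 / \<kappa>))" by (simp only: pow2[symmetric] powr_powr)
      also have "\<dots> = 2 powr (- real l)" using \<kappa>(1) by simp
      also have "\<dots> = (1 / 2) ^ l" by (simp add: powr_minus powr_realpow power_one_over inverse_eq_divide)
      finally show ?thesis by simp
    qed
    have level: "2 * (t / 2 ^ l * (\<epsilon> l * sqrt ((t / 2 ^ l / 2) powr (- p)) + (\<epsilon> l)\<^sup>2)) \<le> (4 * C1 + 2 * C1\<^sup>2) * E * r ^ l"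
      if l: "l < \<Lambda>" for l
    proof -
      have rl: "r ^ l > 0" "r ^ l \<le> 1" using r by (auto intro: power_le_one)
      define K where "K = (t / 2 ^ l / 2) powr (- p)"
      have K: "K = 2 powr (p * (real l + 1)) * (k / real N)"
      proof -
        have "t / 2 ^ l / 2 = t * 2 powr (- (real l + 1))"
        proof -
          have "2 powr (- (real l + 1)) = (inverse (2 powr real l * 2 powr 1) :: real)" by (simp only: powr_minus powr_add)
          thus ?thesis by (simp add: powr_realpow inverse_eq_divide)
        qed
        thus ?thesis using t by (simp add: K_def powr_mult powr_powr tp algebra_simps)
      qed
      have sK: "sqrt K = 2 powr (p / 2 * (real l + 1)) * (z / (1024 * L * sqrt (real N)))"
      proof -
        have "(z / (1024 * L * sqrt (real N)))\<^sup>2 = k / real N"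
          using Np by (simp add: power_divide power_mult_distrib k_def c_def)
        moreover have "(2 powr (p / 2 * (real l + 1)))\<^sup>2 = (2 powr (p * (real l + 1)) :: real)"
          by (simp add: power2_eq_square flip: powr_add)
        ultimately have "(2 powr (p / 2 * (real l + 1)) * (z / (1024 * L * sqrt (real N))))\<^sup>2 = K"
          by (simp only: power_mult_distrib K)
        thus ?thesis using zp L(1) by (intro real_sqrt_unique) auto
      qed
      have zn: "z / sqrt (real N) = real n / real N" using Np by (simp add: z_def)
      have first: "t / 2 ^ l * (\<epsilon> l * sqrt K) \<le> 2 * C1 * E * r ^ l"
      proof -
        have "t / 2 ^ l * (\<epsilon> l * sqrt K) \<le> t / 2 ^ l * (C1 / real n / (r ^ l)\<^sup>2 * sqrt K)"
          using t \<epsilon>le[OF l] K Np k1 by (intro mult_left_mono mult_right_mono) auto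
        also have "\<dots> = C1 * t * (1 / 1024 / L) * ((z / sqrt (real N)) / real n) * ((1 / 2) ^ l * 2 powr (p / 2 * (real l + 1)) / (r ^ l)\<^sup>2)"
          unfolding sK by (simp add: power_one_over field_simps)
        \<comment> \<open>The height \<open>2 powr (- l)\<close> times the square root of the
          density gives the four factors \<open>r ^ l\<close>; dividing by
          \<open>(r ^ l)\<^sup>2\<close> from \<epsilon> leaves two.\<close>
        also have "(1 / 2) ^ l * 2 powr (p / 2 * (real l + 1)) / (r ^ l)\<^sup>2 = 2 powr (p / 2) * (r ^ l)\<^sup>2"
        proof -
          have "(1 / 2) ^ l = (2 powr (- real l) :: real)" by (simp add: powr_minus powr_realpow power_one_over inverse_eq_divide)
          hence "(1 / 2) ^ l * 2 powr (p / 2 * (real l + 1)) = 2 powr (- real l + p / 2 * (real l + 1))"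
            by (simp only: powr_add)
          also have "- real l + p / 2 * (real l + 1) = p / 2 + - (1 - p / 2) * real l" by (simp add: algebra_simps)
          also have "2 powr (p / 2 + - (1 - p / 2) * real l) = 2 powr (p / 2) * 2 powr (- (1 - p / 2) * real l)"
            by (rule powr_add)
          also have "2 powr (- (1 - p / 2) * real l) = (2 powr (- \<kappa> * real l)) powr 4"
            unfolding \<kappa>(3) by (simp add: powr_powr mult_ac)
          also have "\<dots> = (r ^ l) ^ 4" unfolding pow2 using rl by simp
          also have "\<dots> = (r ^ l)\<^sup>2 * (r ^ l)\<^sup>2" by (simp flip: power_add)
          finally have e: "(1 / 2) ^ l * 2 powr (p / 2 * (real l + 1)) = 2 powr (p / 2) * ((r ^ l)\<^sup>2 * (r ^ l)\<^sup>2)" .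
          have "A * (x * x) / x = A * x" if "x \<noteq> 0" for A x :: real using that by simp
          thus ?thesis unfolding e using rl by (metis less_irrefl zero_less_power)
        qed
        also have "z / sqrt (real N) / real n = 1 / real N" unfolding zn using np by simp
        also have "C1 * t * (1 / 1024 / L) * (1 / real N) * (2 powr (p / 2) * (r ^ l)\<^sup>2) = C1 * E * (2 powr (p / 2) / 1024 * (r ^ l)\<^sup>2)"
          by (simp add: E_def)
        also have "\<dots> \<le> C1 * E * (2 * r ^ l)"
        proof (intro mult_left_mono mult_mono)
          have "2 powr (p / 2) \<le> (2 powr 1 :: real)" using p by (intro powr_mono) auto
          thus "2 powr (p / 2) / 1024 \<le> (2::real)" by simp
          show "(r ^ l)\<^sup>2 \<le> r ^ l" using rl by (simp add: power2_eq_square mult_left_le)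
        qed (use C1 E in auto)
        finally show ?thesis by simp
      qed
      have second: "t / 2 ^ l * (\<epsilon> l)\<^sup>2 \<le> C1\<^sup>2 * E * r ^ l"
      proof -
        have "(\<epsilon> l)\<^sup>2 \<le> (C1 / real n / (r ^ l)\<^sup>2)\<^sup>2" using \<epsilon>le[OF l] \<epsilon>0[of l] by (intro power_mono) auto
        hence "t / 2 ^ l * (\<epsilon> l)\<^sup>2 \<le> t / 2 ^ l * (C1 / real n / (r ^ l)\<^sup>2)\<^sup>2" using t by (intro mult_left_mono) auto
        also have "\<dots> = C1\<^sup>2 * (t / (real n)\<^sup>2) * ((1 / 2) ^ l / (r ^ l) ^ 4)"
          by (simp add: power_divide power_one_over field_simps flip: power_mult)
        also have "\<dots> \<le> C1\<^sup>2 * E * (r ^ l)"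
        proof (intro mult_mono tn2 mult_left_mono)
          \<comment> \<open>The quadratic term has the height alone as decay and loses
            \<open>(r ^ l) ^ 4\<close> to \<open>\<epsilon>\<^sup>2\<close>. One factor survives
            because \<open>1 / \<kappa> \<ge> 8\<close>, a consequence of
            \<open>p \<ge> 1\<close>.\<close>
          have "(r ^ l) powr (1 / \<kappa>) \<le> (r ^ l) powr 5"
          proof (rule powr_mono')
            show "5 \<le> 1 / \<kappa>" using \<kappa>(1,2) by (simp add: field_simps)
          qed (use rl in auto)
          also have "\<dots> = (r ^ l) ^ 5" using rl by simp
          also have "\<dots> = r ^ l * (r ^ l) ^ 4" by (simp add: numeral_eq_Suc)
          finally show "(1 / 2) ^ l / (r ^ l) ^ 4 \<le> r ^ l" unfolding half using rl by (simp add: divide_le_eq)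
        qed (use E t rl in auto)
        finally show ?thesis .
      qed
      have "2 * (t / 2 ^ l * (\<epsilon> l * sqrt K + (\<epsilon> l)\<^sup>2)) = 2 * (t / 2 ^ l * (\<epsilon> l * sqrt K)) + 2 * (t / 2 ^ l * (\<epsilon> l)\<^sup>2)"
        by (simp only: distrib_left)
      also have "\<dots> \<le> 2 * (2 * C1 * E * r ^ l) + 2 * (C1\<^sup>2 * E * r ^ l)"
        using first second by linarith
      also have "\<dots> = (4 * C1 + 2 * C1\<^sup>2) * E * r ^ l" by (simp add: algebra_simps)
      finally show ?thesis unfolding K_def .
    qed
    \<comment> \<open>The levels stop when \<open>r ^ \<Lambda>\<close> is of order
      \<open>1 / n\<close>. Since \<open>2 ^ \<Lambda>\<close> is at least the square of
      \<open>1 / r ^ \<Lambda>\<close>, ignoring all smaller values costs only of order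
      \<open>t / n\<^sup>2\<close>.\<close>
    have rest: "t / 2 ^ \<Lambda> \<le> 4 / b\<^sup>2 * E"
    proof -
      have "log 2 (b * real n / 2) / \<kappa> \<le> real \<Lambda>" unfolding \<Lambda>_def by linarith
      hence "log 2 (b * real n / 2) \<le> \<kappa> * real \<Lambda>" using \<kappa>(1) by (simp add: field_simps)
      hence "b * real n / 2 \<le> 2 powr (\<kappa> * real \<Lambda>)" using bn by (simp add: log_le_iff)
      hence "r ^ \<Lambda> \<le> 2 / (b * real n)" unfolding pow2[symmetric] using b(1) np bn by (simp add: powr_minus field_simps)
      have rL: "0 < r ^ \<Lambda>" "r ^ \<Lambda> \<le> 1" using r by (auto intro: power_le_one)
      have "(1 / 2) ^ \<Lambda> \<le> (r ^ \<Lambda>) powr 2" unfolding half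
      proof (rule powr_mono')
        show "2 \<le> 1 / \<kappa>" using \<kappa>(1,2) by (simp add: field_simps)
      qed (use rL in auto)
      also have "\<dots> = (r ^ \<Lambda>)\<^sup>2" using rL by simp
      also have "\<dots> \<le> (2 / (b * real n))\<^sup>2" using \<open>r ^ \<Lambda> \<le> 2 / (b * real n)\<close> rL by (intro power_mono) auto
      finally have "t * (1 / 2) ^ \<Lambda> \<le> t * (2 / (b * real n))\<^sup>2" using t by (intro mult_left_mono) auto
      also have "\<dots> = 4 / b\<^sup>2 * (t / (real n)\<^sup>2)" by (simp add: power_divide power_mult_distrib)
      also have "\<dots> \<le> 4 / b\<^sup>2 * E" using tn2 by (intro mult_left_mono) auto
      finally show ?thesis by (simp add: power_one_over)
    qed
    have "min_query_err n {..<N} (sumN N) (Lp_ball p N)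
      \<le> (\<Sum>l<\<Lambda>. 2 * (t / 2 ^ l * (\<epsilon> l * sqrt ((t / 2 ^ l / 2) powr (- p)) + (\<epsilon> l)\<^sup>2))) + t / 2 ^ \<Lambda> + E"
      by (rule upper_core[OF p(1) N t J \<delta>(1) \<epsilon>0 E]) (use k1 find1 find2 est1 est2 in \<open>simp_all only: ktN\<close>)
    also have "\<dots> \<le> (\<Sum>l<\<Lambda>. (4 * C1 + 2 * C1\<^sup>2) * E * r ^ l) + 4 / b\<^sup>2 * E + E"
      by (intro add_mono sum_mono level rest) auto
    also have "(\<Sum>l<\<Lambda>. (4 * C1 + 2 * C1\<^sup>2) * E * r ^ l) = (4 * C1 + 2 * C1\<^sup>2) * E * (\<Sum>l<\<Lambda>. r ^ l)"
      by (simp add: sum_distrib_left)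
    also have "(4 * C1 + 2 * C1\<^sup>2) * E * (\<Sum>l<\<Lambda>. r ^ l) \<le> (4 * C1 + 2 * C1\<^sup>2) * E * (1 / (8 * b))"
      using geo C1 E by (intro mult_left_mono) auto
    also have "(4 * C1 + 2 * C1\<^sup>2) * E * (1 / (8 * b)) + 4 / b\<^sup>2 * E + E = C3 * E"
      by (simp add: C3_def distrib_right)
    \<comment> \<open>The threshold contributes \<open>L powr (2 / p)\<close> and the division by
      \<open>L\<close> in \<open>E\<close> lowers the exponent to \<open>2 / p - 1\<close>.\<close>
    also have "E = c powr (- 1 / p) * real n powr (-2 / p) * real N powr (2 / p - 1) * L powr (2 / p - 1)"
    proof -
      have "real N / k = c powr (-1) * real n powr (-2) * real N powr 2 * L powr 2"
        unfolding k_def z2 c_def using Np np L(1) by (simp add: powr_minus field_simps power2_eq_square)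
      hence "t = c powr (- 1 / p) * real n powr (-2 / p) * real N powr (2 / p) * L powr (2 / p)"
        unfolding t_def by (simp only: powr_mult powr_powr) simp
      moreover have "real N powr (2 / p - 1) = real N powr (2 / p) / real N" "L powr (2 / p - 1) = L powr (2 / p) / L"
        using Np L(1) by (simp_all add: powr_diff)
      ultimately show ?thesis by (simp add: E_def)
    qed
    finally show ?thesis unfolding L_def z_def by (simp add: mult.assoc)
  qed
  show ?thesis
  proof (intro exI conjI allI impI)
    show "c0 \<ge> 1" by (simp add: c0_def)
    show "C3 * c powr (- 1 / p) > 0" using C3 by (simp add: c_def)
  qed (use main in blast)
qed

theorem theorem2:
  fixes p :: real
  assumes "1 \<le> p" and "p < 2"
  shows "\<exists>c0 c1 c2 c3 :: real. c0 > 0 \<and> c1 > 0 \<and> c2 > 0 \<and> c3 > 0 \<and>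
    (\<forall>n N :: nat. n \<ge> 1 \<and> N \<ge> 1 \<and> c0 * sqrt (real N) \<le> real n \<and> real n \<le> c1 * real N \<longrightarrow>
       c2 * real n powr (-2 / p) * real N powr (2 / p - 1)
         \<le> min_query_err n {..<N} (sumN N) (Lp_ball p N) \<and>
       min_query_err n {..<N} (sumN N) (Lp_ball p N)
         \<le> c3 * real n powr (-2 / p) * real N powr (2 / p - 1)
              * max (log 2 (real n / sqrt (real N))) 1 powr (2 / p - 1))"
proof -
  obtain c0 C where U: "c0 \<ge> 1" "C > 0" "\<And>n N :: nat. n \<ge> 1 \<and> N \<ge> 1 \<and> c0 * sqrt (real N) \<le> real n \<and> real n \<le> real N \<Longrightarrow>
     min_query_err n {..<N} (sumN N) (Lp_ball p N)
       \<le> C * real n powr (-2 / p) * real N powr (2 / p - 1) * max (log 2 (real n / sqrt (real N))) 1 powr (2 / p - 1)"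
    using upper_bound_ex[OF assms] by blast
  show ?thesis
  proof (rule exI[of _ c0], rule exI[of _ "1/64"], rule exI[of _ "1/2 * 1000 powr (- 1 / p)"], rule exI[of _ C],
      intro conjI allI impI)
    fix n N :: nat
    assume h: "n \<ge> 1 \<and> N \<ge> 1 \<and> c0 * sqrt (real N) \<le> real n \<and> real n \<le> 1/64 * real N"
    \<comment> \<open>The lower bound asks only for \<open>sqrt N \<le> n\<close>; the larger
      \<open>c0\<close> is dictated by the upper bound, and \<open>1/64\<close> by the lower
      one.\<close>
    have "1 * sqrt (real N) \<le> c0 * sqrt (real N)" using U(1) by (intro mult_right_mono) auto
    hence "64 * sqrt (real N) \<le> 64 * real n" using h by linarith
    thus "1/2 * 1000 powr (- 1 / p) * real n powr (-2 / p) * real N powr (2 / p - 1) \<le> min_query_err n {..<N} (sumN N) (Lp_ball p N)"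
      by (intro lower_bound) (use assms h in auto)
    show "min_query_err n {..<N} (sumN N) (Lp_ball p N)
       \<le> C * real n powr (-2 / p) * real N powr (2 / p - 1) * max (log 2 (real n / sqrt (real N))) 1 powr (2 / p - 1)"
      by (rule U(3)) (use h in auto)
  qed (use U in auto)
qed

end
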